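(* Let $\mathfrak Q$ be an $\mathscr F$-Boltzmann map for $\ell=1$. The random map $\mathsf Q$ (defined from $\mathfrak Q$ through the right process, see context) is an $\mathscr F$-stopping map for $\mathscr F$ the natural filtration of $\mathfrak Q$; thus it satisfies the Markov property, i.e. $\mathfrak Q=\mathsf Q\odot(\mathfrak Q_h^{\mathsf Q})_{h\in H(\mathsf Q)}$ where, conditionally on $\mathcal F_{\mathsf Q}$, $(\mathfrak Q_h^{\mathsf Q})_{h\in H(\mathsf Q)}$ is a collection of independent $q$-Boltzmann maps with boundary $h$ (perimeter $\deg h$).
   Context: A planar map is a finite connected graph properly embedded in the sphere with a distinguished oriented edge (the root edge). Each edge consists of two semi-edges, one per side. The root face is the face to the right of the root edge; its degree is the perimeter. A quadrangulation with boundary is a planar map in which all faces, except possibly the root face, are surrounded by 4 semi-edges; $\mathcal Q^\ell$ denotes those of perimeter $2\ell$, and $|F(\mathfrak q)|$ the number of interior (non-root) faces. A quadrangulation with holes is a planar map with boundary which has distinguished faces, called holes, which need not be squares, each one with a marked oriented edge, all non-distinguished interior faces being surrounded by 4 semi-edges. $H(\mathfrak q)$: set of holes; $\mathcal Q_H$: set of quadrangulations with holes. Gluing $\mathfrak q\odot(\mathfrak u_h)_{h\in H(\mathfrak q)}$ ($\mathfrak u_h$, possibly with holes, of perimeter $\deg h$): identify the root edge of $\mathfrak u_h$ with the marked edge of $h$ and, following the orientation, the boundary edges of $\mathfrak u_h$ with the edges of $h$; the root and boundary of $\mathfrak q$ are kept. $\mathfrak q\subset\mathfrak p$ means $\mathfrak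 p=\mathfrak q\odot(\mathfrak u_h)_h$ for some (then uniquely defined) $(\mathfrak u_h)_h=:(\mathfrak p^{\mathfrak q}_h)_h$. There is a minimal element, the empty map $\dagger$ (cemetery), with $\dagger\subset\mathfrak q$ for all $\mathfrak q\in\mathcal Q_H$. $q$-Boltzmann map with half-perimeter $\ell$ ($q>0$ with finite normalisation): random $\mathfrak Q\in\mathcal Q^\ell$ with $\mathbb P(\mathfrak Q=\mathfrak q)\propto q^{|F(\mathfrak q)|}$. A filtration is a collection $\mathscr F=(\mathcal F_{\mathfrak q})_{\mathfrak q\in\mathcal Q_H}$ of $\mathbb P$-complete $\sigma$-algebras with $\mathcal F_{\mathfrak q_1}\subseteq\mathcal F_{\mathfrak q_2}$ if $\mathfrak q_1\subset\mathfrak q_2$. $\mathfrak Q$ is an $\mathscr F$-Boltzmann map if for every $\mathfrak q\in\mathcal Q_H$: $\{\mathfrak q\subset\mathfrak Q\}\in\mathcal F_{\mathfrak q}$; and conditionally on $\mathcal F_{\mathfrak q}$ and $\{\mathfrak q\subset\mathfrak Q\}$, $(\mathfrak Q^{\mathfrak q}_h)_{h\in H(\mathfrak q)}$ are independent $q$-Boltzmann maps with boundary $h$. The natural filtration of $\mathfrak Q$ is $\mathcal F_{\mathfrak q}=$ the $\mathbb P$-completion of $\bigvee_{\mathfrak p\subset\mathfrak q}\sigma(\{\mathfrak p\subset\mathfrak Q\})$. A random map with holes $\mathsf Q$ is an $\mathscr F$-stopping map for $\mathfrak Q$ if almost surely $\mathsf Q\subset\mathfrak Q$ and $\{\mathsf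 Q\subset\mathfrak q\}\in\mathcal F_{\mathfrak q}$ for any $\mathfrak q\in\mathcal Q_H$; $\mathcal F_{\mathsf Q}=\{\Theta\in\bigvee_{\mathfrak q}\mathcal F_{\mathfrak q}:\Theta\cap\{\mathsf Q\subset\mathfrak q\}\in\mathcal F_{\mathfrak q}\text{ for any }\mathfrak q\in\mathcal Q_H\}$. Definition of $\mathsf Q$. Work on the dual map of $\mathfrak Q$ (its vertices are the faces of $\mathfrak Q$ and its edges are dual to those of $\mathfrak Q$; the root vertex is dual to the root face). Exploring the dual, each step discovers a dual vertex together with the half-edges adjacent to it. Right process: starting from the root vertex, explore the map by taking the rightmost dual edge that has not been visited, up to the first (and only) return to the root vertex. Let $x_0$ be the root vertex and $x_i$ the dual vertices visited, in chronological order, up to $\tau_E^R$, the first time this process comes back to the root vertex. Define $$\tau_I^R=\inf\{i\in\{1,\dots,\tau_E^R\}:x_i=x_j\text{ for some }j\ne i,\ j\in\{1,\dots,\tau_E^R\}\},\qquad \tau^R=\sup\{i\in\mathbb N:x_i=x_{\tau_I^R}\}.$$ $\mathsf Q$ is the map discovered when following the sequence of edges in the cycle $x_0,\dots,x_{\tau_I^R}$ followed by $x_{\tau^R},\dots,x_{\tau_E^R}$; that is, the submap visited between the first and last visit of the first self-intersection point of the right process is suppressed. This is analogous to running the right process up to $\tau_I^R$ and then running the left process (the same with the leftmost edge) up to hitting $x_{\tau_I^R}$ for the first time.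
   Formalization: Quadrangulations with holes are restricted to those where no edge has holes on both sides and the non-hole faces are connected across non-hole edges; otherwise the gluing may not be a planar map or the fillings are not uniquely defined (e.g. two 2-gon holes sharing an edge). *)

theory Defs
  imports "HOL-Probability.Probability" "HOL-Combinatorics.Orbits"
begin

section \<open>Rooted planar maps with holes\<close>

text \<open>
  Maps are encoded combinatorially, up to relabelling.  A dart is a semi-edge, i.e. one side of an
  edge.  It lies on exactly one face and is oriented so that this face is on its right; in this way
  darts also stand for oriented edges.  \<open>opp\<close> exchanges the two sides of an edge and \<open>nxt\<close> is the
  next dart along the boundary of the face on the right.  The orbits of \<open>nxt\<close> are the faces and
  those of \<open>nxt \<circ> opp\<close> are the vertices (each vertex being the set of darts that leave it).
  The root face is the face of the dart \<open>rootd\<close>.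

  \<open>marks\<close> contains one dart on each hole.  If \<open>h \<in> marks\<close>, the marked oriented edge of the hole is
  \<open>opp h\<close>: it has the hole on its left, so that it is identified with the root edge of the
  map glued into the hole, whose outside is on its right.
\<close>

record 'd pmap =
  darts :: "'d set"
  opp :: "'d \<Rightarrow> 'd"
  nxt :: "'d \<Rightarrow> 'd"
  rootd :: 'd
  marks :: "'d set"

definition face :: "'d pmap \<Rightarrow> 'd \<Rightarrow> 'd set" where
  "face m d = orbit (nxt m) d"

definition root_face :: "'d pmap \<Rightarrow> 'd set" where
  "root_face m = face m (rootd m)"

definition faces :: "'d pmap \<Rightarrow> 'd set set" where
  "faces m = face m ` darts m"

definition verts :: "'d pmap \<Rightarrow> 'd set set" where
  "verts m = orbit (nxt m \<circ> opp m) ` darts m"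

definition edges :: "'d pmap \<Rightarrow> 'd set set" where
  "edges m = (\<lambda>d. {d, opp m d}) ` darts m"

definition hole_darts :: "'d pmap \<Rightarrow> 'd set" where
  "hole_darts m = (\<Union>h\<in>marks m. face m h)"

text \<open>\<open>linked m A\<close>: the darts of \<open>A\<close> are connected within \<open>A\<close>, moving along faces and across edges.\<close>

definition linked :: "'d pmap \<Rightarrow> 'd set \<Rightarrow> bool" where
  "linked m A \<longleftrightarrow>
    (\<forall>x\<in>A. \<forall>y\<in>A. (x, y) \<in> {(c, d). c \<in> A \<and> d \<in> A \<and> (d = nxt m c \<or> d = opp m c)}\<^sup>*)"

text \<open>Finite connected maps on the sphere; genus zero is Euler's formula.\<close>

definition planar_map :: "'d pmap \<Rightarrow> bool" where
  "planar_map m \<longleftrightarrow>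
     finite (darts m) \<and> rootd m \<in> darts m \<and>
     opp m permutes darts m \<and> nxt m permutes darts m \<and>
     (\<forall>d\<in>darts m. opp m d \<noteq> d \<and> opp m (opp m d) = d) \<and>
     linked m (darts m) \<and>
     int (card (verts m)) - int (card (edges m)) + int (card (faces m)) = 2"

text \<open>
  Quadrangulations with holes.  The last two conditions (no edge has holes on both sides, and the
  faces that are not holes are connected through the edges not on a hole) are the standing
  conventions under which gluing is meaningful: without them (say for a hole with a pinch point)
  the result of gluing need not be a planar map, and the glued maps need not be determined by the
  result.  No condition is put on the maps glued in; in particular their boundary need not be simple.
\<close>

definition quad_with_holes :: "'d pmap \<Rightarrow> bool" where
  "quad_with_holes m \<longleftrightarrow>
     planar_map m \<and>
     marks m \<subseteq> darts m \<and> inj_on (face m) (marks m) \<and> rootd m \<notin> hole_darts m \<and>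
     (\<forall>d \<in> darts m - root_face m - hole_darts m. card (face m d) = 4) \<and>
     (\<forall>d \<in> hole_darts m. opp m d \<notin> hole_darts m) \<and>
     linked m (darts m - hole_darts m)"

definition rooted_iso :: "('a \<Rightarrow> 'b) \<Rightarrow> 'a pmap \<Rightarrow> 'b pmap \<Rightarrow> bool" where
  "rooted_iso f m m' \<longleftrightarrow>
     bij_betw f (darts m) (darts m') \<and> f (rootd m) = rootd m' \<and>
     (\<forall>d\<in>darts m. f (opp m d) = opp m' (f d) \<and> f (nxt m d) = nxt m' (f d))"

definition map_iso :: "'a pmap \<Rightarrow> 'b pmap \<Rightarrow> bool" where
  "map_iso m m' \<longleftrightarrow> (\<exists>f. rooted_iso f m m' \<and> f ` marks m = marks m')"

lemma map_iso_refl: "map_iso m m"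
  unfolding map_iso_def rooted_iso_def by (rule exI[of _ id]) auto

lemma map_iso_sym:
  assumes q: "quad_with_holes m" and i: "map_iso m m'"
  shows "map_iso m' m"
proof -
  obtain f where f: "bij_betw f (darts m) (darts m')" "f (rootd m) = rootd m'"
    "\<And>d. d \<in> darts m \<Longrightarrow> f (opp m d) = opp m' (f d) \<and> f (nxt m d) = nxt m' (f d)"
    "f ` marks m = marks m'"
    using i unfolding map_iso_def rooted_iso_def by blast
  have pm: "opp m permutes darts m" "nxt m permutes darts m" "rootd m \<in> darts m"
    "marks m \<subseteq> darts m"
    using q unfolding quad_with_holes_def planar_map_def by auto
  define g where "g = the_inv_into (darts m) f"
  have inj: "inj_on f (darts m)" and im: "f ` darts m = darts m'"
    using f(1) by (auto simp: bij_betw_def)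
  have gf: "g (f d) = d" if "d \<in> darts m" for d
    using that inj by (simp add: g_def the_inv_into_f_f)
  have "bij_betw g (darts m') (darts m)"
    unfolding g_def by (rule bij_betw_the_inv_into[OF f(1)])
  moreover have "g (rootd m') = rootd m"
    using f(2) gf pm(3) by metis
  moreover have "g (opp m' e) = opp m (g e) \<and> g (nxt m' e) = nxt m (g e)" if e: "e \<in> darts m'" for e
  proof -
    obtain d where d: "d \<in> darts m" "e = f d" using e im by auto
    have "opp m d \<in> darts m" "nxt m d \<in> darts m"
      using pm d(1) by (auto simp: permutes_in_image)
    then show ?thesis using d f(3)[OF d(1)] gf by metis
  qed
  moreover have "g ` marks m' = marks m"
  proof -
    have "g ` f ` marks m = (\<lambda>d. d) ` marks m"
      unfolding image_image using gf pm(4) by (intro image_cong) auto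
    then show ?thesis using f(4) by simp
  qed
  ultimately show ?thesis unfolding map_iso_def rooted_iso_def by blast
qed

lemma map_iso_trans:
  assumes "map_iso m m'" "map_iso m' m''"
  shows "map_iso m m''"
proof -
  obtain f where f: "rooted_iso f m m'" "f ` marks m = marks m'"
    using assms(1) unfolding map_iso_def by blast
  obtain g where g: "rooted_iso g m' m''" "g ` marks m' = marks m''"
    using assms(2) unfolding map_iso_def by blast
  have "rooted_iso (g \<circ> f) m m''"
    using f(1) g(1) unfolding rooted_iso_def
    by (auto intro: bij_betw_trans dest: bij_betwE)
  moreover have "(g \<circ> f) ` marks m = marks m''"
    using f(2) g(2) by (metis image_comp)
  ultimately show ?thesis unfolding map_iso_def by blast
qed

definition edge_map :: "nat pmap" where
  "edge_map = \<lparr>darts = {0, 1}, opp = Transposition.transpose 0 1, nxt = Transposition.transpose 0 1, rootd = 0, marks = {}\<rparr>"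

lemma quad_with_holes_edge_map: "quad_with_holes edge_map"
proof -
  have t: "Transposition.transpose 0 (1::nat) permutes {0, 1}"
    by (rule permutes_swap_id) auto
  have inv: "Transposition.transpose 0 (1::nat) \<circ> Transposition.transpose 0 1 = id" by (simp add: fun_eq_iff)
  have oid: "orbit id x = {x}" for x :: nat
    by (auto simp: orbit_altdef id_funpow)
  have o: "orbit (Transposition.transpose 0 (1::nat)) x = {0, 1}" if "x = 0 \<or> x = 1" for x
  proof -
    have s: "orbit (Transposition.transpose 0 (1::nat)) x \<subseteq> {0, 1}"
    proof
      fix y assume "y \<in> orbit (Transposition.transpose 0 (1::nat)) x"
      then show "y \<in> {0, 1}" using that by induct auto
    qed
    have "Transposition.transpose 0 1 x \<in> orbit (Transposition.transpose 0 (1::nat)) x" by (rule orbit.base)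
    moreover have "Transposition.transpose 0 1 (Transposition.transpose 0 1 x) \<in> orbit (Transposition.transpose 0 (1::nat)) x"
      by (intro orbit.step orbit.base)
    ultimately show ?thesis using s that by auto
  qed
  have v: "verts edge_map = {{0}, {1}}"
    unfolding verts_def edge_map_def by (simp only: pmap.simps inv) (auto simp: oid)
  have f: "faces edge_map = {{0, 1}}"
    unfolding faces_def face_def edge_map_def by (simp add: o[unfolded One_nat_def])
  have e: "edges edge_map = {{0, 1}}"
    unfolding edges_def edge_map_def by auto
  have l: "linked edge_map {0, 1}"
    unfolding linked_def edge_map_def by (auto intro!: r_into_rtrancl)
  have "planar_map edge_map"
    unfolding planar_map_def v f e using t l by (auto simp: edge_map_def)
  moreover have "hole_darts edge_map = {}" "root_face edge_map = {0, 1}" "darts edge_map = {0, 1}"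
    by (simp_all add: hole_darts_def root_face_def face_def edge_map_def o[unfolded One_nat_def])
  ultimately show ?thesis
    unfolding quad_with_holes_def using l by (simp add: edge_map_def)
qed

text \<open>
  The set of quadrangulations with holes, without the empty map.  The empty map (cemetery) is
  added as \<open>None\<close> of type \<open>hmap option\<close>.
\<close>

quotient_type hmap = "nat pmap" / partial:
  "\<lambda>m m'. quad_with_holes m \<and> quad_with_holes m' \<and> map_iso m m'"
proof (rule part_equivpI)
  show "\<exists>m :: nat pmap. quad_with_holes m \<and> quad_with_holes m \<and> map_iso m m"
    using quad_with_holes_edge_map map_iso_refl by blast
  show "symp (\<lambda>m m' :: nat pmap. quad_with_holes m \<and> quad_with_holes m' \<and> map_iso m m')"
    by (auto intro!: sympI map_iso_sym)
  show "transp (\<lambda>m m' :: nat pmap. quad_with_holes m \<and> quad_with_holes m' \<and> map_iso m m')"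
    by (rule transpI) (blast intro: map_iso_trans)
qed

definition class_of :: "'d pmap \<Rightarrow> hmap" where
  "class_of m = abs_hmap (SOME m'. quad_with_holes m' \<and> map_iso m m')"

text \<open>
  The holes are named by their marked darts in the chosen representative \<open>rep_hmap p\<close>; these names
  serve only as an index set.
\<close>

definition holes :: "hmap \<Rightarrow> nat set" where
  "holes p = marks (rep_hmap p)"

definition hole_deg :: "hmap \<Rightarrow> nat \<Rightarrow> nat" where
  "hole_deg p h = card (face (rep_hmap p) h)"

definition perimeter :: "hmap \<Rightarrow> nat" where
  "perimeter p = card (root_face (rep_hmap p))"

definition quads :: "nat \<Rightarrow> hmap set" where
  "quads n = {p. holes p = {} \<and> perimeter p = n}"

text \<open>The number of interior faces of a map without holes.\<close>

definition nfaces :: "hmap \<Rightarrow> nat" where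
  "nfaces p = card (faces (rep_hmap p) - {root_face (rep_hmap p)})"


section \<open>Gluing and the submap order\<close>

text \<open>
  The darts of the glued map are those of \<open>p\<close> not on a hole (\<open>Inl d\<close>) and those of the \<open>u h\<close> not on
  the root face (\<open>Inr (h, d)\<close>).
\<close>

definition glue_darts :: "'d pmap \<Rightarrow> ('d \<Rightarrow> 'e pmap) \<Rightarrow> ('d + 'd \<times> 'e) set" where
  "glue_darts p u =
     Inl ` (darts p - hole_darts p) \<union>
     (\<Union>h\<in>marks p. (\<lambda>d. Inr (h, d)) ` (darts (u h) - root_face (u h)))"

text \<open>
  The edges to be identified.  Starting from the marked edge and the root edge, the boundary of
  \<open>u h\<close> is followed in the direction of its root, which has the hole on the left and therefore runs
  backwards in the \<open>nxt\<close>-order of the hole.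
\<close>

definition ident :: "'d pmap \<Rightarrow> ('d \<Rightarrow> 'e pmap) \<Rightarrow> ('d + 'd \<times> 'e) rel" where
  "ident p u = {(Inl ((inv (nxt p) ^^ i) h), Inr (h, (nxt (u h) ^^ i) (rootd (u h)))) | h i. h \<in> marks p}"

definition pre_opp :: "'d pmap \<Rightarrow> ('d \<Rightarrow> 'e pmap) \<Rightarrow> 'd + 'd \<times> 'e \<Rightarrow> 'd + 'd \<times> 'e" where
  "pre_opp p u x = (case x of Inl d \<Rightarrow> Inl (opp p d) | Inr (h, d) \<Rightarrow> Inr (h, opp (u h) d))"

text \<open>
  Across an edge of \<open>p\<close> or \<open>u h\<close> one may reach a dart which disappears because it lies on a hole or
  on the root face of \<open>u h\<close>; one then goes on across the edge identified with it, until a surviving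
  dart is reached (several steps occur if an edge of \<open>u h\<close> has its root face on both sides).
\<close>

definition glue_opp :: "'d pmap \<Rightarrow> ('d \<Rightarrow> 'e pmap) \<Rightarrow> 'd + 'd \<times> 'e \<Rightarrow> 'd + 'd \<times> 'e" where
  "glue_opp p u x =
     (let jump = (\<lambda>y. pre_opp p u (THE z. (y, z) \<in> ident p u \<union> (ident p u)\<inverse>));
          k = (LEAST k. (jump ^^ k) (pre_opp p u x) \<in> glue_darts p u)
      in (jump ^^ k) (pre_opp p u x))"

definition glue_pmap :: "'d pmap \<Rightarrow> ('d \<Rightarrow> 'e pmap) \<Rightarrow> ('d + 'd \<times> 'e) pmap" where
  "glue_pmap p u =
     \<lparr>darts = glue_darts p u,
      opp = (\<lambda>x. if x \<in> glue_darts p u then glue_opp p u x else x),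
      nxt = (\<lambda>x. if x \<in> glue_darts p u
                 then (case x of Inl d \<Rightarrow> Inl (nxt p d) | Inr (h, d) \<Rightarrow> Inr (h, nxt (u h) d))
                 else x),
      rootd = Inl (rootd p),
      marks = (\<Union>h\<in>marks p. (\<lambda>d. Inr (h, d)) ` marks (u h))\<rparr>"

definition glue :: "hmap \<Rightarrow> (nat \<Rightarrow> hmap) \<Rightarrow> hmap"  (infixl \<open>\<odot>\<close> 70) where
  "p \<odot> u = class_of (glue_pmap (rep_hmap p) (\<lambda>h. rep_hmap (u h)))"

definition fills :: "hmap \<Rightarrow> (nat \<Rightarrow> hmap) \<Rightarrow> hmap \<Rightarrow> bool" where
  "fills p u p' \<longleftrightarrow> (\<forall>h\<in>holes p. perimeter (u h) = hole_deg p h) \<and> p' = p \<odot> u"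

fun submap :: "hmap option \<Rightarrow> hmap option \<Rightarrow> bool"  (infix \<open>\<sqsubseteq>\<close> 50) where
  "None \<sqsubseteq> y \<longleftrightarrow> True"
| "Some p \<sqsubseteq> None \<longleftrightarrow> False"
| "Some p \<sqsubseteq> Some p' \<longleftrightarrow> (\<exists>u. fills p u p')"

text \<open>The map which \<open>p'\<close> has in the hole \<open>h\<close> of its submap \<open>p\<close>.\<close>

definition filling :: "hmap \<Rightarrow> hmap \<Rightarrow> nat \<Rightarrow> hmap" where
  "filling p p' = (SOME u. fills p u p')"


section \<open>Boltzmann maps, filtrations and stopping maps\<close>

text \<open>The \<open>q\<close>-Boltzmann law on the quadrangulations of perimeter \<open>n\<close> (half-perimeter \<open>n / 2\<close>).\<close>

definition boltzmann :: "real \<Rightarrow> nat \<Rightarrow> hmap measure" where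
  "boltzmann q n = point_measure (quads n)
     (\<lambda>m. ennreal (q ^ nfaces m / (\<Sum>\<^sub>\<infinity>m'\<in>quads n. q ^ nfaces m')))"

definition filtration :: "'w measure \<Rightarrow> (hmap option \<Rightarrow> 'w measure) \<Rightarrow> bool" where
  "filtration M F \<longleftrightarrow>
     (\<forall>x. subalgebra M (F x) \<and> null_sets M \<subseteq> sets (F x)) \<and>
     (\<forall>x y. x \<sqsubseteq> y \<longrightarrow> sets (F x) \<subseteq> sets (F y))"

definition natural_filtration :: "'w measure \<Rightarrow> ('w \<Rightarrow> hmap) \<Rightarrow> hmap option \<Rightarrow> 'w measure" where
  "natural_filtration M X x =
     sigma (space M) ({{\<omega>\<in>space M. y \<sqsubseteq> Some (X \<omega>)} | y. y \<sqsubseteq> x} \<union> null_sets M)"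

text \<open>
  On the event \<open>E\<close>, on which \<open>p\<close> is a submap of \<open>X\<close>, and conditionally on the \<sigma>-algebra \<open>G\<close>, the maps
  that \<open>X\<close> has in the holes of \<open>p\<close> are independent Boltzmann maps.
\<close>

definition cond_indep_boltzmann ::
  "'w measure \<Rightarrow> real \<Rightarrow> 'w measure \<Rightarrow> 'w set \<Rightarrow> hmap \<Rightarrow> ('w \<Rightarrow> hmap) \<Rightarrow> bool" where
  "cond_indep_boltzmann M q G E p X \<longleftrightarrow>
     (\<forall>A. (\<forall>h\<in>holes p. A h \<subseteq> quads (hole_deg p h)) \<longrightarrow>
        (AE \<omega> in M. \<omega> \<in> E \<longrightarrow>
           real_cond_exp M G (indicator (E \<inter> {\<omega>\<in>space M. \<forall>h\<in>holes p. filling p (X \<omega>) h \<in> A h})) \<omega>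
             = (\<Prod>h\<in>holes p. measure (boltzmann q (hole_deg p h)) (A h))))"

text \<open>\<open>X\<close> is an \<open>F\<close>-Boltzmann map of half-perimeter \<open>l\<close>.\<close>

definition F_boltzmann_map ::
  "'w measure \<Rightarrow> real \<Rightarrow> (hmap option \<Rightarrow> 'w measure) \<Rightarrow> nat \<Rightarrow> ('w \<Rightarrow> hmap) \<Rightarrow> bool" where
  "F_boltzmann_map M q F l X \<longleftrightarrow>
     filtration M F \<and>
     X \<in> M \<rightarrow>\<^sub>M count_space (quads (2 * l)) \<and>
     distr M (count_space (quads (2 * l))) X = boltzmann q (2 * l) \<and>
     (\<forall>x. {\<omega>\<in>space M. x \<sqsubseteq> Some (X \<omega>)} \<in> sets (F x)) \<and>
     (\<forall>p. cond_indep_boltzmann M q (F (Some p)) {\<omega>\<in>space M. Some p \<sqsubseteq> Some (X \<omega>)} p X)"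

definition stopping_map ::
  "'w measure \<Rightarrow> (hmap option \<Rightarrow> 'w measure) \<Rightarrow> ('w \<Rightarrow> hmap) \<Rightarrow> ('w \<Rightarrow> hmap option) \<Rightarrow> bool" where
  "stopping_map M F X Q \<longleftrightarrow>
     Q \<in> M \<rightarrow>\<^sub>M count_space UNIV \<and>
     (AE \<omega> in M. Q \<omega> \<sqsubseteq> Some (X \<omega>)) \<and>
     (\<forall>x. {\<omega>\<in>space M. Q \<omega> \<sqsubseteq> x} \<in> sets (F x))"

text \<open>For a stopping map the collection of sets below is already a \<sigma>-algebra.\<close>

definition stopped_algebra ::
  "'w measure \<Rightarrow> (hmap option \<Rightarrow> 'w measure) \<Rightarrow> ('w \<Rightarrow> hmap option) \<Rightarrow> 'w measure" where
  "stopped_algebra M F Q = sigma (space M)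
     {T \<in> sigma_sets (space M) (\<Union>x. sets (F x)). \<forall>x. T \<inter> {\<omega>\<in>space M. Q \<omega> \<sqsubseteq> x} \<in> sets (F x)}"


section \<open>The right process and the map it discovers\<close>

text \<open>
  A step of the dual exploration is recorded by the dart through which the current face is left.
  \<open>rightmost m V d\<close>: having entered a face through its dart \<open>d\<close>, the rightmost of its darts not
  in \<open>V\<close>.  Since faces lie to the right of their darts, going through them from right to left as seen
  from \<open>d\<close> means following \<open>nxt\<close> backwards.
\<close>

definition rightmost :: "'d pmap \<Rightarrow> 'd set \<Rightarrow> 'd \<Rightarrow> 'd" where
  "rightmost m V d = (inv (nxt m) ^^ (LEAST k. (inv (nxt m) ^^ k) d \<notin> V)) d"

text \<open>
  \<open>right_path m s n\<close>: the darts crossed by the first \<open>n + 1\<close> steps, starting with the dart \<open>s\<close> of the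
  root face.
\<close>

primrec right_path :: "'d pmap \<Rightarrow> 'd \<Rightarrow> nat \<Rightarrow> 'd list" where
  "right_path m s 0 = [s]"
| "right_path m s (Suc n) =
     (let cs = right_path m s n
      in cs @ [rightmost m (set cs \<union> opp m ` set cs) (opp m (last cs))])"

definition exit_dart :: "'d pmap \<Rightarrow> 'd \<Rightarrow> nat \<Rightarrow> 'd" where
  "exit_dart m s n = last (right_path m s n)"

definition visited :: "'d pmap \<Rightarrow> 'd \<Rightarrow> nat \<Rightarrow> 'd set" where
  "visited m s i = (case i of 0 \<Rightarrow> root_face m | Suc n \<Rightarrow> face m (opp m (exit_dart m s n)))"

definition tau_E :: "'d pmap \<Rightarrow> 'd \<Rightarrow> nat" where
  "tau_E m s = (LEAST i. 1 \<le> i \<and> visited m s i = visited m s 0)"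

definition intersection_times :: "'d pmap \<Rightarrow> 'd \<Rightarrow> nat set" where
  "intersection_times m s =
     {i \<in> {1..tau_E m s}. \<exists>j \<in> {1..tau_E m s}. j \<noteq> i \<and> visited m s i = visited m s j}"

definition tau_I :: "'d pmap \<Rightarrow> 'd \<Rightarrow> nat" where
  "tau_I m s = Inf (intersection_times m s)"

definition tau_R :: "'d pmap \<Rightarrow> 'd \<Rightarrow> nat" where
  "tau_R m s = Max {i \<in> {0..tau_E m s}. visited m s i = visited m s (tau_I m s)}"

text \<open>
  The times of the faces, and of the steps (step \<open>i\<close> goes from the face number \<open>i\<close> to the next), on
  the cycle that is followed.  If the right process does not intersect itself, this is the whole cycle.
\<close>

definition kept_faces :: "'d pmap \<Rightarrow> 'd \<Rightarrow> nat set" where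
  "kept_faces m s = (if intersection_times m s = {} then {0..tau_E m s}
     else {0..tau_I m s} \<union> {tau_R m s..tau_E m s})"

definition kept_steps :: "'d pmap \<Rightarrow> 'd \<Rightarrow> nat set" where
  "kept_steps m s = (if intersection_times m s = {} then {0..<tau_E m s}
     else {0..<tau_I m s} \<union> {tau_R m s..<tau_E m s})"

text \<open>
  \<open>discovered m S C H\<close>: the map consisting of the faces of \<open>m\<close> with darts \<open>S\<close>, glued along the edges
  with darts \<open>C\<close> only.  Each dart \<open>d\<close> of \<open>S\<close> not in \<open>C\<close> gets a new opposite dart \<open>Inr d\<close>; the new darts
  form the boundaries of the holes, on which \<open>H\<close> is the set of marks.  The successor of \<open>Inr d\<close>
  is found by rotating about the vertex at which \<open>d\<close> starts, across the edges in \<open>C\<close>.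
\<close>

definition discovered :: "'d pmap \<Rightarrow> 'd set \<Rightarrow> 'd set \<Rightarrow> ('d + 'd) set \<Rightarrow> ('d + 'd) pmap" where
  "discovered m S C H =
     (let D = Inl ` S \<union> Inr ` (S - C);
          back = inv (nxt m);
          turn = (\<lambda>e. back (opp m e));
          border = (\<lambda>d. (turn ^^ (LEAST k. (turn ^^ k) (back d) \<notin> C)) (back d))
      in \<lparr>darts = D,
          opp = (\<lambda>x. if x \<in> D
                     then (case x of Inl d \<Rightarrow> if d \<in> C then Inl (opp m d) else Inr d
                                   | Inr d \<Rightarrow> Inl d)
                     else x),
          nxt = (\<lambda>x. if x \<in> D
                     then (case x of Inl d \<Rightarrow> Inl (nxt m d) | Inr d \<Rightarrow> Inr (border d))
                     else x),
          rootd = Inl (rootd m),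
          marks = H\<rparr>)"

text \<open>
  \<open>p\<close> is the map discovered in \<open>m\<close> along the kept cycle, with some choice of marked edges.
\<close>

definition right_cycle_map :: "'d pmap \<Rightarrow> 'd \<Rightarrow> hmap \<Rightarrow> bool" where
  "right_cycle_map m s p \<longleftrightarrow>
     (let S = (\<Union>i\<in>kept_faces m s. visited m s i);
          C = (\<Union>i\<in>kept_steps m s. {exit_dart m s i, opp m (exit_dart m s i)})
      in \<exists>H. quad_with_holes (discovered m S C H) \<and> hole_darts (discovered m S C H) = Inr ` (S - C) \<and>
             p = class_of (discovered m S C H))"

definition same_up_to_marks :: "hmap \<Rightarrow> hmap \<Rightarrow> bool" where
  "same_up_to_marks p p' \<longleftrightarrow>
     (\<exists>f. rooted_iso f (rep_hmap p) (rep_hmap p') \<and>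
          f ` hole_darts (rep_hmap p) = hole_darts (rep_hmap p'))"

text \<open>
  \<open>is_right_cycle_rule b Q\<close>: \<open>Q\<close> maps each quadrangulation of perimeter 2 to the map discovered in
  it.  Two things are left open by the verbal description and are therefore kept arbitrary:

  \<^item> at the root vertex, where there is no edge of arrival, which of the two dual edges is the
    rightmost one; both possibilities are covered by the parameter \<open>b\<close>;

  \<^item> the marked edges of the holes, which may be chosen by any rule depending only on the
    discovered map.
\<close>

definition is_right_cycle_rule :: "bool \<Rightarrow> (hmap \<Rightarrow> hmap) \<Rightarrow> bool" where
  "is_right_cycle_rule b Q \<longleftrightarrow>
     (\<forall>p\<in>quads 2. let m = rep_hmap p
        in right_cycle_map m (if b then rootd m else nxt m (rootd m)) (Q p)) \<and>
     (\<forall>p\<in>quads 2. \<forall>p'\<in>quads 2. same_up_to_marks (Q p) (Q p') \<longrightarrow> Q p = Q p')"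

end

theory Submission
  imports Defs
begin

text \<open>
  In a quadrangulation of perimeter 2 all face degrees are even, so by planarity the map is bipartite.
  Two corners of a square at the same vertex are then opposite to each other, and the right process
  simply rotates about one end of the root edge until it returns to the root face.  Suppressing
  the first loop of the process therefore leaves a 2-gon as a hole, and whatever is glued into this
  hole, the rotation enters it through one of its edges and comes back through the other: the map
  discovered in one quadrangulation is discovered in every quadrangulation of which it is a submap.  Hence
  \<open>{Q = p}\<close> is the event \<open>{p \<subset> X}\<close> of the natural filtration for every possible value \<open>p\<close>
  of the discovered map, and on it the stopped \<sigma>-algebra and \<open>F\<^sub>p\<close> have the same traces.

  That gluing and cutting preserve genus zero is seen by counting: identifying corners one by one bounds
  the number of vertices from one side, and Euler's inequality bounds it from the other.
\<close>

section \<open>Orbits\<close>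

text \<open>Planarity is available only as an equation between three numbers, with no topology
  behind it. Statements about curves separating the sphere are therefore replaced by linear algebra
  modulo 2: Euler's formula forces the cuts to be all the edge sets orthogonal to the face
  boundaries, and this yields the two colours. The same count, applied to the components left after
  cutting, shows that different holes lie in different components and that every filling has genus
  zero.

  That the rotation leaves the hole through the other edge is a matter of colour: the darts crossed
  all start at vertices of one colour, their opposites at vertices of the other, and the two edges
  of the 2-gon differ in colour. That it leaves at all is due to the periodicity of a rotation. Only
  the closure properties of the region inside the hole enter, so fillings with non-simple boundary
  are covered.\<close>

lemma orbit_self: "finite A \<Longrightarrow> f permutes A \<Longrightarrow> x \<in> orbit f x"
  by (rule permutation_self_in_orbit) (auto simp: permutation_permutes)

lemma orbit_step_eq:
  assumes "finite A" "f permutes A" shows "orbit f (f x) = orbit f x"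
proof -
  have "permutation f" using assms permutation_permutes by blast
  then show ?thesis by (rule permutation_orbit_step)
qed

lemma orbit_eq:
  assumes "finite A" "f permutes A" "y \<in> orbit f x" shows "orbit f y = orbit f x"
  using cyclic_on_orbit[OF assms(2,1)] assms(3) orbit_cyclic_eq3 by metis

lemma orbit_eq_iff:
  assumes "finite A" "f permutes A" shows "orbit f y = orbit f x \<longleftrightarrow> y \<in> orbit f x"
  using orbit_eq[OF assms] orbit_self[OF assms] by metis

lemma orbit_invariant:
  assumes "y \<in> orbit f x" "x \<in> A" "f permutes A" "\<And>z. z \<in> A \<Longrightarrow> g (f z) = g z"
  shows "g y = g x"
proof -
  from assms(1) have "y \<in> A \<and> g y = g x"
    by induct (use assms in \<open>auto simp: permutes_in_image\<close>)
  then show ?thesis ..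
qed

lemma orbit_subset_closed:
  assumes "x \<in> B" "\<And>z. z \<in> B \<Longrightarrow> f z \<in> B" shows "orbit f x \<subseteq> B"
proof
  fix y assume "y \<in> orbit f x" then show "y \<in> B" by induct (use assms in auto)
qed

text \<open>Vertices and faces are orbits, so lower bounds on their number come from labels that are
  constant along the permutation. The genus computations for glued and cut maps and for polygons all
  obtain their inequalities in this way.\<close>

lemma card_image_le_orbits:
  assumes "finite A" "f permutes A" "\<And>z. z \<in> A \<Longrightarrow> g (f z) = g z"
  shows "card (g ` A) \<le> card (orbit f ` A)"
proof (rule surj_card_le)
  show "finite (orbit f ` A)" using assms(1) by simp
  show "g ` A \<subseteq> (\<lambda>B. g (SOME x. x \<in> B)) ` orbit f ` A"
  proof
    fix y assume "y \<in> g ` A"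
    then obtain x where x: "x \<in> A" "y = g x" by blast
    have "(SOME z. z \<in> orbit f x) \<in> orbit f x"
      using orbit_self[OF assms(1,2)] by (metis someI)
    then have "g (SOME z. z \<in> orbit f x) = g x"
      using x(1) assms(2,3) orbit_invariant by metis
    then show "y \<in> (\<lambda>B. g (SOME x. x \<in> B)) ` orbit f ` A"
      using x by (intro image_eqI[of _ _ "orbit f x"]) auto
  qed
qed

text \<open>An equivariant map carries orbits onto orbits; this computes the faces and vertices of
  derived maps from those of the original one.\<close>

lemma orbit_image:
  assumes "\<And>z. z \<in> A \<Longrightarrow> f z \<in> A" "\<And>z. z \<in> A \<Longrightarrow> h (f z) = g (h z)" "x \<in> A"
  shows "orbit g (h x) = h ` orbit f x"
proof (intro equalityI subsetI)
  fix y assume "y \<in> orbit g (h x)"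
  then have "\<exists>z\<in>orbit f x. z \<in> A \<and> y = h z"
  proof induct
    case base then show ?case using assms by (intro bexI[of _ "f x"]) (auto intro: orbit.base)
  next
    case (step y)
    then obtain z where z: "z \<in> orbit f x" "z \<in> A" "y = h z" by blast
    then show ?case using assms by (intro bexI[of _ "f z"]) (auto intro: orbit.step)
  qed
  then show "y \<in> h ` orbit f x" by blast
next
  fix y assume "y \<in> h ` orbit f x"
  then obtain z where z: "z \<in> orbit f x" "y = h z" by blast
  from z(1) have "z \<in> A \<and> h z \<in> orbit g (h x)"
  proof induct
    case base then show ?case using assms(1,2)[OF assms(3)] orbit.base by metis
  next
    case (step y) then show ?case using assms(1,2) orbit.step by metis
  qed
  then show "y \<in> orbit g (h x)" using z by simp
qed

text \<open>Serves to match positions along two boundaries of equal length, and to turn a rotation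
  about a vertex into arithmetic modulo its degree.\<close>

lemma funpow_orbit_period:
  assumes "finite A" "f permutes A"
  shows "(f ^^ i) x = (f ^^ j) x \<longleftrightarrow> i mod card (orbit f x) = j mod card (orbit f x)"
proof -
  define N where "N = funpow_dist1 f x x"
  have s: "x \<in> orbit f x" by (rule orbit_self[OF assms])
  have P: "(f ^^ N) x = x" unfolding N_def by (rule funpow_dist1_prop[OF s])
  have N0: "N > 0" by (simp add: N_def)
  have inj: "inj_on (\<lambda>n. (f ^^ n) x) {0..<N}" unfolding N_def by (rule inj_on_funpow_dist1[OF s])
  have "orbit f x = (\<lambda>n. (f ^^ n) x) ` {0..<N}"
    unfolding N_def by (rule orbit_conv_funpow_dist1[OF s])
  then have c: "card (orbit f x) = N" using card_image[OF inj] by simp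
  have m: "(f ^^ (k mod N)) x = (f ^^ k) x" for k using funpow_mod_eq[OF P] by metis
  show ?thesis unfolding c
  proof
    assume "(f ^^ i) x = (f ^^ j) x"
    then have "(f ^^ (i mod N)) x = (f ^^ (j mod N)) x" using m by simp
    then show "i mod N = j mod N" using inj N0 by (auto simp: inj_on_def)
  next
    assume "i mod N = j mod N" then show "(f ^^ i) x = (f ^^ j) x" using m by metis
  qed
qed

lemma orbit_inv:
  assumes "finite A" "f permutes A" shows "orbit (inv f) x = orbit f x"
proof -
  have "permutation f" using assms permutation_permutes by blast
  then show ?thesis by (rule orbit_inv_eq)
qed

section \<open>Euler's inequality and bipartite colourings\<close>

text \<open>Darts and permutations without connectivity and genus: glued and cut maps have to be
  handled before these are established.\<close>

definition cmap :: "'d pmap \<Rightarrow> bool" where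
  "cmap m \<longleftrightarrow> finite (darts m) \<and> opp m permutes darts m \<and> nxt m permutes darts m \<and>
     (\<forall>d\<in>darts m. opp m d \<noteq> d \<and> opp m (opp m d) = d)"

lemma planar_map_cmap: "planar_map m \<Longrightarrow> cmap m"
  by (simp add: planar_map_def cmap_def)

abbreviation vert :: "'d pmap \<Rightarrow> 'd \<Rightarrow> 'd set" where
  "vert m \<equiv> orbit (nxt m \<circ> opp m)"

context
  fixes m :: "'d pmap"
  assumes cm: "cmap m"
begin

lemma finite_darts: "finite (darts m)"
  and opp_permutes: "opp m permutes darts m"
  and nxt_permutes: "nxt m permutes darts m"
  and opp_neq: "d \<in> darts m \<Longrightarrow> opp m d \<noteq> d"
  and opp_opp: "d \<in> darts m \<Longrightarrow> opp m (opp m d) = d"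
  using cm by (auto simp: cmap_def)

lemma opp_in [simp]: "opp m d \<in> darts m \<longleftrightarrow> d \<in> darts m"
  and nxt_in [simp]: "nxt m d \<in> darts m \<longleftrightarrow> d \<in> darts m"
  and back_in [simp]: "inv (nxt m) d \<in> darts m \<longleftrightarrow> d \<in> darts m"
  by (simp_all add: permutes_in_image[OF opp_permutes] permutes_in_image[OF nxt_permutes]
      permutes_in_image[OF permutes_inv[OF nxt_permutes]])

lemma nxt_back [simp]: "nxt m (inv (nxt m) d) = d"
  and back_nxt [simp]: "inv (nxt m) (nxt m d) = d"
  using permutes_inverses[OF nxt_permutes] by auto

lemma step_permutes: "nxt m \<circ> opp m permutes darts m"
  by (rule permutes_compose[OF opp_permutes nxt_permutes])

lemma face_self [simp]: "d \<in> face m d"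
  unfolding face_def by (rule orbit_self[OF finite_darts nxt_permutes])

lemma face_nxt [simp]: "face m (nxt m d) = face m d"
  unfolding face_def by (rule orbit_step_eq[OF finite_darts nxt_permutes])

lemma face_back [simp]: "face m (inv (nxt m) d) = face m d"
  using face_nxt[of "inv (nxt m) d"] by simp

lemma face_eq_iff: "face m d = face m e \<longleftrightarrow> d \<in> face m e"
  unfolding face_def by (rule orbit_eq_iff[OF finite_darts nxt_permutes])

lemma face_subset: "d \<in> darts m \<Longrightarrow> face m d \<subseteq> darts m"
  unfolding face_def by (rule permutes_orbit_subset[OF nxt_permutes])

lemma finite_face: "finite (face m d)"
  unfolding face_def by (rule finite_orbit[OF orbit_self[OF finite_darts nxt_permutes]])

lemma vert_nxt_opp: "vert m (nxt m (opp m d)) = vert m d"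
  using orbit_step_eq[OF finite_darts step_permutes, of d] by simp

lemma vert_nxt: "d \<in> darts m \<Longrightarrow> vert m (nxt m d) = vert m (opp m d)"
  using vert_nxt_opp[of "opp m d"] by (simp add: opp_opp)

lemma edge_eq_iff:
  assumes "d \<in> darts m" "e \<in> darts m"
  shows "{d, opp m d} = {e, opp m e} \<longleftrightarrow> d = e \<or> d = opp m e"
  using opp_opp assms by (auto simp: doubleton_eq_iff)

lemma card_edges: "2 * card (edges m) = card (darts m)"
proof -
  have "card (darts m) = (\<Sum>e\<in>edges m. card {d \<in> darts m. {d, opp m d} = e})"
    using sum.image_gen[OF finite_darts, of "\<lambda>_. 1::nat" "\<lambda>d. {d, opp m d}"]
    by (simp add: edges_def)
  also have "\<dots> = (\<Sum>e\<in>edges m. 2)"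
  proof (rule sum.cong)
    fix e assume "e \<in> edges m"
    then obtain d0 where d0: "d0 \<in> darts m" "e = {d0, opp m d0}" unfolding edges_def by auto
    have "opp m d0 \<in> darts m" using d0(1) by simp
    then have "{d \<in> darts m. {d, opp m d} = e} = {d0, opp m d0}"
      unfolding d0(2) using edge_eq_iff d0(1) by blast
    then show "card {d \<in> darts m. {d, opp m d} = e} = 2"
      using opp_neq[OF d0(1)] by (metis card_2_iff)
  qed simp
  finally show ?thesis by simp
qed

text \<open>Connectivity is mostly used in this form, a label being transported along steps;
  \<open>linkedI\<close> is the converse.\<close>

lemma linked_const:
  assumes "linked m A" "x \<in> A" "y \<in> A"
    and "\<And>c. c \<in> A \<Longrightarrow> nxt m c \<in> A \<Longrightarrow> P (nxt m c) = P c"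
    and "\<And>c. c \<in> A \<Longrightarrow> opp m c \<in> A \<Longrightarrow> P (opp m c) = P c"
  shows "P x = P y"
proof -
  have "(x, y) \<in> {(c, d). c \<in> A \<and> d \<in> A \<and> (d = nxt m c \<or> d = opp m c)}\<^sup>*"
    using assms unfolding linked_def by blast
  then show ?thesis
    by induct (use assms(4,5) in auto)
qed

end

section \<open>Sign sums over sets of faces and sets of edges\<close>

lemma card_sym_diff_even:
  assumes "finite A" "finite B"
  shows "card (sym_diff A B) + 2 * card (A \<inter> B) = card A + card B"
proof -
  have "card (sym_diff A B) = card (A - B) + card (B - A)"
    using assms by (intro card_Un_disjoint) auto
  moreover have "card A = card (A - B) + card (A \<inter> B)"
    using assms card_Int_Diff[of A B] by simp
  moreover have "card B = card (B - A) + card (A \<inter> B)"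
    using assms card_Int_Diff[of B A] by (simp add: Int_commute)
  ultimately show ?thesis by simp
qed

lemma sign_sym_diff:
  assumes "finite A" "finite B"
  shows "(-1::int) ^ card (sym_diff A B) = (-1) ^ card A * (-1) ^ card B"
proof -
  have "(-1::int) ^ card A * (-1) ^ card B = (-1) ^ (card (sym_diff A B) + 2 * card (A \<inter> B))"
    using card_sym_diff_even[OF assms] by (simp add: power_add)
  then show ?thesis by (simp add: power_add power_mult)
qed

lemma card_le_twice_image:
  assumes "finite A" "\<And>a b. a \<in> A \<Longrightarrow> b \<in> A \<Longrightarrow> f a = f b \<Longrightarrow> b = a \<or> b = c a"
  shows "card A \<le> 2 * card (f ` A)"
proof -
  have "card A = (\<Sum>y\<in>f ` A. card {x\<in>A. f x = y})"
    using sum.image_gen[OF assms(1), of "\<lambda>_. 1::nat" f] by simp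
  also have "\<dots> \<le> (\<Sum>y\<in>f ` A. 2)"
  proof (rule sum_mono)
    fix y assume "y \<in> f ` A"
    then obtain a where a: "a \<in> A" "y = f a" by blast
    then have "{x\<in>A. f x = y} \<subseteq> {a, c a}" using assms(2)[OF a(1)] by fastforce
    then have "card {x\<in>A. f x = y} \<le> card {a, c a}" by (intro card_mono) auto
    also have "\<dots> \<le> 2" by (simp add: card_insert_if)
    finally show "card {x\<in>A. f x = y} \<le> 2" .
  qed
  finally show ?thesis by simp
qed

text \<open>
  Linear algebra over the field with two elements by counting: summing the signs
  \<open>(-1) ^ card (incidences m W x)\<close> over sets \<open>W\<close> of faces and \<open>x\<close> of edges in both orders bounds the
  number of edge sets orthogonal to all face boundaries, and the cuts are among these.
\<close>

definition incidences :: "'d pmap \<Rightarrow> 'd set set \<Rightarrow> 'd set set \<Rightarrow> 'd set" where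
  "incidences m W x = {d \<in> darts m. face m d \<in> W \<and> {d, opp m d} \<in> x}"

text \<open>Seen in the dual map, these are the edge sets that meet every dual vertex in an even
  number of half-edges. Quantifying over sets \<open>W\<close> of faces instead of single faces lets
  the sum over \<open>W\<close> detect membership.\<close>

definition cycles :: "'d pmap \<Rightarrow> 'd set set set" where
  "cycles m = {x \<in> Pow (edges m). \<forall>W\<in>Pow (faces m). even (card (incidences m W x))}"

definition cut :: "'d pmap \<Rightarrow> 'd set set \<Rightarrow> 'd set set" where
  "cut m U = (\<lambda>d. {d, opp m d}) ` {d \<in> darts m. (vert m d \<in> U) \<noteq> (vert m (opp m d) \<in> U)}"

context
  fixes m :: "'d pmap"
  assumes cm: "cmap m" and lk: "linked m (darts m)" and ne: "darts m \<noteq> {}"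
begin

lemma finite_incidences: "finite (incidences m W x)"
  using finite_darts[OF cm] by (simp add: incidences_def)

lemma finite_map: "finite (edges m)" "finite (faces m)" "finite (verts m)"
  using finite_darts[OF cm] by (auto simp: edges_def faces_def verts_def)

text \<open>If some \<open>W0\<close> has odd incidence with \<open>x\<close>, exchanging
  \<open>W\<close> with \<open>sym_diff W W0\<close> reverses every sign, so the sum is its own
  negative.\<close>

lemma sum_face_sets:
  assumes "x \<in> Pow (edges m)"
  shows "(\<Sum>W\<in>Pow (faces m). (-1::int) ^ card (incidences m W x))
    = (if x \<in> cycles m then 2 ^ card (faces m) else 0)"
proof (cases "x \<in> cycles m")
  case True
  then have "(\<Sum>W\<in>Pow (faces m). (-1::int) ^ card (incidences m W x)) = (\<Sum>W\<in>Pow (faces m). 1)"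
    by (intro sum.cong) (auto simp: cycles_def)
  then show ?thesis using True finite_map by (simp add: card_Pow)
next
  case False
  then obtain W0 where W0: "W0 \<subseteq> faces m" "odd (card (incidences m W0 x))"
    using assms by (auto simp: cycles_def)
  define g where "g W = (-1::int) ^ card (incidences m W x)" for W
  have flip: "g (sym_diff W W0) = - g W" for W
  proof -
    have "incidences m (sym_diff W W0) x = sym_diff (incidences m W x) (incidences m W0 x)"
      by (auto simp: incidences_def)
    then show ?thesis
      unfolding g_def by (simp add: sign_sym_diff[OF finite_incidences finite_incidences] W0(2))
  qed
  have sdd: "sym_diff (sym_diff W W0) W0 = W" for W by blast
  have "sum g (Pow (faces m)) = (\<Sum>W\<in>Pow (faces m). g (sym_diff W W0))"
    by (rule sum.reindex_bij_witness[where i = "\<lambda>W. sym_diff W W0" and j = "\<lambda>W. sym_diff W W0"])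
      (use W0(1) in \<open>auto simp: sdd\<close>)
  also have "\<dots> = - sum g (Pow (faces m))" by (simp add: flip sum_negf)
  finally show ?thesis using False unfolding g_def by simp
qed

text \<open>Connectivity supplies an edge with exactly one side on a face of \<open>W\<close>.
  Adding or removing this edge changes the incidences by the single dart \<open>d0\<close>, so the
  terms cancel in pairs.\<close>

lemma sum_edge_sets:
  assumes W: "W \<in> Pow (faces m)" "W \<noteq> {}" "W \<noteq> faces m"
  shows "(\<Sum>x\<in>Pow (edges m). (-1::int) ^ card (incidences m W x)) = 0"
proof -
  have "\<exists>d\<in>darts m. face m d \<in> W \<and> face m (opp m d) \<notin> W"
  proof (rule ccontr)
    assume "\<not> ?thesis"
    then have n: "d \<in> darts m \<Longrightarrow> face m d \<in> W \<Longrightarrow> face m (opp m d) \<in> W" for d by blast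
    have "(face m x \<in> W) = (face m y \<in> W)" if "x \<in> darts m" "y \<in> darts m" for x y
    proof (rule linked_const[OF cm lk that])
      fix c assume "c \<in> darts m"
      then show "(face m (opp m c) \<in> W) = (face m c \<in> W)"
        using n[of c] n[of "opp m c"] by (auto simp: opp_opp[OF cm] cm)
    qed (simp add: cm)
    then have "W = {} \<or> faces m \<subseteq> W" using W(1) unfolding faces_def by blast
    then show False using W by blast
  qed
  then obtain d0 where d0: "d0 \<in> darts m" "face m d0 \<in> W" "face m (opp m d0) \<notin> W" by blast
  define e0 where "e0 = {d0, opp m d0}"
  have e0: "e0 \<in> edges m" using d0(1) by (auto simp: edges_def e0_def)
  define g where "g x = (-1::int) ^ card (incidences m W x)" for x
  have flip: "g (sym_diff x {e0}) = - g x" for x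
  proof -
    have "incidences m W {e0} = {d0}"
    proof -
      have "d = d0" if "d \<in> incidences m W {e0}" for d
      proof -
        have "d \<in> darts m" "face m d \<in> W" "{d, opp m d} = {d0, opp m d0}"
          using that by (auto simp: incidences_def e0_def)
        then show ?thesis using edge_eq_iff[OF cm _ d0(1), of d] d0(3) by blast
      qed
      moreover have "d0 \<in> incidences m W {e0}" using d0 by (auto simp: incidences_def e0_def)
      ultimately show ?thesis by blast
    qed
    moreover have "incidences m W (sym_diff x {e0}) = sym_diff (incidences m W x) (incidences m W {e0})"
      by (auto simp: incidences_def)
    ultimately show ?thesis
      unfolding g_def using sign_sym_diff[OF finite_incidences, of "{d0}"] by simp
  qed
  have sdd: "sym_diff (sym_diff x {e0}) {e0} = x" for x by blast
  have "sum g (Pow (edges m)) = (\<Sum>x\<in>Pow (edges m). g (sym_diff x {e0}))"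
    by (rule sum.reindex_bij_witness[where i = "\<lambda>x. sym_diff x {e0}" and j = "\<lambda>x. sym_diff x {e0}"])
      (use e0 in \<open>auto simp: sdd\<close>)
  also have "\<dots> = - sum g (Pow (edges m))" by (simp add: flip sum_negf)
  finally show ?thesis unfolding g_def by simp
qed

text \<open>Double counting of signs. Summed over \<open>W\<close> first, only the elements of
  \<open>cycles m\<close> contribute, each \<open>2 ^ card (faces m)\<close>. Summed over
  \<open>x\<close> first, only the empty and the full set of faces remain, each with at most
  \<open>2 ^ card (edges m)\<close>.\<close>

lemma card_cycles_le: "2 ^ card (faces m) * card (cycles m) \<le> 2 * 2 ^ card (edges m)"
proof -
  define g where "g W x = (-1::int) ^ card (incidences m W x)" for W x
  have "(\<Sum>W\<in>Pow (faces m). \<Sum>x\<in>Pow (edges m). g W x) = (\<Sum>x\<in>Pow (edges m). \<Sum>W\<in>Pow (faces m). g W x)"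
    by (rule sum.swap)
  also have "\<dots> = (\<Sum>x\<in>Pow (edges m). if x \<in> cycles m then 2 ^ card (faces m) else 0)"
    unfolding g_def by (rule sum.cong[OF refl sum_face_sets])
  also have "\<dots> = (\<Sum>x\<in>Pow (edges m) \<inter> cycles m. 2 ^ card (faces m))"
    by (rule sum.inter_restrict[symmetric]) (simp add: finite_map)
  also have "\<dots> = int (2 ^ card (faces m) * card (cycles m))"
    using Int_absorb1[of "cycles m" "Pow (edges m)"] by (simp add: cycles_def subset_iff)
  finally have 1: "(\<Sum>W\<in>Pow (faces m). \<Sum>x\<in>Pow (edges m). g W x) = int (2 ^ card (faces m) * card (cycles m))" .
  have "(\<Sum>W\<in>Pow (faces m). \<Sum>x\<in>Pow (edges m). g W x) = (\<Sum>W\<in>{{}, faces m}. \<Sum>x\<in>Pow (edges m). g W x)"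
  proof (rule sum.mono_neutral_right)
    show "\<forall>W\<in>Pow (faces m) - {{}, faces m}. (\<Sum>x\<in>Pow (edges m). g W x) = 0"
      unfolding g_def using sum_edge_sets by blast
  qed (auto simp: finite_map)
  also have "\<dots> \<le> (\<Sum>W\<in>{{}, faces m}. \<Sum>x\<in>Pow (edges m). 1)"
  proof (intro sum_mono)
    fix W x show "g W x \<le> 1" unfolding g_def by (cases "even (card (incidences m W x))") auto
  qed
  also have "\<dots> = (\<Sum>W\<in>{{}, faces m}. 2 ^ card (edges m))"
    by (simp add: card_Pow finite_map)
  also have "\<dots> = int (card {{}, faces m} * 2 ^ card (edges m))" by simp
  finally have "2 ^ card (faces m) * card (cycles m) \<le> card {{}, faces m} * 2 ^ card (edges m)"
    unfolding 1 by (simp only: of_nat_le_iff)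
  also have "\<dots> \<le> 2 * 2 ^ card (edges m)"
    by (rule mult_right_mono) (auto simp: card_insert_if)
  finally show ?thesis .
qed

lemma cut_iff:
  assumes d: "d \<in> darts m"
  shows "{d, opp m d} \<in> cut m U \<longleftrightarrow> (vert m d \<in> U) \<noteq> (vert m (opp m d) \<in> U)"
proof
  assume "{d, opp m d} \<in> cut m U"
  then obtain c where c: "c \<in> darts m" "(vert m c \<in> U) \<noteq> (vert m (opp m c) \<in> U)" "{d, opp m d} = {c, opp m c}"
    unfolding cut_def by blast
  then have "d = c \<or> d = opp m c" using edge_eq_iff[OF cm d] by blast
  then show "(vert m d \<in> U) \<noteq> (vert m (opp m d) \<in> U)" using c opp_opp[OF cm] by metis
qed (use d in \<open>auto simp: cut_def\<close>)

text \<open>Around a face, membership of the current vertex in \<open>U\<close> changes an even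
  number of times: \<open>A\<close> records membership at the start of a dart, \<open>A'\<close> at
  its end, and \<open>nxt\<close> maps one onto the other.\<close>

lemma cut_in_cycles: "cut m U \<in> cycles m"
proof -
  have "even (card (incidences m W (cut m U)))" for W
  proof -
    define B where "B = {d \<in> darts m. face m d \<in> W}"
    define A where "A = {d \<in> B. vert m d \<in> U}"
    define A' where "A' = {d \<in> B. vert m (nxt m d) \<in> U}"
    have fin: "finite B" using finite_darts[OF cm] by (simp add: B_def)
    have "bij_betw (nxt m) A' A"
      by (rule bij_betw_byWitness[where f' = "inv (nxt m)"]) (auto simp: A_def A'_def B_def cm)
    then have "card A' = card A" by (rule bij_betw_same_card)
    moreover have "incidences m W (cut m U) = sym_diff A A'"
      by (auto simp: incidences_def cut_iff A_def A'_def B_def vert_nxt[OF cm])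
    moreover have "finite A" "finite A'" using fin by (auto simp: A_def A'_def)
    ultimately show ?thesis using card_sym_diff_even[of A A'] by presburger
  qed
  then show ?thesis by (auto simp: cycles_def cut_def edges_def)
qed

text \<open>Two vertex sets with the same cut differ by a set that no edge leaves, and by
  connectivity this set is empty or everything.\<close>

lemma card_cuts: "2 ^ card (verts m) \<le> 2 * card (cut m ` Pow (verts m))"
proof -
  have "card (Pow (verts m)) \<le> 2 * card (cut m ` Pow (verts m))"
  proof (rule card_le_twice_image[where c = "\<lambda>U. verts m - U"])
    show "finite (Pow (verts m))" by (simp add: finite_map)
    fix U U' assume U: "U \<in> Pow (verts m)" "U' \<in> Pow (verts m)" and eq: "cut m U = cut m U'"
    define P where "P d \<longleftrightarrow> ((vert m d \<in> U) \<noteq> (vert m d \<in> U'))" for d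
    have opp: "P (opp m c) = P c" if "c \<in> darts m" for c
      using cut_iff[OF that, of U] cut_iff[OF that, of U'] eq by (auto simp: P_def)
    have "P x = P y" if "x \<in> darts m" "y \<in> darts m" for x y
    proof (rule linked_const[OF cm lk that])
      fix c assume "c \<in> darts m"
      then show "P (nxt m c) = P c" using opp[of c] vert_nxt[OF cm] by (simp add: P_def)
    qed (rule opp)
    then consider "\<forall>d\<in>darts m. P d" | "\<forall>d\<in>darts m. \<not> P d" by blast
    then show "U' = U \<or> U' = verts m - U"
    proof cases
      case 1 then show ?thesis using U unfolding P_def verts_def by (intro disjI2) blast
    next
      case 2 then show ?thesis using U unfolding P_def verts_def by (intro disjI1) blast
    qed
  qed
  then show ?thesis by (simp add: card_Pow finite_map)
qed

lemma finite_cycles: "finite (cycles m)"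
  by (rule finite_subset[of _ "Pow (edges m)"]) (auto simp: cycles_def finite_map)

text \<open>Dimensions modulo 2: the cuts contribute at least V - 1, the cycles at most E - F + 1,
  and every cut is a cycle.\<close>

theorem euler_le: "card (verts m) + card (faces m) \<le> card (edges m) + 2"
proof -
  have "card (cut m ` Pow (verts m)) \<le> card (cycles m)"
    by (rule card_mono[OF finite_cycles]) (use cut_in_cycles in auto)
  then have "2 ^ card (verts m) \<le> 2 * card (cycles m)" using card_cuts by linarith
  then have "2 ^ card (faces m) * 2 ^ card (verts m) \<le> 2 ^ card (faces m) * (2 * card (cycles m))"
    by (rule mult_left_mono) simp
  also have "\<dots> \<le> 4 * 2 ^ card (edges m)" using card_cycles_le by (simp add: mult_ac)
  finally have "(2::nat) ^ (card (verts m) + card (faces m)) \<le> 2 ^ (card (edges m) + 2)"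
    by (simp add: power_add mult.commute)
  then show ?thesis by (rule power_le_imp_le_exp[rotated]) simp
qed

text \<open>When Euler's inequality is sharp, every cycle is a cut. Even face degrees put the set of
  all edges among the cycles, and a vertex set \<open>U\<close> with this cut is a colour
  class.\<close>

theorem bipartite:
  assumes eu: "card (verts m) + card (faces m) = card (edges m) + 2"
    and ev: "\<And>d. d \<in> darts m \<Longrightarrow> even (card (face m d))"
  shows "\<exists>P :: 'd \<Rightarrow> bool. \<forall>d\<in>darts m. P (opp m d) \<noteq> P d \<and> P (nxt m d) \<noteq> P d"
proof -
  have "2 ^ card (faces m) * (2 * card (cycles m)) \<le> 4 * 2 ^ card (edges m)"
    using card_cycles_le by (simp add: mult_ac)
  also have "(4::nat) * 2 ^ card (edges m) = 2 ^ (card (faces m) + card (verts m))"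
    using eu by (simp add: power_add add.commute)
  also have "\<dots> = 2 ^ card (faces m) * 2 ^ card (verts m)" by (simp add: power_add)
  also have "\<dots> \<le> 2 ^ card (faces m) * (2 * card (cut m ` Pow (verts m)))"
    using card_cuts by (intro mult_left_mono) auto
  finally have "card (cycles m) \<le> card (cut m ` Pow (verts m))" by simp
  then have eq: "cut m ` Pow (verts m) = cycles m"
    using cut_in_cycles by (intro card_seteq[OF finite_cycles]) auto
  have "edges m \<in> cycles m"
  proof -
    have "even (card (incidences m W (edges m)))" if W: "W \<subseteq> faces m" for W
    proof -
      have "incidences m W (edges m) = {d \<in> darts m. face m d \<in> W}"
        by (auto simp: incidences_def edges_def)
      also have "\<dots> = \<Union>W"
      proof (intro equalityI subsetI)
        fix d assume "d \<in> {d \<in> darts m. face m d \<in> W}" then show "d \<in> \<Union>W"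
          using face_self[OF cm] by blast
      next
        fix d assume "d \<in> \<Union>W"
        then obtain w where w: "w \<in> W" "d \<in> w" by blast
        then obtain e where e: "e \<in> darts m" "w = face m e" using W by (auto simp: faces_def)
        then show "d \<in> {d \<in> darts m. face m d \<in> W}"
          using w face_eq_iff[OF cm, of d e] face_subset[OF cm, of e] by auto
      qed
      also have "card (\<Union>W) = (\<Sum>w\<in>W. card w)"
      proof (rule card_Union_disjoint)
        show "disjoint W"
        proof (rule disjointI)
          fix a b assume ab: "a \<in> W" "b \<in> W" "a \<noteq> b"
          then obtain x y where "a = face m x" "b = face m y" using W unfolding faces_def by blast
          then show "a \<inter> b = {}" using ab(3) face_eq_iff[OF cm] by (metis disjoint_iff)
        qed
        show "\<And>A. A \<in> W \<Longrightarrow> finite A" using W finite_face[OF cm] by (auto simp: faces_def)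
      qed
      also have "even \<dots>" using W ev by (intro dvd_sum) (auto simp: faces_def)
      finally show ?thesis .
    qed
    then show ?thesis by (auto simp: cycles_def)
  qed
  then obtain U where U: "edges m = cut m U" using eq by blast
  have "(vert m (opp m d) \<in> U) \<noteq> (vert m d \<in> U)" if "d \<in> darts m" for d
    using cut_iff[OF that, of U] that U by (auto simp: edges_def)
  then show ?thesis using vert_nxt[OF cm] by (intro exI[of _ "\<lambda>d. vert m d \<in> U"]) simp
qed

end

section \<open>Gluing\<close>

text \<open>Each pair \<open>(a, b)\<close> is imposed by redirecting the class of \<open>b\<close>
  to that of \<open>a\<close>, which loses at most one class. The number of identifications
  therefore bounds the loss.\<close>

lemma merge_classes:
  assumes "finite A" "finite P"
  shows "\<exists>cls :: 'a \<Rightarrow> 'a. (\<forall>(a, b)\<in>P. cls a = cls b) \<and> card A \<le> card (cls ` A) + card P"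
  using assms(2)
proof induct
  case empty show ?case by (intro exI[of _ id]) auto
next
  case (insert x P)
  obtain a b where x: "x = (a, b)" by (cases x)
  obtain cls :: "'a \<Rightarrow> 'a" where c: "\<forall>(a, b)\<in>P. cls a = cls b" "card A \<le> card (cls ` A) + card P"
    using insert by blast
  define cls' where "cls' z = (if cls z = cls b then cls a else cls z)" for z
  have "cls ` A \<subseteq> insert (cls b) (cls' ` A)" by (auto simp: cls'_def)
  then have "card (cls ` A) \<le> card (insert (cls b) (cls' ` A))"
    using assms(1) by (intro card_mono) auto
  also have "\<dots> \<le> Suc (card (cls' ` A))" by (rule card_insert_le_m1) auto
  finally have "card A \<le> card (cls' ` A) + card (insert x P)"
    using c(2) insert by simp
  moreover have "\<forall>(a, b)\<in>insert x P. cls' a = cls' b"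
    using c(1) by (auto simp: cls'_def x)
  ultimately show ?case by blast
qed

text \<open>The predicate to test is reachability from \<open>x\<close>. Steps along
  \<open>nxt\<close> can be undone because its orbits are finite cycles, and \<open>opp\<close> is
  an involution, so reachability does not change along a step in either direction.\<close>

lemma linkedI:
  fixes m :: "'d pmap"
  assumes cm: "cmap m" and A: "A \<subseteq> darts m" "\<And>d. d \<in> A \<Longrightarrow> nxt m d \<in> A"
    and connected: "\<And>(P :: 'd \<Rightarrow> bool) x y. (\<And>c. c \<in> A \<Longrightarrow> P (nxt m c) = P c) \<Longrightarrow>
      (\<And>c. c \<in> A \<Longrightarrow> opp m c \<in> A \<Longrightarrow> P (opp m c) = P c) \<Longrightarrow> x \<in> A \<Longrightarrow> y \<in> A \<Longrightarrow> P x = P y"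
  shows "linked m A"
proof -
  define R where "R = {(c, d). c \<in> A \<and> d \<in> A \<and> (d = nxt m c \<or> d = opp m c)}"
  have st: "(c, nxt m c) \<in> R" if "c \<in> A" for c using that A(2) by (auto simp: R_def)
  have bk: "(nxt m c, c) \<in> R\<^sup>*" if c: "c \<in> A" for c
  proof -
    have "w \<in> A \<and> (nxt m c, w) \<in> R\<^sup>*" if "w \<in> orbit (nxt m) (nxt m c)" for w
      using that
    proof induct
      case base then show ?case using st[OF A(2)[OF c]] A(2)[OF A(2)[OF c]] by blast
    next
      case (step z) then show ?case using st[of z] A(2)[of z] by (meson rtrancl.rtrancl_into_rtrancl)
    qed
    moreover have "c \<in> orbit (nxt m) (nxt m c)"
      using face_self[OF cm, of c] face_nxt[OF cm, of c] by (simp add: face_def)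
    ultimately show ?thesis by blast
  qed
  have "(x, y) \<in> R\<^sup>*" if xy: "x \<in> A" "y \<in> A" for x y
  proof -
    have "((x, x) \<in> R\<^sup>*) = ((x, y) \<in> R\<^sup>*)"
    proof (rule connected[OF _ _ xy])
      fix c assume c: "c \<in> A"
      show "((x, nxt m c) \<in> R\<^sup>*) = ((x, c) \<in> R\<^sup>*)"
        using st[OF c] bk[OF c] by (meson rtrancl.rtrancl_into_rtrancl rtrancl_trans)
      assume c': "opp m c \<in> A"
      have "(c, opp m c) \<in> R" "(opp m c, c) \<in> R"
        using c c' A(1) opp_opp[OF cm] by (auto simp: R_def)
      then show "((x, opp m c) \<in> R\<^sup>*) = ((x, c) \<in> R\<^sup>*)"
        by (meson rtrancl.rtrancl_into_rtrancl)
    qed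
    then show ?thesis by simp
  qed
  then show ?thesis unfolding linked_def R_def by blast
qed

lemma involution_permutes:
  assumes "\<And>x. x \<notin> S \<Longrightarrow> f x = x" "\<And>x. x \<in> S \<Longrightarrow> f x \<in> S \<and> f (f x) = x"
  shows "f permutes S"
proof (rule bij_imp_permutes)
  show "bij_betw f S S" by (rule bij_betw_byWitness[where f' = f]) (use assms(2) in auto)
qed (rule assms(1))

lemma planar_mapD:
  assumes "planar_map m"
  shows "cmap m" "linked m (darts m)" "rootd m \<in> darts m" "darts m \<noteq> {}"
    "card (verts m) + card (faces m) = card (edges m) + 2"
  using assms by (auto simp: planar_map_def cmap_def)

text \<open>The reverse inequality is \<open>euler_le\<close>, so genus zero amounts to having
  enough vertices and faces.\<close>

lemma planar_mapI:
  assumes "cmap m" "linked m (darts m)" "rootd m \<in> darts m"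
    "card (edges m) + 2 \<le> card (verts m) + card (faces m)"
  shows "planar_map m"
proof -
  have "card (verts m) + card (faces m) = card (edges m) + 2"
    using euler_le[OF assms(1,2)] assms(3,4) by fastforce
  then show ?thesis using assms by (simp add: planar_map_def cmap_def)
qed

lemma quad_with_holesD:
  assumes "quad_with_holes m"
  shows "planar_map m" "cmap m" "marks m \<subseteq> darts m" "inj_on (face m) (marks m)" "rootd m \<notin> hole_darts m"
    "\<And>d. d \<in> darts m \<Longrightarrow> d \<notin> root_face m \<Longrightarrow> d \<notin> hole_darts m \<Longrightarrow> card (face m d) = 4"
    "\<And>d. d \<in> hole_darts m \<Longrightarrow> opp m d \<notin> hole_darts m"
    "linked m (darts m - hole_darts m)"
  using assms planar_map_cmap by (auto simp: quad_with_holes_def)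

lemma hole_darts_closed:
  assumes cm: "cmap m"
  shows "nxt m d \<in> hole_darts m \<longleftrightarrow> d \<in> hole_darts m" "inv (nxt m) d \<in> hole_darts m \<longleftrightarrow> d \<in> hole_darts m"
    "nxt m d \<in> root_face m \<longleftrightarrow> d \<in> root_face m" "inv (nxt m) d \<in> root_face m \<longleftrightarrow> d \<in> root_face m"
  unfolding hole_darts_def root_face_def UN_iff
  by (simp_all add: face_eq_iff[OF cm, symmetric] face_nxt[OF cm] face_back[OF cm])

locale gluing =
  fixes p :: "'d pmap" and u :: "'d \<Rightarrow> 'e pmap"
  assumes qp: "quad_with_holes p"
    and qu: "h \<in> marks p \<Longrightarrow> quad_with_holes (u h)"
    and deg: "h \<in> marks p \<Longrightarrow> card (root_face (u h)) = card (face p h)"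
begin

abbreviation "G \<equiv> glue_pmap p u"

lemmas cp = quad_with_holesD(2)[OF qp]
lemmas cu = quad_with_holesD(2)[OF qu]

lemma root_in: "h \<in> marks p \<Longrightarrow> rootd (u h) \<in> darts (u h)" "rootd p \<in> darts p"
  using qp qu planar_mapD(3) quad_with_holesD(1) by blast+

lemma root_face_subset: "h \<in> marks p \<Longrightarrow> root_face (u h) \<subseteq> darts (u h)"
  unfolding root_face_def by (rule face_subset[OF cu root_in(1)])

lemma hole_darts_subset: "hole_darts p \<subseteq> darts p"
  using face_subset[OF cp] quad_with_holesD(3)[OF qp] by (auto simp: hole_darts_def)

lemma hole_unique:
  assumes "h \<in> marks p" "h' \<in> marks p" "x \<in> face p h" "x \<in> face p h'" shows "h = h'"
proof -
  have "face p h = face p h'" using assms face_eq_iff[OF cp] by metis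
  then show ?thesis using quad_with_holesD(4)[OF qp] assms by (auto simp: inj_on_def)
qed

section \<open>Identification of a hole with the boundary of its filling\<close>

definition hd :: "'d \<Rightarrow> nat \<Rightarrow> 'd" where "hd h i = (inv (nxt p) ^^ i) h"
definition rd :: "'d \<Rightarrow> nat \<Rightarrow> 'e" where "rd h i = (nxt (u h) ^^ i) (rootd (u h))"

lemma orbit_back: "orbit (inv (nxt p)) h = face p h"
  unfolding face_def by (rule orbit_inv[OF finite_darts[OF cp] nxt_permutes[OF cp]])

text \<open>Both walks have the same period because \<open>deg\<close> equates the two boundary
  lengths. Hence pairing equal positions gives a bijection between the darts of the hole and those
  of the root face.\<close>

lemma hd_rd_eq: "h \<in> marks p \<Longrightarrow> hd h i = hd h j \<longleftrightarrow> rd h i = rd h j"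
  unfolding hd_def rd_def
    funpow_orbit_period[OF finite_darts[OF cp] permutes_inv[OF nxt_permutes[OF cp]]]
    funpow_orbit_period[OF finite_darts[OF cu] nxt_permutes[OF cu]] orbit_back
  using deg[of h] by (simp add: root_face_def face_def)

lemma hd_surj: "x \<in> face p h \<Longrightarrow> \<exists>i. x = hd h i"
proof -
  assume x: "x \<in> face p h"
  have "permutation (inv (nxt p))"
    using finite_darts[OF cp] permutes_inv[OF nxt_permutes[OF cp]] permutation_permutes by blast
  from orbit_altdef_permutation[OF this, of h] x show ?thesis unfolding orbit_back hd_def by blast
qed

lemma rd_surj: "h \<in> marks p \<Longrightarrow> y \<in> root_face (u h) \<Longrightarrow> \<exists>i. y = rd h i"
proof -
  assume h: "h \<in> marks p" and y: "y \<in> root_face (u h)"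
  have "permutation (nxt (u h))"
    using finite_darts[OF cu[OF h]] nxt_permutes[OF cu[OF h]] permutation_permutes by blast
  from orbit_altdef_permutation[OF this, of "rootd (u h)"] y show ?thesis
    unfolding root_face_def face_def rd_def by blast
qed

lemma hd_in: "hd h i \<in> face p h"
  unfolding hd_def orbit_back[symmetric]
  by (intro funpow_in_orbit orbit_self[OF finite_darts[OF cp] permutes_inv[OF nxt_permutes[OF cp]]])

lemma rd_in: "h \<in> marks p \<Longrightarrow> rd h i \<in> root_face (u h)"
  unfolding rd_def root_face_def face_def
  by (intro funpow_in_orbit orbit_self[OF finite_darts[OF cu] nxt_permutes[OF cu]])

text \<open>The two directions of the identification as functions; by \<open>hd_rd_eq\<close> the
  result does not depend on the position chosen.\<close>

definition to_root :: "'d \<Rightarrow> 'd \<Rightarrow> 'e" where "to_root h x = rd h (SOME i. x = hd h i)"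
definition to_hole :: "'d \<Rightarrow> 'e \<Rightarrow> 'd" where "to_hole h y = hd h (SOME i. y = rd h i)"

lemma to_root_hd [simp]: "h \<in> marks p \<Longrightarrow> to_root h (hd h i) = rd h i"
  unfolding to_root_def using hd_rd_eq[of h] by (metis (mono_tags, lifting) someI)

lemma to_hole_rd [simp]: "h \<in> marks p \<Longrightarrow> to_hole h (rd h i) = hd h i"
  unfolding to_hole_def using hd_rd_eq[of h] by (metis (mono_tags, lifting) someI)

lemma to_root_in: "h \<in> marks p \<Longrightarrow> x \<in> face p h \<Longrightarrow> to_root h x \<in> root_face (u h)"
  and to_hole_to_root: "h \<in> marks p \<Longrightarrow> x \<in> face p h \<Longrightarrow> to_hole h (to_root h x) = x"
  and to_root_back: "h \<in> marks p \<Longrightarrow> x \<in> face p h \<Longrightarrow> to_root h (inv (nxt p) x) = nxt (u h) (to_root h x)"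
proof -
  assume h: "h \<in> marks p" and "x \<in> face p h"
  then obtain i where i: "x = hd h i" using hd_surj by blast
  show "to_root h x \<in> root_face (u h)" using rd_in[OF h] h i by simp
  show "to_hole h (to_root h x) = x" using h i by simp
  have "inv (nxt p) x = hd h (Suc i)" by (simp add: i hd_def)
  then show "to_root h (inv (nxt p) x) = nxt (u h) (to_root h x)"
    using h i to_root_hd by (simp add: rd_def)
qed

lemma to_hole_in: "h \<in> marks p \<Longrightarrow> y \<in> root_face (u h) \<Longrightarrow> to_hole h y \<in> face p h"
  and to_root_to_hole: "h \<in> marks p \<Longrightarrow> y \<in> root_face (u h) \<Longrightarrow> to_root h (to_hole h y) = y"
proof -
  assume h: "h \<in> marks p" and "y \<in> root_face (u h)"
  then obtain i where i: "y = rd h i" using rd_surj by blast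
  show "to_hole h y \<in> face p h" using hd_in h i by simp
  show "to_root h (to_hole h y) = y" using h i by simp
qed

definition jump :: "'d + 'd \<times> 'e \<Rightarrow> 'd + 'd \<times> 'e" where
  "jump y = pre_opp p u (THE z. (y, z) \<in> ident p u \<union> (ident p u)\<inverse>)"

lemma ident_eq: "(ident p u :: ('d + 'd \<times> 'e) rel) = {(Inl x, Inr (h, to_root h x)) | h x. h \<in> marks p \<and> x \<in> face p h}"
proof (intro equalityI subsetI)
  fix z assume "z \<in> ident p u"
  then obtain h i where "h \<in> marks p" "z = (Inl (hd h i), Inr (h, rd h i))"
    unfolding ident_def hd_def rd_def by blast
  then show "z \<in> {(Inl x, Inr (h, to_root h x)) | h x. h \<in> marks p \<and> x \<in> face p h}"
    using hd_in to_root_hd by (metis (mono_tags, lifting) mem_Collect_eq)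
next
  fix z :: "('d + 'd \<times> 'e) \<times> ('d + 'd \<times> 'e)" assume "z \<in> {(Inl x, Inr (h, to_root h x)) | h x. h \<in> marks p \<and> x \<in> face p h}"
  then obtain h x where h: "h \<in> marks p" "x \<in> face p h" "z = (Inl x, Inr (h, to_root h x))" by blast
  then obtain i where "x = hd h i" using hd_surj by blast
  then have "z = (Inl (hd h i), Inr (h, rd h i))" using h by simp
  then show "z \<in> ident p u" using h(1) unfolding ident_def hd_def rd_def by blast
qed

lemma jump_Inl: "h \<in> marks p \<Longrightarrow> x \<in> face p h \<Longrightarrow> jump (Inl x) = Inr (h, opp (u h) (to_root h x))"
proof -
  assume h: "h \<in> marks p" "x \<in> face p h"
  have "(THE z. (Inl x, z) \<in> ident p u \<union> (ident p u)\<inverse>) = Inr (h, to_root h x)"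
    by (rule the_equality) (use h hole_unique in \<open>auto simp: ident_eq\<close>)
  then show ?thesis by (simp add: jump_def pre_opp_def)
qed

lemma jump_Inr: "h \<in> marks p \<Longrightarrow> y \<in> root_face (u h) \<Longrightarrow> jump (Inr (h, y)) = Inl (opp p (to_hole h y))"
proof -
  assume h: "h \<in> marks p" "y \<in> root_face (u h)"
  have "(THE z. (Inr (h, y), z) \<in> ident p u \<union> (ident p u)\<inverse>) = Inl (to_hole h y)"
  proof (rule the_equality)
    show "(Inr (h, y), Inl (to_hole h y)) \<in> ident p u \<union> (ident p u)\<inverse>"
      using h to_hole_in to_root_to_hole by (auto simp: ident_eq)
  qed (use h to_hole_to_root in \<open>auto simp: ident_eq\<close>)
  then show ?thesis by (simp add: jump_def pre_opp_def)
qed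

section \<open>Opposite darts in the glued map\<close>

lemma glue_opp_jump:
  "glue_opp p u x = (jump ^^ (LEAST k. (jump ^^ k) (pre_opp p u x) \<in> glue_darts p u)) (pre_opp p u x)"
  unfolding glue_opp_def Let_def jump_def ..

lemma glue_opp0: "pre_opp p u x \<in> glue_darts p u \<Longrightarrow> glue_opp p u x = pre_opp p u x"
  unfolding glue_opp_jump by (subst Least_eq_0) auto

lemma glue_opp1:
  assumes "pre_opp p u x \<notin> glue_darts p u" "jump (pre_opp p u x) \<in> glue_darts p u"
  shows "glue_opp p u x = jump (pre_opp p u x)"
proof -
  have "(LEAST k. (jump ^^ k) (pre_opp p u x) \<in> glue_darts p u) = 1"
    by (rule Least_equality) (use assms in \<open>auto simp: Suc_le_eq intro!: gr0I\<close>)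
  then show ?thesis by (simp add: glue_opp_jump)
qed

text \<open>Two jumps are the most that occur: a jump out of a filling crosses an edge of
  \<open>p\<close> that borders a hole, and since no edge of \<open>p\<close> has holes on both
  sides, it ends at a surviving dart (\<open>opp_hole\<close>).\<close>

lemma glue_opp2:
  assumes "pre_opp p u x \<notin> glue_darts p u" "jump (pre_opp p u x) \<notin> glue_darts p u"
    "jump (jump (pre_opp p u x)) \<in> glue_darts p u"
  shows "glue_opp p u x = jump (jump (pre_opp p u x))"
proof -
  have "(LEAST k. (jump ^^ k) (pre_opp p u x) \<in> glue_darts p u) = 2"
  proof (rule Least_equality)
    fix k assume k: "(jump ^^ k) (pre_opp p u x) \<in> glue_darts p u"
    then have "k \<noteq> 0" "k \<noteq> 1" using assms by (intro notI; simp)+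
    then show "2 \<le> k" by simp
  qed (use assms in \<open>simp add: numeral_2_eq_2\<close>)
  then show ?thesis by (simp add: glue_opp_jump numeral_2_eq_2)
qed

definition pd :: "'d set" where "pd = darts p - hole_darts p"
definition ud :: "'d \<Rightarrow> 'e set" where "ud h = darts (u h) - root_face (u h)"

lemma glue_darts_eq: "glue_darts p u = Inl ` pd \<union> Inr ` (SIGMA h:marks p. ud h)"
  by (auto simp: glue_darts_def pd_def ud_def)

lemma glue_darts_iff [simp]:
  "Inl d \<in> glue_darts p u \<longleftrightarrow> d \<in> pd" "Inr (h, y) \<in> glue_darts p u \<longleftrightarrow> h \<in> marks p \<and> y \<in> ud h"
  by (auto simp: glue_darts_eq)

lemma opp_hole: "x \<in> hole_darts p \<Longrightarrow> opp p x \<in> pd"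
  using quad_with_holesD(7)[OF qp] hole_darts_subset cp unfolding pd_def by auto

lemma in_hole: "h \<in> marks p \<Longrightarrow> x \<in> face p h \<Longrightarrow> x \<in> hole_darts p"
  by (auto simp: hole_darts_def)

lemma pd_opp_cases:
  assumes "d \<in> pd"
  obtains "opp p d \<in> pd" | h where "h \<in> marks p" "opp p d \<in> face p h"
  using assms cp by (auto simp: pd_def hole_darts_def)

lemma ud_opp_cases:
  assumes "h \<in> marks p" "y \<in> darts (u h)"
  obtains "opp (u h) y \<in> ud h" | "opp (u h) y \<in> root_face (u h)"
  using assms cu[OF assms(1)] by (auto simp: ud_def)

lemma glue_opp_pd: "opp p d \<in> pd \<Longrightarrow> glue_opp p u (Inl d) = Inl (opp p d)"
  using glue_opp0[of "Inl d"] by (simp add: pre_opp_def)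

lemma glue_opp_ud: "h \<in> marks p \<Longrightarrow> opp (u h) y \<in> ud h \<Longrightarrow> glue_opp p u (Inr (h, y)) = Inr (h, opp (u h) y)"
  using glue_opp0[of "Inr (h, y)"] by (simp add: pre_opp_def)

lemma glue_opp_root:
  assumes "h \<in> marks p" "opp (u h) y \<in> root_face (u h)"
  shows "glue_opp p u (Inr (h, y)) = Inl (opp p (to_hole h (opp (u h) y)))"
  using glue_opp1[of "Inr (h, y)"] assms opp_hole[OF in_hole[OF _ to_hole_in]]
  by (simp add: pre_opp_def jump_Inr) (simp add: ud_def)

lemma glue_opp_hole:
  assumes "h \<in> marks p" "opp p d \<in> face p h" "opp (u h) (to_root h (opp p d)) \<in> ud h"
  shows "glue_opp p u (Inl d) = Inr (h, opp (u h) (to_root h (opp p d)))"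
  using glue_opp1[of "Inl d"] assms in_hole[OF assms(1,2)]
  by (simp add: pre_opp_def jump_Inl) (simp add: pd_def)

lemma glue_opp_hole_root:
  assumes "h \<in> marks p" "opp p d \<in> face p h" "opp (u h) (to_root h (opp p d)) \<in> root_face (u h)"
  shows "glue_opp p u (Inl d) = Inl (opp p (to_hole h (opp (u h) (to_root h (opp p d)))))"
proof -
  have "opp p d \<notin> pd" using in_hole[OF assms(1,2)] by (simp add: pd_def)
  moreover have "opp (u h) (to_root h (opp p d)) \<notin> ud h" using assms by (simp add: ud_def)
  ultimately show ?thesis
  using glue_opp2[of "Inl d"] assms opp_hole[OF in_hole[OF _ to_hole_in]]
  by (simp add: pre_opp_def jump_Inl jump_Inr)
qed

lemma opp_to_hole_pd: "h \<in> marks p \<Longrightarrow> y \<in> root_face (u h) \<Longrightarrow> opp p (to_hole h y) \<in> pd"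
  using opp_hole in_hole to_hole_in by blast

lemma pd_darts: "d \<in> pd \<Longrightarrow> d \<in> darts p" and ud_darts: "y \<in> ud h \<Longrightarrow> y \<in> darts (u h)"
  by (auto simp: pd_def ud_def)

lemma to_hole_darts: "h \<in> marks p \<Longrightarrow> y \<in> root_face (u h) \<Longrightarrow> to_hole h y \<in> darts p"
  using to_hole_in in_hole hole_darts_subset by blast

lemma to_root_darts: "h \<in> marks p \<Longrightarrow> x \<in> face p h \<Longrightarrow> to_root h x \<in> darts (u h)"
  using to_root_in root_face_subset by blast

lemma glue_opp_step:
  assumes "x \<in> glue_darts p u"
  shows "glue_opp p u x \<in> glue_darts p u \<and> glue_opp p u x \<noteq> x \<and> glue_opp p u (glue_opp p u x) = x"
proof (cases x)
  case (Inl d)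
  then have d: "d \<in> pd" "d \<in> darts p" using assms pd_darts by auto
  note oo = opp_opp[OF cp d(2)]
  from d(1) show ?thesis
  proof (cases rule: pd_opp_cases)
    case 1 then show ?thesis using Inl d opp_neq[OF cp d(2)] glue_opp_pd oo by simp
  next
    case (2 h)
    let ?y = "to_root h (opp p d)"
    have y: "?y \<in> darts (u h)" "?y \<in> root_face (u h)" using to_root_darts to_root_in 2 by auto
    note oy = opp_opp[OF cu[OF 2(1)] y(1)]
    note ny = opp_neq[OF cu[OF 2(1)] y(1)]
    from 2(1) y(1) show ?thesis
    proof (cases rule: ud_opp_cases)
      case 1
      have "glue_opp p u (Inr (h, opp (u h) ?y)) = Inl d"
        using glue_opp_root[OF 2(1), of "opp (u h) ?y"] y(2) oy oo to_hole_to_root[OF 2] by simp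
      then show ?thesis using glue_opp_hole[OF 2 1] Inl 2 1 by simp
    next
      \<comment> \<open>An edge of \<open>u h\<close> with its root face on both sides joins two
        edges of the hole to each other; they are different because \<open>opp (u h)\<close> has no
        fixed point on the darts.\<close>
      case b: 2
      let ?y' = "opp (u h) ?y"
      have x': "to_hole h ?y' \<in> face p h" "to_hole h ?y' \<in> darts p"
        using to_hole_in to_hole_darts 2 b by auto
      have o: "opp p (opp p (to_hole h ?y')) = to_hole h ?y'" using opp_opp[OF cp x'(2)] .
      have "glue_opp p u (Inl (opp p (to_hole h ?y'))) = Inl d"
        using glue_opp_hole_root[of h "opp p (to_hole h ?y')"] 2 x'(1) o to_root_to_hole[OF 2(1) b] oy y(2)
          to_hole_to_root[OF 2] oo by simp
      moreover have "opp p (to_hole h ?y') \<noteq> d"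
        using o ny to_root_to_hole[OF 2(1) b] by metis
      ultimately show ?thesis
        using glue_opp_hole_root[OF 2 b] Inl opp_to_hole_pd[OF 2(1) b] by simp
    qed
  qed
next
  case (Inr z)
  then obtain h y where x: "x = Inr (h, y)" by (cases z) auto
  then have h: "h \<in> marks p" and y: "y \<in> ud h" "y \<in> darts (u h)" using assms ud_darts by auto
  note oy = opp_opp[OF cu[OF h] y(2)]
  from h y(2) show ?thesis
  proof (cases rule: ud_opp_cases)
    case 1 then show ?thesis using x y h opp_neq[OF cu[OF h] y(2)] glue_opp_ud[OF h] oy by simp
  next
    case 2
    have x': "to_hole h (opp (u h) y) \<in> face p h" "to_hole h (opp (u h) y) \<in> darts p"
      using to_hole_in to_hole_darts 2 h by auto
    have o: "opp p (opp p (to_hole h (opp (u h) y))) = to_hole h (opp (u h) y)" using opp_opp[OF cp x'(2)] .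
    have "glue_opp p u (Inl (opp p (to_hole h (opp (u h) y)))) = Inr (h, y)"
      using glue_opp_hole[of h "opp p (to_hole h (opp (u h) y))"] h x'(1) o to_root_to_hole[OF h 2] oy y(1) by simp
    then show ?thesis using glue_opp_root[OF h 2] x opp_to_hole_pd[OF h 2] by simp
  qed
qed

lemma darts_G [simp]: "darts G = glue_darts p u"
  and rootd_G [simp]: "rootd G = Inl (rootd p)"
  and marks_G: "marks G = (\<Union>h\<in>marks p. (\<lambda>d. Inr (h, d)) ` marks (u h))"
  by (simp_all add: glue_pmap_def)

lemma opp_G [simp]: "x \<in> glue_darts p u \<Longrightarrow> opp G x = glue_opp p u x"
  by (simp add: glue_pmap_def)

lemma nxt_G [simp]: "d \<in> pd \<Longrightarrow> nxt G (Inl d) = Inl (nxt p d)"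
  "h \<in> marks p \<Longrightarrow> y \<in> ud h \<Longrightarrow> nxt G (Inr (h, y)) = Inr (h, nxt (u h) y)"
  by (simp_all add: glue_pmap_def)

lemma pd_closed [simp]: "nxt p d \<in> pd \<longleftrightarrow> d \<in> pd" "inv (nxt p) d \<in> pd \<longleftrightarrow> d \<in> pd"
  by (simp_all add: pd_def hole_darts_closed[OF cp] nxt_in[OF cp] back_in[OF cp])

lemma ud_closed [simp]: "h \<in> marks p \<Longrightarrow> nxt (u h) y \<in> ud h \<longleftrightarrow> y \<in> ud h"
  "h \<in> marks p \<Longrightarrow> inv (nxt (u h)) y \<in> ud h \<longleftrightarrow> y \<in> ud h"
  by (simp_all add: ud_def hole_darts_closed[OF cu] nxt_in[OF cu] back_in[OF cu])

lemma finite_glue_darts: "finite (glue_darts p u)"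
proof -
  have "finite (marks p)" using quad_with_holesD(3)[OF qp] finite_darts[OF cp] finite_subset by blast
  then show ?thesis
    unfolding glue_darts_eq using finite_darts[OF cp] finite_darts[OF cu]
    by (intro finite_UnI finite_imageI finite_SigmaI) (auto simp: pd_def ud_def)
qed

lemma cmap_G: "cmap G"
proof -
  have "opp G permutes darts G"
    by (rule involution_permutes) (use glue_opp_step in \<open>auto simp: glue_pmap_def\<close>)
  moreover have "nxt G permutes darts G"
  proof (rule bij_imp_permutes)
    show "nxt G x = x" if "x \<notin> darts G" for x using that by (simp add: glue_pmap_def)
    let ?b = "\<lambda>x. case x of Inl d \<Rightarrow> Inl (inv (nxt p) d) | Inr (h, y) \<Rightarrow> Inr (h, inv (nxt (u h)) y)"
    show "bij_betw (nxt G) (darts G) (darts G)"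
    proof (rule bij_betw_byWitness[where f' = ?b])
      show "\<forall>x\<in>darts G. ?b (nxt G x) = x"
        by (auto simp: glue_darts_eq back_nxt[OF cp] back_nxt[OF cu])
      show "\<forall>x\<in>darts G. nxt G (?b x) = x"
        by (auto simp: glue_darts_eq nxt_back[OF cp] nxt_back[OF cu])
      show "nxt G ` darts G \<subseteq> darts G" by (auto simp: glue_darts_eq)
      show "?b ` darts G \<subseteq> darts G" by (auto simp: glue_darts_eq)
    qed
  qed
  ultimately show ?thesis
    using finite_glue_darts glue_opp_step by (simp add: cmap_def)
qed

text \<open>The sets \<open>A h\<close> allow two applications: all darts of the fillings give
  connectivity of the glued map, and the darts off their holes give connectivity away from the
  holes.\<close>

lemma linked_G_gen:
  assumes A: "\<And>h. h \<in> marks p \<Longrightarrow> linked (u h) (A h)" "\<And>h. h \<in> marks p \<Longrightarrow> A h \<subseteq> darts (u h)"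
    "\<And>h. h \<in> marks p \<Longrightarrow> root_face (u h) \<subseteq> A h" "\<And>h y. h \<in> marks p \<Longrightarrow> y \<in> A h \<Longrightarrow> nxt (u h) y \<in> A h"
  shows "linked G (Inl ` pd \<union> Inr ` (SIGMA h:marks p. A h \<inter> ud h))" (is "linked G ?B")
proof (rule linkedI[OF cmap_G])
  show "?B \<subseteq> darts G" by (auto simp: glue_darts_eq)
  show "nxt G d \<in> ?B" if "d \<in> ?B" for d using that A(4) by auto
  fix P :: "'d + 'd \<times> 'e \<Rightarrow> bool" and x y assume n: "\<And>c. c \<in> ?B \<Longrightarrow> P (nxt G c) = P c"
    and o: "\<And>c. c \<in> ?B \<Longrightarrow> opp G c \<in> ?B \<Longrightarrow> P (opp G c) = P c" and x: "x \<in> ?B" and y: "y \<in> ?B"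
  define c0 where "c0 \<longleftrightarrow> P (Inl (rootd p))"
  have r: "rootd p \<in> pd" using root_in quad_with_holesD(5)[OF qp] by (simp add: pd_def)
  have l: "P (Inl d) = c0" if d: "d \<in> pd" for d
    unfolding c0_def
  proof (rule linked_const[OF cp, of "pd" _ _ "\<lambda>d. P (Inl d)"])
    show "linked p pd" using quad_with_holesD(8)[OF qp] by (simp add: pd_def)
    fix c assume c: "c \<in> pd"
    show "P (Inl (nxt p c)) = P (Inl c)" using n[of "Inl c"] c by simp
    assume "opp p c \<in> pd" then show "P (Inl (opp p c)) = P (Inl c)"
      using o[of "Inl c"] c glue_opp_pd by simp
  qed (use d r in auto)
  have "P (Inr (h, y)) = c0" if h: "h \<in> marks p" and y: "y \<in> A h" "y \<in> ud h" for h y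
  proof -
    \<comment> \<open>The boundary darts of \<open>u h\<close> have disappeared from the glued map.
      Giving them the value \<open>c0\<close> found on \<open>p\<close> makes the predicate constant
      along the steps of \<open>u h\<close> within \<open>A h\<close>.\<close>
    define P' where "P' y = (if y \<in> root_face (u h) then c0 else P (Inr (h, y)))" for y
    have "P' y = P' (rootd (u h))"
    proof (rule linked_const[OF cu[OF h] A(1)[OF h] y(1)])
      show "rootd (u h) \<in> A h" using A(3)[OF h] face_self[OF cu[OF h]] by (auto simp: root_face_def)
      fix c assume c: "c \<in> A h"
      show "P' (nxt (u h) c) = P' c"
        using n[of "Inr (h, c)"] c h A(2)[OF h]
        by (auto simp: P'_def hole_darts_closed[OF cu] ud_def)
      assume c': "opp (u h) c \<in> A h"
      \<comment> \<open>The dart is glued to a dart of \<open>p\<close>, where the value is already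
        known to be \<open>c0\<close>.\<close>
      have key: "P (Inr (h, c)) = c0" if "c \<in> A h" "c \<in> ud h" "opp (u h) c \<in> root_face (u h)" for c
        using glue_opp_root[OF h that(3)] opp_to_hole_pd[OF h that(3)] o[of "Inr (h, c)"] that h l by simp
      have cd: "c \<in> darts (u h)" using c A(2) h by blast
      have oc: "opp (u h) (opp (u h) c) = c" by (rule opp_opp[OF cu[OF h] cd])
      show "P' (opp (u h) c) = P' c"
      proof (cases "c \<in> root_face (u h)"; cases "opp (u h) c \<in> root_face (u h)")
        assume "c \<notin> root_face (u h)" "opp (u h) c \<notin> root_face (u h)"
        moreover have "opp (u h) c \<in> ud h" "c \<in> ud h" using calculation cd opp_in[OF cu[OF h]] by (auto simp: ud_def)
        ultimately show ?thesis using o[of "Inr (h, c)"] c c' h glue_opp_ud[OF h] by (simp add: P'_def)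
      next
        assume "c \<notin> root_face (u h)" "opp (u h) c \<in> root_face (u h)"
        then show ?thesis using key[of c] c cd by (auto simp: P'_def ud_def)
      next
        assume "c \<in> root_face (u h)" "opp (u h) c \<notin> root_face (u h)"
        then show ?thesis using key[of "opp (u h) c"] c' cd oc opp_in[OF cu[OF h]] by (auto simp: P'_def ud_def)
      qed (auto simp: P'_def)
    qed
    then show ?thesis using y face_self[OF cu[OF h]] by (auto simp: P'_def ud_def root_face_def)
  qed
  with l x y show "P x = P y" by auto
qed

lemma face_G_Inl: "d \<in> pd \<Longrightarrow> face G (Inl d) = Inl ` face p d"
  unfolding face_def by (rule orbit_image[of pd]) auto

lemma face_G_Inr: "h \<in> marks p \<Longrightarrow> y \<in> ud h \<Longrightarrow> face G (Inr (h, y)) = (\<lambda>y. Inr (h, y)) ` face (u h) y"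
  unfolding face_def by (rule orbit_image[of "ud h"]) auto

lemma hole_darts_ud: "h \<in> marks p \<Longrightarrow> y \<in> hole_darts (u h) \<Longrightarrow> y \<in> ud h"
proof -
  assume h: "h \<in> marks p" and "y \<in> hole_darts (u h)"
  then obtain k where k: "k \<in> marks (u h)" "y \<in> face (u h) k" by (auto simp: hole_darts_def)
  have kd: "k \<in> darts (u h)" using k quad_with_holesD(3)[OF qu[OF h]] by blast
  have "y \<notin> root_face (u h)"
  proof
    assume "y \<in> root_face (u h)"
    then have "face (u h) k = face (u h) (rootd (u h))"
      using k(2) face_eq_iff[OF cu[OF h]] unfolding root_face_def by metis
    then have "rootd (u h) \<in> face (u h) k" using face_self[OF cu[OF h]] by blast
    then show False using quad_with_holesD(5)[OF qu[OF h]] k(1) by (auto simp: hole_darts_def)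
  qed
  then show ?thesis using face_subset[OF cu[OF h] kd] k(2) by (auto simp: ud_def)
qed

lemma marks_ud: "h \<in> marks p \<Longrightarrow> k \<in> marks (u h) \<Longrightarrow> k \<in> ud h"
  using hole_darts_ud[of h k] face_self[OF cu, of h k] by (auto simp: hole_darts_def)

lemma hole_darts_G: "hole_darts G = Inr ` (SIGMA h:marks p. hole_darts (u h))"
proof -
  have "hole_darts G = (\<Union>h\<in>marks p. \<Union>k\<in>marks (u h). face G (Inr (h, k)))"
    by (auto simp: hole_darts_def marks_G)
  also have "\<dots> = (\<Union>h\<in>marks p. \<Union>k\<in>marks (u h). (\<lambda>y. Inr (h, y)) ` face (u h) k)"
    by (intro SUP_cong refl face_G_Inr marks_ud)
  also have "\<dots> = Inr ` (SIGMA h:marks p. hole_darts (u h))"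
    by (auto simp: hole_darts_def)
  finally show ?thesis .
qed

section \<open>Euler's formula for the glued map\<close>

definition node :: "'d + 'd \<times> 'e \<Rightarrow> 'd set + 'd \<times> 'e set" where
  "node x = (case x of Inl d \<Rightarrow> Inl (vert p d) | Inr (h, y) \<Rightarrow> Inr (h, vert (u h) y))"

text \<open>The boundary of the filling runs against the hole, so the start of
  \<open>to_root h x\<close> meets the end of \<open>x\<close>, that is the start of
  \<open>opp p x\<close>.\<close>

definition corner :: "'d \<Rightarrow> 'd \<Rightarrow> ('d set + 'd \<times> 'e set) \<times> ('d set + 'd \<times> 'e set)" where
  "corner h x = (Inl (vert p (opp p x)), Inr (h, vert (u h) (to_root h x)))"

text \<open>The corner at the other end of the edge belongs to the preceding dart of the hole, which
  is matched with the next boundary dart of the filling (\<open>to_root_back\<close>).\<close>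

lemma node_root:
  assumes cls: "\<And>h x. h \<in> marks p \<Longrightarrow> x \<in> face p h \<Longrightarrow> cls (fst (corner h x)) = cls (snd (corner h x))"
    and h: "h \<in> marks p" and y: "y \<in> root_face (u h)"
  shows "cls (Inl (vert p (nxt p (opp p (to_hole h y))))) = cls (Inr (h, vert (u h) (nxt (u h) y)))"
proof -
  let ?x = "to_hole h y"
  have x: "?x \<in> face p h" "?x \<in> darts p" using to_hole_in to_hole_darts h y by auto
  have bx: "inv (nxt p) ?x \<in> face p h" using face_eq_iff[OF cp] face_back[OF cp] x(1) by metis
  have bd: "inv (nxt p) ?x \<in> darts p" using x(2) by (simp add: back_in[OF cp])
  have "cls (Inl (vert p (opp p (inv (nxt p) ?x)))) = cls (Inr (h, vert (u h) (nxt (u h) y)))"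
    using cls[OF h bx] to_root_back[OF h x(1)] to_root_to_hole[OF h y] by (simp add: corner_def)
  moreover have "vert p (opp p (inv (nxt p) ?x)) = vert p ?x"
    using vert_nxt[OF cp bd] nxt_back[OF cp] by simp
  moreover have "vert p (nxt p (opp p ?x)) = vert p ?x" by (rule vert_nxt_opp[OF cp])
  ultimately show ?thesis by simp
qed

text \<open>A step about a vertex of the glued map may pass between \<open>p\<close> and a filling
  more than once, but each passage takes place at an identified corner. Any merging of these corners
  is thus constant on vertices.\<close>

lemma node_G_step:
  assumes cls: "\<And>h x. h \<in> marks p \<Longrightarrow> x \<in> face p h \<Longrightarrow> cls (fst (corner h x)) = cls (snd (corner h x))"
    and x: "x \<in> glue_darts p u"
  shows "cls (node (nxt G (opp G x))) = cls (node x)"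
proof (cases x)
  case (Inl d)
  then have d: "d \<in> pd" "d \<in> darts p" using x pd_darts by auto
  from d(1) show ?thesis
  proof (cases rule: pd_opp_cases)
    case 1 then show ?thesis using Inl d glue_opp_pd vert_nxt_opp[OF cp, of d] by (simp add: node_def)
  next
    case (2 h)
    let ?y = "to_root h (opp p d)"
    have y: "?y \<in> darts (u h)" using to_root_darts 2 by auto
    have c: "cls (Inl (vert p d)) = cls (Inr (h, vert (u h) ?y))"
      using cls[OF 2] opp_opp[OF cp d(2)] by (simp add: corner_def)
    have v: "vert (u h) (nxt (u h) (opp (u h) ?y)) = vert (u h) ?y" by (rule vert_nxt_opp[OF cu[OF 2(1)]])
    from 2(1) y show ?thesis
    proof (cases rule: ud_opp_cases)
      case 1 then show ?thesis using glue_opp_hole[OF 2 1] Inl d c v 2 by (simp add: node_def)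
    next
      case b: 2
      then show ?thesis
        using node_root[of cls, OF cls 2(1) b] glue_opp_hole_root[OF 2 b] Inl c d v opp_to_hole_pd[OF 2(1) b]
        by (simp add: node_def)
    qed
  qed
next
  case (Inr z)
  then obtain h y where x': "x = Inr (h, y)" by (cases z) auto
  then have h: "h \<in> marks p" and y: "y \<in> ud h" "y \<in> darts (u h)" using x ud_darts by auto
  have v: "vert (u h) (nxt (u h) (opp (u h) y)) = vert (u h) y" by (rule vert_nxt_opp[OF cu[OF h]])
  from h y(2) show ?thesis
  proof (cases rule: ud_opp_cases)
    case 1 then show ?thesis using x' y h glue_opp_ud[OF h] v by (simp add: node_def)
  next
    case b: 2
    then show ?thesis
      using node_root[of cls, OF cls h b] glue_opp_root[OF h b] x' y h v opp_to_hole_pd[OF h b]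
      by (simp add: node_def)
  qed
qed

lemma finite_marks: "finite (marks p)"
  using quad_with_holesD(3)[OF qp] finite_darts[OF cp] finite_subset by blast

lemma card_hole_darts: "card (hole_darts p) = (\<Sum>h\<in>marks p. card (face p h))"
  unfolding hole_darts_def
  by (rule card_UN_disjoint) (use finite_marks finite_face[OF cp] hole_unique in auto)

text \<open>The vertices of \<open>p\<close> and of all fillings are merged along one corner for
  each hole dart; the classes that result label the vertices of the glued map.\<close>

lemma card_verts_G: "card (verts p) + (\<Sum>h\<in>marks p. card (verts (u h))) \<le> card (verts G) + card (hole_darts p)"
proof -
  define A where "A = Inl ` verts p \<union> Inr ` (SIGMA h:marks p. verts (u h))"
  define P where "P = (\<lambda>(h, x). corner h x) ` (SIGMA h:marks p. face p h)"
  have fv: "finite (verts p)" "h \<in> marks p \<Longrightarrow> finite (verts (u h))" for h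
    using finite_darts[OF cp] finite_darts[OF cu] by (auto simp: verts_def)
  have fin: "finite A" "finite P"
    unfolding A_def P_def using fv finite_marks finite_face[OF cp] by auto
  obtain cls :: "'d set + 'd \<times> 'e set \<Rightarrow> 'd set + 'd \<times> 'e set"
    where cls: "\<forall>(a, b)\<in>P. cls a = cls b" "card A \<le> card (cls ` A) + card P"
    using merge_classes[OF fin] by blast
  have cls': "cls (fst (corner h x)) = cls (snd (corner h x))" if "h \<in> marks p" "x \<in> face p h" for h x
    using cls(1) that unfolding P_def by (force simp: corner_def)
  \<comment> \<open>Every class must be seen from a surviving dart. If \<open>d\<close> lies on a
    hole, \<open>opp p (inv (nxt p) d)\<close> survives and starts at the same vertex; a boundary
    vertex of a filling is merged with a vertex of \<open>p\<close>.\<close>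
  have sub: "cls ` A \<subseteq> (cls \<circ> node) ` darts G"
  proof -
    have 1: "cls (Inl (vert p d)) \<in> (cls \<circ> node) ` darts G" if d: "d \<in> darts p" for d
    proof (cases "d \<in> hole_darts p")
      case False
      then show ?thesis using d by (intro image_eqI[of _ _ "Inl d"]) (auto simp: node_def pd_def)
    next
      case True
      have bd: "inv (nxt p) d \<in> hole_darts p" using True hole_darts_closed[OF cp] by blast
      have "opp p (inv (nxt p) d) \<in> pd" using opp_hole[OF bd] .
      moreover have "vert p (opp p (inv (nxt p) d)) = vert p d"
        using vert_nxt[OF cp, of "inv (nxt p) d"] d by (simp add: nxt_back[OF cp] back_in[OF cp])
      ultimately show ?thesis
        by (intro image_eqI[of _ _ "Inl (opp p (inv (nxt p) d))"]) (auto simp: node_def)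
    qed
    have 2: "cls (Inr (h, vert (u h) y)) \<in> (cls \<circ> node) ` darts G" if h: "h \<in> marks p" and y: "y \<in> darts (u h)" for h y
    proof (cases "y \<in> root_face (u h)")
      case False
      then show ?thesis using h y by (intro image_eqI[of _ _ "Inr (h, y)"]) (auto simp: node_def ud_def)
    next
      case True
      have x: "to_hole h y \<in> face p h" "to_hole h y \<in> darts p" using to_hole_in to_hole_darts h True by auto
      have "cls (Inr (h, vert (u h) y)) = cls (Inl (vert p (opp p (to_hole h y))))"
        using cls'[OF h x(1)] to_root_to_hole[OF h True] by (simp add: corner_def)
      then show ?thesis using 1[of "opp p (to_hole h y)"] x(2) by (simp add: opp_in[OF cp])
    qed
    show ?thesis unfolding A_def using 1 2 by (auto simp: verts_def)
  qed
  have "card (cls ` A) \<le> card ((cls \<circ> node) ` darts G)"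
    using sub finite_glue_darts by (intro card_mono) auto
  also have "\<dots> \<le> card (orbit (nxt G \<circ> opp G) ` darts G)"
    by (rule card_image_le_orbits[OF finite_darts[OF cmap_G] step_permutes[OF cmap_G]])
      (use node_G_step[of cls, OF cls'] in simp)
  finally have 1: "card (cls ` A) \<le> card (verts G)" by (simp add: verts_def)
  have "card P \<le> card (SIGMA h:marks p. face p h)"
    unfolding P_def using finite_marks finite_face[OF cp] by (intro card_image_le) auto
  also have "\<dots> = card (hole_darts p)"
    using finite_marks finite_face[OF cp] by (simp add: card_hole_darts card_SigmaI)
  finally have 2: "card P \<le> card (hole_darts p)" .
  have "card A = card (Inl ` verts p :: ('d set + 'd \<times> 'e set) set) + card (Inr ` (SIGMA h:marks p. verts (u h)) :: ('d set + 'd \<times> 'e set) set)"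
    unfolding A_def using fv finite_marks by (intro card_Un_disjoint) auto
  also have "\<dots> = card (verts p) + (\<Sum>h\<in>marks p. card (verts (u h)))"
    using fv finite_marks by (simp add: card_image card_SigmaI)
  finally show ?thesis using cls(2) 1 2 by linarith
qed

text \<open>Each hole costs two faces, the hole itself and the root face of its filling; all other
  faces survive.\<close>

lemma card_faces_G: "card (faces p) + (\<Sum>h\<in>marks p. card (faces (u h))) \<le> card (faces G) + 2 * card (marks p)"
proof -
  define g where "g x = (case x of Inl d \<Rightarrow> Inl (face p d) | Inr (h, y) \<Rightarrow> Inr (h, face (u h) y))"
    for x :: "'d + 'd \<times> 'e"
  have "card (g ` darts G) \<le> card (orbit (nxt G) ` darts G)"
    by (rule card_image_le_orbits[OF finite_darts[OF cmap_G] nxt_permutes[OF cmap_G]])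
      (auto simp: glue_darts_eq g_def face_nxt[OF cp] face_nxt[OF cu])
  also have "orbit (nxt G) ` darts G = faces G" by (auto simp: faces_def face_def)
  also have "g ` darts G = Inl ` (face p ` pd) \<union> Inr ` (SIGMA h:marks p. face (u h) ` ud h)"
  proof -
    have "g ` darts G = (\<lambda>d. g (Inl d)) ` pd \<union> (\<lambda>z. g (Inr z)) ` (SIGMA h:marks p. ud h)"
      by (simp add: glue_darts_eq image_Un image_image)
    also have "(\<lambda>d. g (Inl d)) ` pd = Inl ` (face p ` pd)" by (auto simp: g_def)
    also have "(\<lambda>z. g (Inr z)) ` (SIGMA h:marks p. ud h) = Inr ` (SIGMA h:marks p. face (u h) ` ud h)"
      unfolding g_def by force
    finally show ?thesis .
  qed
  finally have 1: "card (Inl ` (face p ` pd) \<union> Inr ` (SIGMA h:marks p. face (u h) ` ud h) :: ('d set + 'd \<times> 'e set) set) \<le> card (faces G)" .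
  have f: "finite pd" "h \<in> marks p \<Longrightarrow> finite (ud h)" for h
    using finite_darts[OF cp] finite_darts[OF cu] by (auto simp: pd_def ud_def)
  have "card (Inl ` (face p ` pd) \<union> Inr ` (SIGMA h:marks p. face (u h) ` ud h) :: ('d set + 'd \<times> 'e set) set)
     = card (Inl ` (face p ` pd) :: ('d set + 'd \<times> 'e set) set) + card (Inr ` (SIGMA h:marks p. face (u h) ` ud h) :: ('d set + 'd \<times> 'e set) set)"
    using f finite_marks by (intro card_Un_disjoint) auto
  also have "\<dots> = card (face p ` pd) + (\<Sum>h\<in>marks p. card (face (u h) ` ud h))"
    using f finite_marks by (simp add: card_image card_SigmaI)
  finally have 2: "card (face p ` pd) + (\<Sum>h\<in>marks p. card (face (u h) ` ud h)) \<le> card (faces G)" using 1 by simp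
  have "faces p \<subseteq> face p ` pd \<union> face p ` marks p"
  proof
    fix w assume "w \<in> faces p"
    then obtain d where d: "d \<in> darts p" "w = face p d" by (auto simp: faces_def)
    show "w \<in> face p ` pd \<union> face p ` marks p"
    proof (cases "d \<in> hole_darts p")
      case True
      then obtain h where "h \<in> marks p" "d \<in> face p h" by (auto simp: hole_darts_def)
      then show ?thesis using d face_eq_iff[OF cp] by blast
    qed (use d in \<open>auto simp: pd_def\<close>)
  qed
  then have "card (faces p) \<le> card (face p ` pd \<union> face p ` marks p)"
    using f finite_marks by (intro card_mono) auto
  also have "\<dots> \<le> card (face p ` pd) + card (face p ` marks p)" by (rule card_Un_le)
  also have "\<dots> \<le> card (face p ` pd) + card (marks p)" using card_image_le[OF finite_marks] by simp
  finally have 3: "card (faces p) \<le> card (face p ` pd) + card (marks p)" .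
  have 4: "card (faces (u h)) \<le> card (face (u h) ` ud h) + 1" if h: "h \<in> marks p" for h
  proof -
    have "faces (u h) \<subseteq> insert (root_face (u h)) (face (u h) ` ud h)"
    proof
      fix w assume "w \<in> faces (u h)"
      then obtain d where d: "d \<in> darts (u h)" "w = face (u h) d" by (auto simp: faces_def)
      then show "w \<in> insert (root_face (u h)) (face (u h) ` ud h)"
        using face_eq_iff[OF cu[OF h]] by (cases "d \<in> root_face (u h)") (auto simp: ud_def root_face_def)
    qed
    then have "card (faces (u h)) \<le> card (insert (root_face (u h)) (face (u h) ` ud h))"
      using f h by (intro card_mono) auto
    then show ?thesis using f(2)[OF h] by (simp add: card_insert_if split: if_splits)
  qed
  have "(\<Sum>h\<in>marks p. card (faces (u h))) \<le> (\<Sum>h\<in>marks p. card (face (u h) ` ud h) + 1)"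
    by (rule sum_mono) (rule 4)
  also have "\<dots> = (\<Sum>h\<in>marks p. card (face (u h) ` ud h)) + card (marks p)"
    by (simp only: sum.distrib) simp
  finally show ?thesis using 2 3 by linarith
qed

lemma card_darts_G: "card (darts G) + 2 * card (hole_darts p) = card (darts p) + (\<Sum>h\<in>marks p. card (darts (u h)))"
proof -
  have f: "finite pd" "h \<in> marks p \<Longrightarrow> finite (ud h)" for h
    using finite_darts[OF cp] finite_darts[OF cu] by (auto simp: pd_def ud_def)
  have "card (darts G) = card (Inl ` pd :: ('d + 'd \<times> 'e) set) + card (Inr ` (SIGMA h:marks p. ud h) :: ('d + 'd \<times> 'e) set)"
    unfolding darts_G glue_darts_eq using f finite_marks by (intro card_Un_disjoint) auto
  also have "\<dots> = card pd + (\<Sum>h\<in>marks p. card (ud h))"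
    using f finite_marks by (simp add: card_image card_SigmaI)
  finally have 1: "card (darts G) = card pd + (\<Sum>h\<in>marks p. card (ud h))" .
  have 2: "card pd + card (hole_darts p) = card (darts p)"
    unfolding pd_def using hole_darts_subset finite_darts[OF cp]
    by (metis card_Diff_subset card_mono finite_subset le_add_diff_inverse2)
  have "card (ud h) + card (face p h) = card (darts (u h))" if h: "h \<in> marks p" for h
    unfolding ud_def deg[OF h, symmetric] using root_face_subset[OF h] finite_darts[OF cu[OF h]]
    by (metis card_Diff_subset card_mono finite_subset le_add_diff_inverse2)
  then have "(\<Sum>h\<in>marks p. card (darts (u h))) = (\<Sum>h\<in>marks p. card (ud h)) + card (hole_darts p)"
    by (simp add: card_hole_darts sum.distrib[symmetric])
  then show ?thesis using 1 2 by linarith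
qed

text \<open>Gluing loses exactly one edge and at most one vertex for each hole dart, and at most two
  faces for each hole. The faces are paid for by the Euler characteristic 2 of the filling, so the
  glued map has Euler characteristic at least 2.\<close>

theorem quad_with_holes_G: "quad_with_holes G"
proof -
  have lk: "linked G (darts G)"
  proof -
    have "linked G (Inl ` pd \<union> Inr ` (SIGMA h:marks p. darts (u h) \<inter> ud h))"
      using planar_mapD[OF quad_with_holesD(1)[OF qu]] root_face_subset nxt_in[OF cu]
      by (intro linked_G_gen) auto
    moreover have "(SIGMA h:marks p. darts (u h) \<inter> ud h) = (SIGMA h:marks p. ud h)"
      using ud_darts by blast
    ultimately show ?thesis by (simp add: glue_darts_eq)
  qed
  have "linked G (Inl ` pd \<union> Inr ` (SIGMA h:marks p. (darts (u h) - hole_darts (u h)) \<inter> ud h))"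
  proof (rule linked_G_gen)
    fix h assume h: "h \<in> marks p"
    show "root_face (u h) \<subseteq> darts (u h) - hole_darts (u h)"
      using root_face_subset[OF h] hole_darts_ud[OF h] by (auto simp: ud_def)
  qed (auto simp: quad_with_holesD(8)[OF qu] nxt_in[OF cu] hole_darts_closed[OF cu])
  moreover have "Inl ` pd \<union> Inr ` (SIGMA h:marks p. (darts (u h) - hole_darts (u h)) \<inter> ud h) = darts G - hole_darts G"
    unfolding hole_darts_G darts_G glue_darts_eq using hole_darts_ud ud_darts by auto
  ultimately have lk': "linked G (darts G - hole_darts G)" by simp
  have "2 * card (edges G) + 2 * card (hole_darts p) = 2 * card (edges p) + (\<Sum>h\<in>marks p. 2 * card (edges (u h)))"
    using card_darts_G card_edges[OF cmap_G] card_edges[OF cp] card_edges[OF cu] by simp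
  then have e: "card (edges G) + card (hole_darts p) = card (edges p) + (\<Sum>h\<in>marks p. card (edges (u h)))"
    by (simp add: sum_distrib_left[symmetric])
  have "(\<Sum>h\<in>marks p. card (verts (u h))) + (\<Sum>h\<in>marks p. card (faces (u h))) = (\<Sum>h\<in>marks p. card (edges (u h)) + 2)"
    unfolding sum.distrib[symmetric]
    by (intro sum.cong refl planar_mapD(5)[OF quad_with_holesD(1)[OF qu]])
  then have eu: "(\<Sum>h\<in>marks p. card (verts (u h))) + (\<Sum>h\<in>marks p. card (faces (u h))) = (\<Sum>h\<in>marks p. card (edges (u h))) + 2 * card (marks p)"
    by (simp only: sum.distrib) simp
  have r: "rootd p \<in> pd" using root_in quad_with_holesD(5)[OF qp] by (simp add: pd_def)
  have "planar_map G"
  proof (rule planar_mapI[OF cmap_G lk])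
    show "rootd G \<in> darts G" using r by simp
    show "card (edges G) + 2 \<le> card (verts G) + card (faces G)"
      using e eu card_verts_G card_faces_G planar_mapD(5)[OF quad_with_holesD(1)[OF qp]] by linarith
  qed
  moreover have "marks G \<subseteq> darts G" using marks_ud by (auto simp: marks_G)
  moreover have "inj_on (face G) (marks G)"
  proof (rule inj_onI)
    fix a b assume "a \<in> marks G" "b \<in> marks G" and e: "face G a = face G b"
    then obtain h k h' k' where a: "h \<in> marks p" "k \<in> marks (u h)" "a = Inr (h, k)"
      and b: "h' \<in> marks p" "k' \<in> marks (u h')" "b = Inr (h', k')"
      by (auto simp: marks_G)
    have *: "(\<lambda>y. Inr (h, y) :: 'd + 'd \<times> 'e) ` face (u h) k = (\<lambda>y. Inr (h', y)) ` face (u h') k'"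
      using e a b face_G_Inr marks_ud by simp
    have "k \<in> face (u h) k" by (rule face_self[OF cu[OF a(1)]])
    then have hh: "h = h'" using * by blast
    have "inj (\<lambda>y. Inr (h, y) :: 'd + 'd \<times> 'e)" by (auto intro: injI)
    then have "face (u h) k = face (u h) k'" using * hh inj_image_eq_iff by metis
    then have "k = k'" using quad_with_holesD(4)[OF qu[OF a(1)]] a b hh by (auto simp: inj_on_def)
    then show "a = b" using a b hh by simp
  qed
  moreover have "rootd G \<notin> hole_darts G" by (auto simp: hole_darts_G)
  moreover have "\<forall>d\<in>darts G - root_face G - hole_darts G. card (face G d) = 4"
  proof
    fix x assume x: "x \<in> darts G - root_face G - hole_darts G"
    have rf: "root_face G = Inl ` root_face p" using face_G_Inl[OF r] by (simp add: root_face_def)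
    show "card (face G x) = 4"
    proof (cases x)
      case (Inl d)
      then have "d \<in> pd" "d \<notin> root_face p" using x rf by auto
      then show ?thesis using quad_with_holesD(6)[OF qp, of d] Inl face_G_Inl[of d]
        by (simp add: card_image pd_def)
    next
      case (Inr z)
      then obtain h y where z: "x = Inr (h, y)" by (cases z) auto
      have y: "h \<in> marks p" "y \<in> ud h" "y \<notin> hole_darts (u h)" using x z hole_darts_G by auto
      then have "card (face (u h) y) = 4" using quad_with_holesD(6)[OF qu[OF y(1)], of y] by (auto simp: ud_def)
      then show ?thesis using z face_G_Inr[OF y(1,2)] by (simp add: card_image inj_on_def)
    qed
  qed
  moreover have "\<forall>d\<in>hole_darts G. opp G d \<notin> hole_darts G"
  proof
    fix x assume "x \<in> hole_darts G"
    then obtain h y where x: "x = Inr (h, y)" "h \<in> marks p" "y \<in> hole_darts (u h)" by (auto simp: hole_darts_G)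
    have y: "y \<in> ud h" using hole_darts_ud x by blast
    from x(2) ud_darts[OF y] show "opp G x \<notin> hole_darts G"
    proof (cases rule: ud_opp_cases)
      case 1
      then show ?thesis using x y glue_opp_ud quad_with_holesD(7)[OF qu[OF x(2)] x(3)] by (auto simp: hole_darts_G)
    next
      case 2
      then show ?thesis using x y glue_opp_root by (auto simp: hole_darts_G)
    qed
  qed
  ultimately show ?thesis using lk' unfolding quad_with_holes_def by blast
qed

end

section \<open>Isomorphisms and classes\<close>

lemma rooted_isoD:
  assumes "rooted_iso f m m'"
  shows "bij_betw f (darts m) (darts m')" "f (rootd m) = rootd m'"
    "\<And>d. d \<in> darts m \<Longrightarrow> f (opp m d) = opp m' (f d)"
    "\<And>d. d \<in> darts m \<Longrightarrow> f (nxt m d) = nxt m' (f d)"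
    "inj_on f (darts m)" "f ` darts m = darts m'"
  using assms by (auto simp: rooted_iso_def bij_betw_def)

context
  fixes m :: "'a pmap" and m' :: "'b pmap" and f
  assumes cm: "cmap m" and cm': "cmap m'" and iso: "rooted_iso f m m'"
begin

lemmas isoD = rooted_isoD[OF iso]

lemma iso_in: "d \<in> darts m \<Longrightarrow> f d \<in> darts m'"
  using isoD(6) by blast

lemma iso_back: "d \<in> darts m \<Longrightarrow> f (inv (nxt m) d) = inv (nxt m') (f d)"
proof -
  assume d: "d \<in> darts m"
  have "nxt m' (f (inv (nxt m) d)) = f d"
    using isoD(4)[of "inv (nxt m) d"] d back_in[OF cm] nxt_back[OF cm] by simp
  then show ?thesis using back_nxt[OF cm'] by metis
qed

lemma iso_back_funpow:
  assumes "d \<in> darts m"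
  shows "(inv (nxt m) ^^ i) d \<in> darts m \<and> f ((inv (nxt m) ^^ i) d) = (inv (nxt m') ^^ i) (f d)"
  by (induct i) (use assms iso_back back_in[OF cm] in auto)

lemma iso_nxt_funpow:
  assumes "d \<in> darts m"
  shows "(nxt m ^^ i) d \<in> darts m \<and> f ((nxt m ^^ i) d) = (nxt m' ^^ i) (f d)"
  by (induct i) (use assms isoD(4) nxt_in[OF cm] in auto)

lemma iso_face: "d \<in> darts m \<Longrightarrow> face m' (f d) = f ` face m d"
  unfolding face_def by (rule orbit_image[of "darts m"]) (use isoD(4) nxt_in[OF cm] in auto)

lemma iso_vert: "d \<in> darts m \<Longrightarrow> vert m' (f d) = f ` vert m d"
  by (rule orbit_image[of "darts m"]) (use isoD(3,4) nxt_in[OF cm] opp_in[OF cm] in auto)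

lemma iso_root_face: "rootd m \<in> darts m \<Longrightarrow> root_face m' = f ` root_face m"
  unfolding root_face_def using iso_face isoD(2) by metis

lemma iso_hole_darts: "marks m \<subseteq> darts m \<Longrightarrow> f ` marks m = marks m' \<Longrightarrow> hole_darts m' = f ` hole_darts m"
proof -
  assume ma: "marks m \<subseteq> darts m" "f ` marks m = marks m'"
  have "hole_darts m' = (\<Union>h\<in>marks m. face m' (f h))" unfolding hole_darts_def ma(2)[symmetric] by simp
  also have "\<dots> = (\<Union>h\<in>marks m. f ` face m h)" using ma iso_face by (intro SUP_cong refl) auto
  finally show ?thesis by (auto simp: hole_darts_def)
qed

lemma iso_card_image:
  assumes "\<W> \<subseteq> Pow (darts m)" shows "card ((`) f ` \<W>) = card \<W>"
  by (rule card_image, rule inj_on_image, rule inj_on_subset[OF isoD(5)]) (use assms in auto)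

lemma iso_linked:
  assumes lk: "linked m A" and A: "A \<subseteq> darts m" "\<And>d. d \<in> A \<Longrightarrow> nxt m d \<in> A"
  shows "linked m' (f ` A)"
proof (rule linkedI[OF cm'])
  show "f ` A \<subseteq> darts m'" using A iso_in by blast
  fix d assume "d \<in> f ` A" then show "nxt m' d \<in> f ` A" using A isoD(4) by force
next
  fix P :: "'b \<Rightarrow> bool" and x y
  assume n: "\<And>c. c \<in> f ` A \<Longrightarrow> P (nxt m' c) = P c"
    and o: "\<And>c. c \<in> f ` A \<Longrightarrow> opp m' c \<in> f ` A \<Longrightarrow> P (opp m' c) = P c" and x: "x \<in> f ` A" and y: "y \<in> f ` A"
  obtain a b where ab: "a \<in> A" "x = f a" "b \<in> A" "y = f b" using x y by blast
  have "P (f a) = P (f b)"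
  proof (rule linked_const[OF cm lk ab(1,3), of "\<lambda>d. P (f d)"])
    fix c assume c: "c \<in> A"
    then have cd: "c \<in> darts m" using A by blast
    show "P (f (nxt m c)) = P (f c)" using n[of "f c"] c isoD(4)[OF cd] by simp
    assume "opp m c \<in> A"
    then show "P (f (opp m c)) = P (f c)" using o[of "f c"] c isoD(3)[OF cd] by (metis imageI)
  qed
  then show "P x = P y" using ab by simp
qed

lemma iso_quad_with_holes:
  assumes q: "quad_with_holes m" and ma: "f ` marks m = marks m'"
  shows "quad_with_holes m'"
proof -
  note Q = quad_with_holesD[OF q] and P = planar_mapD[OF quad_with_holesD(1)[OF q]]
  note hd = iso_hole_darts[OF Q(3) ma] and rf = iso_root_face[OF P(3)]
  have hs: "hole_darts m \<subseteq> darts m"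
    using Q(3) face_subset[OF cm] by (auto simp: hole_darts_def)
  have rs: "root_face m \<subseteq> darts m"
    using P(3) face_subset[OF cm] by (auto simp: root_face_def)
  have mem: "f d \<in> f ` B \<longleftrightarrow> d \<in> B" if "d \<in> darts m" "B \<subseteq> darts m" for d B
    using that isoD(5) by (auto simp: inj_on_def)
  have "faces m' = (`) f ` faces m"
    unfolding faces_def image_image isoD(6)[symmetric] using iso_face by (intro image_cong) auto
  then have cf: "card (faces m') = card (faces m)"
    using iso_card_image[of "faces m"] face_subset[OF cm] unfolding faces_def by (metis image_subsetI PowI)
  have "verts m' = (`) f ` verts m"
    unfolding verts_def image_image isoD(6)[symmetric] using iso_vert by (intro image_cong) auto
  then have cv: "card (verts m') = card (verts m)"
    using iso_card_image[of "verts m"] permutes_orbit_subset[OF step_permutes[OF cm]]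
    unfolding verts_def by (metis image_subsetI PowI)
  have "card (darts m') = card (darts m)"
    using card_image[OF isoD(5)] isoD(6) by simp
  then have ce: "card (edges m') = card (edges m)"
    using card_edges[OF cm] card_edges[OF cm'] by simp
  have lk: "linked m' (darts m')"
  proof -
    have "linked m' (f ` darts m)" by (rule iso_linked[OF P(2)]) (simp_all add: nxt_in[OF cm])
    then show ?thesis unfolding isoD(6) .
  qed
  have "rootd m' \<in> darts m'" using iso_in[OF P(3)] unfolding isoD(2) .
  then have "planar_map m'"
    by (rule planar_mapI[OF cm' lk]) (simp add: cf cv ce P(5))
  moreover have "marks m' \<subseteq> darts m'"
    unfolding ma[symmetric] by (rule image_subsetI, rule iso_in) (use Q(3) in auto)
  moreover have "inj_on (face m') (marks m')"
  proof (rule inj_onI)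
    fix a b assume ab: "a \<in> marks m'" "b \<in> marks m'" "face m' a = face m' b"
    obtain x y where "x \<in> marks m" "y \<in> marks m" "a = f x" "b = f y"
      using ab(1,2) unfolding ma[symmetric] by blast
    then have x: "x \<in> marks m" "y \<in> marks m" "a = f x" "b = f y" "face m' (f x) = face m' (f y)"
      using ab(3) by simp_all
    have xd: "x \<in> darts m" "y \<in> darts m" using x Q(3) by auto
    then have "f ` face m x = f ` face m y" using x(5) iso_face by simp
    then have "face m x = face m y"
      using inj_on_image_eq_iff[OF isoD(5)] face_subset[OF cm] xd by blast
    then show "a = b" using Q(4) x by (auto simp: inj_on_def)
  qed
  moreover have "rootd m' \<notin> hole_darts m'"
    using mem[OF P(3) hs] Q(5) isoD(2) hd by simp
  moreover have "\<forall>d\<in>darts m' - root_face m' - hole_darts m'. card (face m' d) = 4"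
  proof
    fix d assume d: "d \<in> darts m' - root_face m' - hole_darts m'"
    then obtain c where c: "c \<in> darts m" "d = f c" using isoD(6) by blast
    then have "card (face m c) = 4" using d mem[OF c(1) rs] mem[OF c(1) hs] hd rf Q(6) by simp
    then show "card (face m' d) = 4"
      using c iso_face card_image[OF inj_on_subset[OF isoD(5) face_subset[OF cm c(1)]]] by simp
  qed
  moreover have "\<forall>d\<in>hole_darts m'. opp m' d \<notin> hole_darts m'"
  proof
    fix d assume "d \<in> hole_darts m'"
    then obtain c where c: "c \<in> hole_darts m" "d = f c" using hd by blast
    have "opp m c \<in> darts m" using c hs opp_in[OF cm] by blast
    then show "opp m' d \<notin> hole_darts m'"
      using c hs Q(7)[OF c(1)] mem[OF _ hs, of "opp m c"] isoD(3) hd by (metis subsetD)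
  qed
  moreover have "linked m' (darts m' - hole_darts m')"
  proof -
    have "darts m' - hole_darts m' = f ` (darts m - hole_darts m)"
      unfolding hd isoD(6)[symmetric] using hs isoD(5) by (simp add: inj_on_image_set_diff[of f "darts m"])
    moreover have "linked m' (f ` (darts m - hole_darts m))"
      by (rule iso_linked[OF Q(8)]) (auto simp: nxt_in[OF cm] hole_darts_closed[OF cm])
    ultimately show ?thesis by simp
  qed
  ultimately show ?thesis unfolding quad_with_holes_def by blast
qed

end

text \<open>Makes the choice in \<open>class_of\<close> meaningful: glued and discovered maps have
  darts in sum types, whereas \<open>hmap\<close> is built from maps on natural numbers.\<close>

lemma exists_nat_rep:
  assumes q: "quad_with_holes m"
  shows "\<exists>m' :: nat pmap. quad_with_holes m' \<and> map_iso m m'"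
proof -
  note cm = quad_with_holesD(2)[OF q] and r = planar_mapD(3)[OF quad_with_holesD(1)[OF q]]
  obtain f :: "'a \<Rightarrow> nat" where inj: "inj_on f (darts m)"
    using finite_imp_inj_to_nat_seg[OF finite_darts[OF cm]] by blast
  define g where "g = the_inv_into (darts m) f"
  have gf: "g (f d) = d" if "d \<in> darts m" for d
    using that inj by (simp add: g_def the_inv_into_f_f)
  define m' where "m' = \<lparr>darts = f ` darts m,
    opp = (\<lambda>x. if x \<in> f ` darts m then f (opp m (g x)) else x),
    nxt = (\<lambda>x. if x \<in> f ` darts m then f (nxt m (g x)) else x),
    rootd = f (rootd m), marks = f ` marks m\<rparr>"
  have "opp m' permutes darts m'"
  proof (rule involution_permutes)
    fix x assume "x \<in> darts m'"
    then obtain d where "d \<in> darts m" "x = f d" by (auto simp: m'_def)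
    then show "opp m' x \<in> darts m' \<and> opp m' (opp m' x) = x"
      by (simp add: m'_def gf opp_opp[OF cm] opp_in[OF cm])
  qed (simp add: m'_def)
  moreover have "nxt m' permutes darts m'"
  proof (rule bij_imp_permutes)
    show "bij_betw (nxt m') (darts m') (darts m')"
      by (rule bij_betw_byWitness[where f' = "\<lambda>x. f (inv (nxt m) (g x))"])
        (auto simp: m'_def gf nxt_in[OF cm] back_in[OF cm] nxt_back[OF cm] back_nxt[OF cm])
  qed (simp add: m'_def)
  moreover have "opp m' x \<noteq> x \<and> opp m' (opp m' x) = x" if x: "x \<in> darts m'" for x
  proof -
    obtain d where d: "d \<in> darts m" "x = f d" using x by (auto simp: m'_def)
    have "f (opp m d) \<noteq> f d"
      using opp_neq[OF cm d(1)] opp_in[OF cm] d(1) inj by (auto simp: inj_on_def)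
    then show ?thesis using d by (simp add: m'_def gf opp_in[OF cm] opp_opp[OF cm])
  qed
  ultimately have cm': "cmap m'"
    using finite_darts[OF cm] by (simp add: cmap_def) (simp add: m'_def)
  have iso: "rooted_iso f m m'" "f ` marks m = marks m'"
    using inj by (auto simp: rooted_iso_def m'_def gf bij_betw_def)
  have "quad_with_holes m'" by (rule iso_quad_with_holes[OF cm cm' iso(1) q iso(2)])
  then show ?thesis using iso unfolding map_iso_def by blast
qed

lemma quad_with_holes_rep: "quad_with_holes (rep_hmap p)"
  using Quotient3_rep_reflp[OF Quotient3_hmap, of p] by blast

lemma rep_abs_hmap: "quad_with_holes m \<Longrightarrow> map_iso (rep_hmap (abs_hmap m)) m"
  using Quotient3_rep_abs[OF Quotient3_hmap, of m] map_iso_refl[of m] by blast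

lemma abs_hmap_eqI: "quad_with_holes m \<Longrightarrow> map_iso m (rep_hmap p) \<Longrightarrow> abs_hmap m = p"
  using Quotient3_rel[OF Quotient3_hmap, of m "rep_hmap p"] quad_with_holes_rep[of p]
    Quotient3_abs_rep[OF Quotient3_hmap, of p] map_iso_refl by metis

lemma class_of_aux:
  assumes "quad_with_holes m"
  shows "\<exists>m' :: nat pmap. quad_with_holes m' \<and> map_iso m m' \<and> class_of m = abs_hmap m'"
  using someI_ex[OF exists_nat_rep[OF assms]] unfolding class_of_def by blast

lemma rep_class_of:
  assumes "quad_with_holes m" shows "map_iso (rep_hmap (class_of m)) m"
proof -
  obtain m' :: "nat pmap" where m': "quad_with_holes m'" "map_iso m m'" "class_of m = abs_hmap m'"
    using class_of_aux[OF assms] by blast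
  then show ?thesis using rep_abs_hmap[OF m'(1)] map_iso_sym[OF assms m'(2)] map_iso_trans by metis
qed

lemma class_of_eqI:
  assumes "quad_with_holes m" "map_iso m (rep_hmap p)" shows "class_of m = p"
proof -
  obtain m' :: "nat pmap" where m': "quad_with_holes m'" "map_iso m m'" "class_of m = abs_hmap m'"
    using class_of_aux[OF assms(1)] by blast
  then have "map_iso m' (rep_hmap p)" using map_iso_sym[OF assms(1) m'(2)] assms(2) map_iso_trans by blast
  then show ?thesis using abs_hmap_eqI[OF m'(1)] m'(3) by simp
qed

lemma fills_gluing:
  assumes "\<forall>h\<in>holes p. perimeter (u h) = hole_deg p h"
  shows "gluing (rep_hmap p) (\<lambda>h. rep_hmap (u h))"
  by unfold_locales (use assms quad_with_holes_rep in \<open>auto simp: holes_def perimeter_def hole_deg_def\<close>)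

lemma fills_rep:
  assumes "fills p u p'"
  shows "gluing (rep_hmap p) (\<lambda>h. rep_hmap (u h))"
    "map_iso (rep_hmap p') (glue_pmap (rep_hmap p) (\<lambda>h. rep_hmap (u h)))"
  using assms fills_gluing[of p u] rep_class_of[OF gluing.quad_with_holes_G] by (auto simp: fills_def glue_def)

lemma fillsI:
  assumes "gluing (rep_hmap p) (\<lambda>h. rep_hmap (u h))"
    "map_iso (glue_pmap (rep_hmap p) (\<lambda>h. rep_hmap (u h))) (rep_hmap p')"
  shows "fills p u p'"
  using gluing.deg[OF assms(1)] class_of_eqI[OF gluing.quad_with_holes_G[OF assms(1)] assms(2)]
  by (auto simp: fills_def glue_def holes_def perimeter_def hole_deg_def)

text \<open>A map is determined by finite data, as both permutations are the identity outside the
  darts. Countability turns the stopping event into a countable union of events of the natural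
  filtration.\<close>

lemma countable_hmap: "countable (UNIV :: hmap set)"
proof -
  define gr :: "(nat \<Rightarrow> nat) \<Rightarrow> nat set \<Rightarrow> (nat \<times> nat) set" where "gr f A = (\<lambda>x. (x, f x)) ` A" for f A
  define code where "code m = (darts m, gr (opp m) (darts m), gr (nxt m) (darts m), rootd m, marks m)" for m :: "nat pmap"
  have gr: "f = g" if "gr f A = gr g A" "f permutes A" "g permutes A" for f g A
  proof
    fix x show "f x = g x"
    proof (cases "x \<in> A")
      case True
      then have "(x, f x) \<in> gr g A" using that(1) unfolding gr_def by blast
      then show ?thesis by (auto simp: gr_def)
    qed (use that(2,3) in \<open>simp add: permutes_not_in\<close>)
  qed
  have "inj (code \<circ> rep_hmap)"
  proof (rule injI)
    fix p p' assume "(code \<circ> rep_hmap) p = (code \<circ> rep_hmap) p'"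
    then have e: "code (rep_hmap p) = code (rep_hmap p')" by simp
    note c = quad_with_holesD(2)[OF quad_with_holes_rep]
    have d: "darts (rep_hmap p) = darts (rep_hmap p')" using e by (simp add: code_def)
    have "opp (rep_hmap p) = opp (rep_hmap p')"
      using e opp_permutes[OF c, of p] opp_permutes[OF c, of p']
      by (intro gr[of _ "darts (rep_hmap p)"]) (simp_all add: code_def d)
    moreover have "nxt (rep_hmap p) = nxt (rep_hmap p')"
      using e nxt_permutes[OF c, of p] nxt_permutes[OF c, of p']
      by (intro gr[of _ "darts (rep_hmap p)"]) (simp_all add: code_def d)
    ultimately have "rep_hmap p = rep_hmap p'" using e by (simp add: code_def)
    then show "p = p'" using Quotient3_abs_rep[OF Quotient3_hmap] by metis
  qed
  moreover have "range (code \<circ> rep_hmap) \<subseteq> Collect finite \<times> Collect finite \<times> Collect finite \<times> UNIV \<times> Collect finite"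
  proof -
    have "finite (darts (rep_hmap p))" "finite (marks (rep_hmap p))" for p
      using finite_darts[OF quad_with_holesD(2)[OF quad_with_holes_rep]]
        finite_subset[OF quad_with_holesD(3)[OF quad_with_holes_rep]] by auto
    then show ?thesis by (auto simp: code_def gr_def)
  qed
  moreover have "countable (Collect finite \<times> Collect finite \<times> Collect finite \<times> UNIV \<times> Collect finite
      :: (nat set \<times> (nat \<times> nat) set \<times> (nat \<times> nat) set \<times> nat \<times> nat set) set)"
    by (intro countable_SIGMA countable_Collect_finite countableI_type)
  ultimately show ?thesis by (meson countable_image_inj_on countable_subset)
qed

text \<open>Criterion for recognising a glued map. \<open>\<psi>\<close> is also given on the
  boundary darts of \<open>u h\<close>, which disappear; there it takes the value of the dart of
  \<open>p\<close> beyond the hole edge (\<open>bd\<close>). In this way a chain of jumps collapses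
  to a single crossing in \<open>m\<close>.\<close>

lemma (in gluing) glue_isoI:
  fixes m :: "'m pmap"
  assumes root: "\<phi> (rootd p) = rootd m"
    and nx: "\<And>d. d \<in> pd \<Longrightarrow> \<phi> (nxt p d) = nxt m (\<phi> d)"
    and op: "\<And>d. d \<in> pd \<Longrightarrow> opp p d \<in> pd \<Longrightarrow> \<phi> (opp p d) = opp m (\<phi> d)"
    and nx': "\<And>h y. h \<in> marks p \<Longrightarrow> y \<in> ud h \<Longrightarrow> \<psi> h (nxt (u h) y) = nxt m (\<psi> h y)"
    and op': "\<And>h y. h \<in> marks p \<Longrightarrow> y \<in> darts (u h) \<Longrightarrow> \<psi> h (opp (u h) y) = opp m (\<psi> h y)"
    and bd: "\<And>h i. h \<in> marks p \<Longrightarrow> \<psi> h (rd h i) = \<phi> (opp p (hd h i))"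
    and bij: "bij_betw (case_sum \<phi> (\<lambda>(h, y). \<psi> h y)) (glue_darts p u) (darts m)"
    and ma: "(\<Union>h\<in>marks p. \<psi> h ` marks (u h)) = marks m"
  shows "map_iso G m"
proof -
  let ?F = "case_sum \<phi> (\<lambda>(h, y). \<psi> h y)"
  have bd': "\<psi> h (to_root h x) = \<phi> (opp p x)" if "h \<in> marks p" "x \<in> face p h" for h x
    using hd_surj[OF that(2)] bd[OF that(1)] that(1) by auto
  have bd'': "\<phi> (opp p (to_hole h y)) = \<psi> h y" if "h \<in> marks p" "y \<in> root_face (u h)" for h y
    using bd'[OF that(1) to_hole_in[OF that]] to_root_to_hole[OF that] by simp
  have O: "?F (opp G x) = opp m (?F x)" if x: "x \<in> glue_darts p u" for x
  proof (cases x)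
    case (Inl d)
    then have d: "d \<in> pd" "d \<in> darts p" using x pd_darts by auto
    from d(1) show ?thesis
    proof (cases rule: pd_opp_cases)
      case 1 then show ?thesis using Inl d glue_opp_pd op by simp
    next
      case (2 h)
      let ?y = "to_root h (opp p d)"
      have y: "?y \<in> darts (u h)" using to_root_darts 2 by auto
      have e: "\<psi> h (opp (u h) ?y) = opp m (\<phi> d)"
        using op'[OF 2(1) y] bd'[OF 2] opp_opp[OF cp d(2)] by simp
      from 2(1) y show ?thesis
      proof (cases rule: ud_opp_cases)
        case 1 then show ?thesis using glue_opp_hole[OF 2 1] Inl d e by simp
      next
        case b: 2 then show ?thesis using glue_opp_hole_root[OF 2 b] Inl d e bd''[OF 2(1) b] by simp
      qed
    qed
  next
    case (Inr z)
    then obtain h y where x': "x = Inr (h, y)" by (cases z) auto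
    then have h: "h \<in> marks p" and y: "y \<in> ud h" "y \<in> darts (u h)" using x ud_darts by auto
    from h y(2) show ?thesis
    proof (cases rule: ud_opp_cases)
      case 1 then show ?thesis using x' y h glue_opp_ud[OF h] op' by simp
    next
      case b: 2 then show ?thesis using x' y h glue_opp_root[OF h b] op' bd''[OF h b] by simp
    qed
  qed
  have "?F (nxt G x) = nxt m (?F x)" if "x \<in> glue_darts p u" for x
    using that nx nx' by (auto simp: glue_darts_eq)
  with O bij root have "rooted_iso ?F G m" by (simp add: rooted_iso_def)
  moreover have "?F ` marks G = marks m" unfolding marks_G ma[symmetric] by (simp add: image_UN image_image)
  ultimately show ?thesis unfolding map_iso_def by blast
qed

section \<open>Cutting\<close>

definition strip :: "'d + 'd \<Rightarrow> 'd" where "strip = case_sum id id"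

lemma strip_simps [simp]: "strip (Inl d) = d" "strip (Inr d) = d"
  by (simp_all add: strip_def)

locale cutting =
  fixes m :: "'d pmap" and S C :: "'d set" and H :: "('d + 'd) set"
  assumes qm: "quad_with_holes m" and no_marks: "marks m = {}"
    and S_darts: "S \<subseteq> darts m" and S_nxt: "d \<in> S \<Longrightarrow> nxt m d \<in> S" and root_S: "rootd m \<in> S"
    and CS: "C \<subseteq> S" and C_opp: "d \<in> C \<Longrightarrow> opp m d \<in> C"
    and qD: "quad_with_holes (discovered m S C H)"
    and hole_D: "hole_darts (discovered m S C H) = Inr ` (S - C)"
begin

abbreviation "D \<equiv> discovered m S C H"

lemmas cm = quad_with_holesD(2)[OF qm]
lemmas cD = quad_with_holesD(2)[OF qD]

definition turn :: "'d \<Rightarrow> 'd" where "turn e = inv (nxt m) (opp m e)"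
definition border :: "'d \<Rightarrow> 'd" where
  "border d = (turn ^^ (LEAST k. (turn ^^ k) (inv (nxt m) d) \<notin> C)) (inv (nxt m) d)"

lemma darts_D: "darts D = Inl ` S \<union> Inr ` (S - C)"
  and rootd_D: "rootd D = Inl (rootd m)"
  and marks_D: "marks D = H"
  and opp_D_C: "d \<in> C \<Longrightarrow> opp D (Inl d) = Inl (opp m d)"
  and opp_D_Inl: "d \<in> S \<Longrightarrow> d \<notin> C \<Longrightarrow> opp D (Inl d) = Inr d"
  and opp_D_Inr: "d \<in> S \<Longrightarrow> d \<notin> C \<Longrightarrow> opp D (Inr d) = Inl d"
  and nxt_D_Inl: "d \<in> S \<Longrightarrow> nxt D (Inl d) = Inl (nxt m d)"
  and nxt_D_Inr: "d \<in> S \<Longrightarrow> d \<notin> C \<Longrightarrow> nxt D (Inr d) = Inr (border d)"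
  using CS by (auto simp: discovered_def Let_def border_def turn_def[abs_def])

lemma back_S: "d \<in> S \<Longrightarrow> inv (nxt m) d \<in> S"
proof -
  assume d: "d \<in> S"
  have "inv (nxt m) d \<in> orbit (nxt m) d"
    using face_self[OF cm, of "inv (nxt m) d"] face_back[OF cm, of d] by (simp add: face_def)
  then show ?thesis using orbit_subset_closed[of d S "nxt m"] d S_nxt by blast
qed

lemma S_closed: "nxt m d \<in> S \<longleftrightarrow> d \<in> S"
  using S_nxt back_S back_nxt[OF cm] by metis

lemma C_closed: "d \<in> darts m \<Longrightarrow> opp m d \<in> C \<longleftrightarrow> d \<in> C"
  using C_opp opp_opp[OF cm] by metis

lemma border_in: "d \<in> S - C \<Longrightarrow> border d \<in> S - C"
proof -
  assume d: "d \<in> S - C"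
  then have "nxt D (Inr d) \<in> darts D" using nxt_in[OF cD] darts_D by blast
  then show ?thesis using nxt_D_Inr d darts_D by auto
qed

text \<open>Bijectivity of \<open>border\<close> is not derived from the rotation: it is read off
  from the fact that the discovered map is a map, whose \<open>nxt\<close> permutes the hole
  darts.\<close>

lemma back_D_Inr: "d \<in> S - C \<Longrightarrow> \<exists>e\<in>S - C. inv (nxt D) (Inr d) = Inr e \<and> border e = d"
proof -
  assume d: "d \<in> S - C"
  then have "Inr d \<in> hole_darts D" by (simp add: hole_D)
  then have "inv (nxt D) (Inr d) \<in> hole_darts D" using hole_darts_closed(2)[OF cD] by blast
  then obtain e where e: "e \<in> S - C" "inv (nxt D) (Inr d) = Inr e" unfolding hole_D by blast
  have "nxt D (Inr e) = Inr d" using nxt_back[OF cD, of "Inr d"] e by simp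
  then show ?thesis using e nxt_D_Inr by auto
qed

text \<open>
  The fillings are the components of the map with darts \<open>UD\<close>, which consists of the faces outside \<open>S\<close>
  and of a copy \<open>Inr d\<close> of each \<open>d \<in> S - C\<close>.  This copy is to be identified with the hole dart \<open>Inr d\<close>
  of \<open>D\<close>.  It lies parallel to \<open>d\<close>, so that removing the tags commutes with the passage across edges.
\<close>

definition lift :: "'d \<Rightarrow> 'd + 'd" where "lift e = (if e \<in> S then Inr e else Inl e)"
definition UD :: "('d + 'd) set" where "UD = Inl ` (darts m - S) \<union> Inr ` (S - C)"
definition Uopp :: "'d + 'd \<Rightarrow> 'd + 'd" where "Uopp x = lift (opp m (strip x))"
text \<open>On the copies the successor is the inverse of that in \<open>D\<close>, because the
  boundary of a filling runs against the hole.\<close>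

definition Unxt :: "'d + 'd \<Rightarrow> 'd + 'd" where
  "Unxt x = (case x of Inl d \<Rightarrow> Inl (nxt m d) | Inr d \<Rightarrow> inv (nxt D) (Inr d))"
definition Umap :: "('d + 'd) set \<Rightarrow> ('d + 'd) \<Rightarrow> ('d + 'd) pmap" where
  "Umap K r = \<lparr>darts = K, opp = (\<lambda>x. if x \<in> K then Uopp x else x),
     nxt = (\<lambda>x. if x \<in> K then Unxt x else x), rootd = r, marks = {}\<rparr>"

lemma Umap_simps [simp]: "darts (Umap K r) = K" "rootd (Umap K r) = r" "marks (Umap K r) = {}"
  "x \<in> K \<Longrightarrow> opp (Umap K r) x = Uopp x" "x \<in> K \<Longrightarrow> nxt (Umap K r) x = Unxt x"
  by (simp_all add: Umap_def)

lemma finite_UD: "finite UD"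
  unfolding UD_def using finite_darts[OF cm] finite_subset[OF S_darts] by auto

lemma strip_lift [simp]: "strip (lift e) = e" by (simp add: lift_def)

lemma lift_strip: "x \<in> UD \<Longrightarrow> lift (strip x) = x"
  using CS by (auto simp: UD_def lift_def)

lemma strip_UD: "x \<in> UD \<Longrightarrow> strip x \<in> darts m - C"
  using CS S_darts by (auto simp: UD_def)

lemma lift_UD: "e \<in> darts m - C \<Longrightarrow> lift e \<in> UD"
  by (auto simp: UD_def lift_def)

lemma Uopp_step: "x \<in> UD \<Longrightarrow> Uopp x \<in> UD \<and> Uopp (Uopp x) = x \<and> Uopp x \<noteq> x"
proof -
  assume x: "x \<in> UD"
  have s: "strip x \<in> darts m" "strip x \<notin> C" using strip_UD[OF x] by auto
  have "opp m (strip x) \<in> darts m - C" using s C_closed opp_in[OF cm] by auto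
  then have "Uopp x \<in> UD" unfolding Uopp_def by (rule lift_UD)
  moreover have "Uopp (Uopp x) = x" using lift_strip[OF x] opp_opp[OF cm s(1)] by (simp add: Uopp_def)
  moreover have "Uopp x \<noteq> x" using opp_neq[OF cm s(1)] by (metis Uopp_def strip_lift)
  ultimately show ?thesis by blast
qed

lemma Unxt_Inr: "d \<in> S - C \<Longrightarrow> \<exists>e\<in>S - C. Unxt (Inr d) = Inr e \<and> border e = d"
  using back_D_Inr by (simp add: Unxt_def)

lemma Unxt_in: "x \<in> UD \<Longrightarrow> Unxt x \<in> UD"
proof (cases x)
  case (Inl d)
  assume "x \<in> UD"
  then show ?thesis using Inl S_closed nxt_in[OF cm] by (auto simp: UD_def Unxt_def)
next
  case (Inr d)
  assume "x \<in> UD"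
  then show ?thesis using Inr Unxt_Inr[of d] by (auto simp: UD_def)
qed

lemma inj_Unxt: "inj_on Unxt UD"
proof (rule inj_onI)
  fix x y assume xy: "x \<in> UD" "y \<in> UD" "Unxt x = Unxt y"
  have L: "\<exists>d'. Unxt x = Inl d'" if "x = Inl d" for x d using that by (simp add: Unxt_def)
  have R: "\<exists>d'. Unxt x = Inr d'" if "x = Inr d" "x \<in> UD" for x d
    using that Unxt_Inr[of d] by (auto simp: UD_def)
  show "x = y"
  proof (cases x; cases y)
    fix a b assume "x = Inl a" "y = Inl b"
    then show ?thesis using xy(3) back_nxt[OF cm] by (simp add: Unxt_def) metis
  next
    fix a b assume "x = Inr a" "y = Inr b"
    then have "inv (nxt D) (Inr a) = inv (nxt D) (Inr b)" using xy(3) by (simp add: Unxt_def)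
    then have "(Inr a :: 'd + 'd) = Inr b" using nxt_back[OF cD] by metis
    then show ?thesis using \<open>x = Inr a\<close> \<open>y = Inr b\<close> by simp
  qed (use L R xy in \<open>metis sum.distinct(1)\<close>)+
qed

definition closed :: "('d + 'd) set \<Rightarrow> bool" where
  "closed K \<longleftrightarrow> K \<subseteq> UD \<and> (\<forall>x\<in>K. Uopp x \<in> K \<and> Unxt x \<in> K)"

lemma closed_UD: "closed UD"
  using Uopp_step Unxt_in by (auto simp: closed_def)

lemma cmap_U:
  assumes K: "closed K" shows "cmap (Umap K r)"
proof -
  have sub: "K \<subseteq> UD" and fin: "finite K" using K finite_subset[OF _ finite_UD] by (auto simp: closed_def)
  have "opp (Umap K r) permutes K"
    by (rule involution_permutes) (use K Uopp_step in \<open>auto simp: Umap_def closed_def\<close>)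
  moreover have "nxt (Umap K r) permutes K"
  proof (rule bij_imp_permutes)
    have "inj_on (nxt (Umap K r)) K"
      using inj_on_subset[OF inj_Unxt sub] by (auto simp: inj_on_def)
    moreover have "nxt (Umap K r) ` K \<subseteq> K" using K by (auto simp: closed_def)
    ultimately show "bij_betw (nxt (Umap K r)) K K"
      using endo_inj_surj[OF fin, of "nxt (Umap K r)"] unfolding bij_betw_def by blast
  qed (simp add: Umap_def)
  ultimately show ?thesis using fin sub Uopp_step K by (auto simp: cmap_def closed_def subset_iff)
qed

section \<open>Components outside the kept faces\<close>

definition Urel :: "('d + 'd) rel" where
  "Urel = {(c, d). c \<in> UD \<and> d \<in> UD \<and> (d = Unxt c \<or> d = Uopp c)}"

definition comp :: "('d + 'd) \<Rightarrow> ('d + 'd) set" where "comp h = {x. (h, x) \<in> Urel\<^sup>*}"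

lemma comp_self: "h \<in> comp h" by (simp add: comp_def)

lemma comp_subset: "h \<in> UD \<Longrightarrow> comp h \<subseteq> UD"
proof
  fix x assume h: "h \<in> UD" and "x \<in> comp h"
  then have "(h, x) \<in> Urel\<^sup>*" by (simp add: comp_def)
  then show "x \<in> UD" by induct (use h in \<open>auto simp: Urel_def\<close>)
qed

lemma closed_comp: assumes h: "h \<in> UD" shows "closed (comp h)"
proof -
  have "Uopp x \<in> comp h \<and> Unxt x \<in> comp h" if x: "x \<in> comp h" for x
  proof -
    have xU: "x \<in> UD" using comp_subset[OF h] x by blast
    then have "(x, Uopp x) \<in> Urel" "(x, Unxt x) \<in> Urel" using Uopp_step Unxt_in by (auto simp: Urel_def)
    then show ?thesis using x unfolding comp_def by (auto intro: rtrancl_into_rtrancl)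
  qed
  then show ?thesis using comp_subset[OF h] by (auto simp: closed_def)
qed

lemma linked_comp: assumes h: "h \<in> UD" shows "linked (Umap (comp h) r) (comp h)"
proof (rule linkedI[OF cmap_U[OF closed_comp[OF h]]])
  note cl = closed_comp[OF h]
  show "comp h \<subseteq> darts (Umap (comp h) r)" by simp
  show "nxt (Umap (comp h) r) d \<in> comp h" if "d \<in> comp h" for d using that cl by (simp add: closed_def)
  fix P :: "'d + 'd \<Rightarrow> bool" and x y
  assume n: "\<And>c. c \<in> comp h \<Longrightarrow> P (nxt (Umap (comp h) r) c) = P c"
    and o: "\<And>c. c \<in> comp h \<Longrightarrow> opp (Umap (comp h) r) c \<in> comp h \<Longrightarrow> P (opp (Umap (comp h) r) c) = P c"
    and x: "x \<in> comp h" and y: "y \<in> comp h"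
  have "P z = P h" if "z \<in> comp h" for z
  proof -
    have "(h, z) \<in> Urel\<^sup>*" using that by (simp add: comp_def)
    then show ?thesis
    proof induct
      case (step a b)
      have a: "a \<in> comp h" using step(1) by (simp add: comp_def)
      have "b = Unxt a \<or> b = Uopp a" using step(2) by (auto simp: Urel_def)
      then show ?case using n[OF a] o[OF a] a cl step(3) by (auto simp: closed_def)
    qed simp
  qed
  then show "P x = P y" using x y by blast
qed

text \<open>\<open>Urel\<close> is directed; the path back comes from \<open>linked_comp\<close>,
  which rests on the cycles of \<open>Unxt\<close> being finite.\<close>

lemma comp_eq:
  assumes h: "h \<in> UD" and x: "x \<in> comp h" shows "comp x = comp h"
proof -
  have "(x, h) \<in> {(c, d). c \<in> comp h \<and> d \<in> comp h \<and> (d = nxt (Umap (comp h) h) c \<or> d = opp (Umap (comp h) h) c)}\<^sup>*"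
    using linked_comp[OF h, of h] x comp_self unfolding linked_def by blast
  moreover have "{(c, d). c \<in> comp h \<and> d \<in> comp h \<and> (d = nxt (Umap (comp h) h) c \<or> d = opp (Umap (comp h) h) c)} \<subseteq> Urel"
    using comp_subset[OF h] by (auto simp: Urel_def)
  ultimately have "(x, h) \<in> Urel\<^sup>*" using rtrancl_mono by blast
  then show ?thesis using x unfolding comp_def by (auto intro: rtrancl_trans)
qed

lemma H_hole: "H \<subseteq> Inr ` (S - C)"
  using face_self[OF cD] unfolding hole_D[symmetric] hole_darts_def marks_D by blast

lemma H_UD: "H \<subseteq> UD" using H_hole by (auto simp: UD_def)

lemma finite_H: "finite H" using finite_subset[OF H_UD finite_UD] .

lemma face_D_hole: "h \<in> H \<Longrightarrow> face D h \<subseteq> Inr ` (S - C)"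
  unfolding hole_D[symmetric] hole_darts_def marks_D by blast

lemma orbit_back_D: "orbit (inv (nxt D)) h = face D h"
  unfolding face_def by (rule orbit_inv[OF finite_darts[OF cD] nxt_permutes[OF cD]])

lemma face_D_comp:
  assumes h: "h \<in> H" shows "face D h \<subseteq> comp h"
proof
  fix x assume "x \<in> face D h"
  then have "x \<in> orbit (inv (nxt D)) h" by (simp add: orbit_back_D)
  then have "x \<in> comp h \<inter> Inr ` (S - C)"
  proof induct
    case base
    obtain d where d: "d \<in> S - C" "h = Inr d" using h H_hole by blast
    have "Unxt h \<in> comp h" using closed_comp[of h] h H_UD comp_self[of h] by (auto simp: closed_def)
    then show ?case using d back_D_Inr[of d] by (auto simp: Unxt_def)
  next
    case (step y)
    then obtain d where d: "d \<in> S - C" "y = Inr d" by blast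
    have "Unxt y \<in> comp h" using closed_comp[of h] h H_UD step by (auto simp: closed_def)
    then show ?case using d back_D_Inr[of d] by (auto simp: Unxt_def)
  qed
  then show "x \<in> comp h" by blast
qed

lemma hole_cover: "d \<in> S - C \<Longrightarrow> \<exists>h\<in>H. Inr d \<in> face D h"
proof -
  assume "d \<in> S - C"
  then have "Inr d \<in> hole_darts D" by (simp add: hole_D)
  then show ?thesis by (auto simp: hole_darts_def marks_D)
qed

lemma comp_closed_iff:
  assumes h: "h \<in> UD" and x: "x \<in> UD"
  shows "Uopp x \<in> comp h \<longleftrightarrow> x \<in> comp h" "Unxt x \<in> comp h \<longleftrightarrow> x \<in> comp h"
proof -
  have "Uopp x \<in> comp x" "Unxt x \<in> comp x" using closed_comp[OF x] comp_self[of x] by (auto simp: closed_def)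
  then have "comp (Uopp x) = comp x" "comp (Unxt x) = comp x" using comp_eq[OF x] by auto
  then show "Uopp x \<in> comp h \<longleftrightarrow> x \<in> comp h" "Unxt x \<in> comp h \<longleftrightarrow> x \<in> comp h"
    using comp_eq[OF h] comp_self by metis+
qed

text \<open>Connectivity of \<open>m\<close>: the predicate \<open>P\<close> holds at the root, and
  the region outside \<open>S\<close> is entered from \<open>S\<close> only across an edge of
  \<open>S - C\<close>, whose copy lies in the component of a hole.\<close>

lemma comp_cover: "x \<in> UD \<Longrightarrow> \<exists>h\<in>H. x \<in> comp h"
proof -
  have R: "\<exists>h\<in>H. Inr d \<in> comp h" if "d \<in> S - C" for d
    using hole_cover[OF that] face_D_comp by blast
  define P where "P e \<longleftrightarrow> e \<in> S \<or> (\<exists>h\<in>H. Inl e \<in> comp h)" for e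
  have ci: "Uopp x \<in> comp h \<longleftrightarrow> x \<in> comp h" "Unxt x \<in> comp h \<longleftrightarrow> x \<in> comp h" if "h \<in> H" "x \<in> UD" for h x
    using comp_closed_iff that H_UD by blast+
  have opp1: "P c" if c: "c \<in> darts m" "P (opp m c)" for c
  proof (cases "c \<in> S")
    case False
    then have cU: "Inl c \<in> UD" using c by (simp add: UD_def)
    show ?thesis
    proof (cases "opp m c \<in> S")
      case True
      have "c \<notin> C" using False CS by blast
      then have "opp m c \<in> S - C" using True C_closed[OF c(1)] by simp
      moreover have "Uopp (Inl c) = Inr (opp m c)" using True by (simp add: Uopp_def lift_def)
      ultimately show ?thesis using R[of "opp m c"] ci(1)[OF _ cU] unfolding P_def by auto
    next
      case n: False
      have "Uopp (Inl c) = Inl (opp m c)" using n by (simp add: Uopp_def lift_def)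
      then show ?thesis using n c(2) ci(1)[OF _ cU] unfolding P_def by auto
    qed
  qed (simp add: P_def)
  have "P e" if e: "e \<in> darts m" for e
  proof -
    have "P e = P (rootd m)"
    proof (rule linked_const[OF cm planar_mapD(2)[OF quad_with_holesD(1)[OF qm]] e])
      show "rootd m \<in> darts m" using root_S S_darts by blast
      fix c assume c: "c \<in> darts m"
      show "P (nxt m c) = P c"
      proof (cases "c \<in> S")
        case False
        then have "Inl c \<in> UD" using c by (simp add: UD_def)
        then show ?thesis using False ci(2)[of _ "Inl c"] S_closed by (auto simp: P_def Unxt_def)
      qed (simp add: P_def S_closed)
      show "P (opp m c) = P c" using opp1[of c] opp1[of "opp m c"] c opp_opp[OF cm] opp_in[OF cm] by auto
    qed
    then show ?thesis using root_S by (simp add: P_def)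
  qed
  then have L: "\<exists>h\<in>H. Inl e \<in> comp h" if "e \<in> darts m - S" for e using that by (auto simp: P_def)
  assume "x \<in> UD" then show ?thesis using L R by (auto simp: UD_def)
qed

lemma face_U_Inl:
  assumes K: "closed K" "Inl d \<in> K" shows "face (Umap K r) (Inl d) = Inl ` face m d"
proof -
  have "orbit (nxt (Umap K r)) (Inl d) = Inl ` orbit (nxt m) d"
  proof (rule orbit_image[of "{e. Inl e \<in> K}"])
    show "\<And>z. z \<in> {e. Inl e \<in> K} \<Longrightarrow> nxt m z \<in> {e. Inl e \<in> K}"
      using K(1) unfolding closed_def Unxt_def by force
  qed (use K in \<open>auto simp: Unxt_def\<close>)
  then show ?thesis by (simp add: face_def)
qed

lemma face_U_hole:
  assumes K: "closed K" and h: "h \<in> H" "h \<in> K" and x: "x \<in> face D h" "x \<in> K"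
  shows "face (Umap K r) x = face D h"
proof -
  have "orbit (nxt (Umap K r)) (id x) = id ` orbit (inv (nxt D)) x"
  proof (rule orbit_image[of "K \<inter> face D h"])
    fix z assume z: "z \<in> K \<inter> face D h"
    then obtain d where d: "d \<in> S - C" "z = Inr d" using face_D_hole[OF h(1)] by blast
    then have e: "Unxt z = inv (nxt D) z" by (simp add: Unxt_def)
    moreover have "inv (nxt D) z \<in> face D h" using z face_eq_iff[OF cD] face_back[OF cD] by (metis IntD2)
    moreover have "Unxt z \<in> K" using z K by (auto simp: closed_def)
    ultimately show "inv (nxt D) z \<in> K \<inter> face D h" by simp
    show "id (inv (nxt D) z) = nxt (Umap K r) (id z)" using z e by simp
  qed (use x in auto)
  then have "face (Umap K r) x = face D x" by (simp add: face_def[of "Umap K r"] orbit_back_D)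
  also have "\<dots> = face D h" using x face_eq_iff[OF cD] by blast
  finally show ?thesis .
qed

section \<open>Counting vertices, faces and edges of the complement\<close>

lemma vert_opp_turn: "y \<in> darts m \<Longrightarrow> turn y \<in> darts m \<and> vert m (opp m (turn y)) = vert m (opp m y)"
proof -
  assume y: "y \<in> darts m"
  then have t: "turn y \<in> darts m" by (simp add: turn_def back_in[OF cm] opp_in[OF cm])
  have "vert m (opp m (turn y)) = vert m (nxt m (turn y))" using vert_nxt[OF cm t] by simp
  then show ?thesis using t by (simp add: turn_def nxt_back[OF cm])
qed

lemma vert_border: "d \<in> darts m \<Longrightarrow> vert m (opp m (border d)) = vert m d"
proof -
  assume d: "d \<in> darts m"
  have b: "inv (nxt m) d \<in> darts m" using d by (simp add: back_in[OF cm])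
  have "(turn ^^ k) (inv (nxt m) d) \<in> darts m \<and> vert m (opp m ((turn ^^ k) (inv (nxt m) d))) = vert m (opp m (inv (nxt m) d))" for k
  proof (induct k)
    case (Suc k)
    have "(turn ^^ Suc k) (inv (nxt m) d) = turn ((turn ^^ k) (inv (nxt m) d))" by simp
    then show ?case using Suc vert_opp_turn[of "(turn ^^ k) (inv (nxt m) d)"] by metis
  qed (use b in simp)
  moreover have "vert m (opp m (inv (nxt m) d)) = vert m d" using vert_nxt[OF cm b] nxt_back[OF cm] by simp
  ultimately show ?thesis unfolding border_def by simp
qed

text \<open>Vertices of the complement can be labelled by vertices of \<open>m\<close>: at a copy
  the next dart is found through \<open>border\<close>, which turns about a single vertex of
  \<open>m\<close> (\<open>vert_border\<close>).\<close>

lemma strip_step: "x \<in> UD \<Longrightarrow> vert m (strip (Unxt (Uopp x))) = vert m (strip x)"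
proof -
  assume x: "x \<in> UD"
  define d where "d = strip x"
  define e where "e = opp m d"
  have d: "d \<in> darts m" "d \<notin> C" using strip_UD[OF x] by (auto simp: d_def)
  have o: "Uopp x = lift e" by (simp add: Uopp_def d_def e_def)
  have oe: "opp m e = d" using opp_opp[OF cm d(1)] by (simp add: e_def)
  show ?thesis
  proof (cases "e \<in> S")
    case False
    then have "Unxt (Uopp x) = Inl (nxt m e)" by (simp add: o lift_def Unxt_def)
    then show ?thesis using vert_nxt_opp[OF cm, of d] by (simp add: d_def[symmetric] e_def)
  next
    case True
    have "e \<notin> C" using d C_closed[OF d(1)] by (simp add: e_def)
    then obtain e' where e': "e' \<in> S - C" "Unxt (Inr e) = Inr e'" "border e' = e" using Unxt_Inr[of e] True by blast
    have "vert m (opp m e) = vert m e'" using vert_border[of e'] e' S_darts by blast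
    then show ?thesis using True e'(2) oe by (simp add: o lift_def d_def[symmetric])
  qed
qed

text \<open>There are no pinch points, so every dart in \<open>S - C\<close> accounts for a boundary vertex of its own.\<close>

lemma vert_D_Inr:
  assumes e: "e \<in> S - C" shows "vert D (Inr e) \<inter> range Inr = {Inr e}"
proof -
  obtain e'' where e'': "e'' \<in> S - C" "border e'' = e" using back_D_Inr[OF e] by blast
  define t where "t i = (turn ^^ i) (inv (nxt m) e'')" for i
  define k where "k = (LEAST i. t i \<notin> C)"
  have tk: "t k = e" using e''(2) by (simp add: border_def t_def k_def)
  have lt: "t i \<in> C" if "i < k" for i using not_less_Least[of i "\<lambda>i. t i \<notin> C"] that by (auto simp: k_def)
  define z where "z i = nxt m (t i)" for i
  have z0: "z 0 = e''" by (simp add: z_def t_def nxt_back[OF cm])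
  have zS: "z (Suc i) = opp m (t i)" for i by (simp add: z_def t_def turn_def nxt_back[OF cm])
  \<comment> \<open>One full turn about the vertex: from \<open>Inr e\<close> to \<open>z k\<close>,
    down to \<open>z 0 = e''\<close>, and along the hole back to \<open>Inr e\<close>, since
    \<open>e\<close> is the border successor of \<open>e''\<close>.\<close>
  define B where "B = insert (Inr e) ((\<lambda>i. Inl (z i)) ` {..k})"
  have "vert D (Inr e) \<subseteq> B"
  proof (rule orbit_subset_closed)
    fix x assume "x \<in> B"
    then consider "x = Inr e" | "x = Inl (z 0)" | i where "x = Inl (z (Suc i))" "Suc i \<le> k"
      unfolding B_def by (auto, metis not0_implies_Suc)
    then show "(nxt D \<circ> opp D) x \<in> B"
    proof cases
      case 1
      then have "(nxt D \<circ> opp D) x = Inl (z k)" using e by (simp add: opp_D_Inr nxt_D_Inl z_def tk)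
      then show ?thesis by (simp add: B_def)
    next
      case 2
      then have "(nxt D \<circ> opp D) x = Inr e" using e'' by (simp add: z0 opp_D_Inl nxt_D_Inr)
      then show ?thesis by (simp add: B_def)
    next
      case (3 i)
      have ti: "t i \<in> C" using lt 3 by simp
      have td: "t i \<in> darts m" using ti CS S_darts by blast
      have "opp D x = Inl (t i)" using 3 opp_D_C[OF C_opp[OF ti]] opp_opp[OF cm td] by (simp add: zS)
      then have "(nxt D \<circ> opp D) x = Inl (z i)" using ti CS by (simp add: nxt_D_Inl subset_iff z_def)
      then show ?thesis using 3 by (auto simp: B_def)
    qed
  qed (simp add: B_def)
  moreover have "B \<inter> range Inr = {Inr e}" by (auto simp: B_def)
  moreover have "Inr e \<in> vert D (Inr e)" by (rule orbit_self[OF finite_darts[OF cD] step_permutes[OF cD]])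
  ultimately show ?thesis by blast
qed

text \<open>A vertex of \<open>m\<close> whose darts all lie in \<open>C\<close> remains an inner
  vertex of \<open>D\<close>; all others are seen from the complement. Besides its inner vertices,
  \<open>D\<close> has a boundary vertex for each dart of \<open>S - C\<close>.\<close>

lemma card_verts: "card (verts m) + card (S - C) \<le> card (verts (Umap UD r)) + card (verts D)"
proof -
  define I where "I = {w \<in> verts D. w \<inter> range Inr = {}}"
  define W where "W = {w \<in> verts m. w \<subseteq> C}"
  have fin: "finite (verts D)" "finite (verts m)" "finite (S - C)"
    using finite_darts[OF cD] finite_darts[OF cm] finite_subset[OF S_darts] by (auto simp: verts_def)
  have inj: "inj_on (\<lambda>d. vert D (Inr d)) (S - C)"
  proof (rule inj_onI)
    fix a b assume "a \<in> S - C" "b \<in> S - C" "vert D (Inr a) = vert D (Inr b)"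
    then have "{Inr a :: 'd + 'd} = {Inr b}" using vert_D_Inr[of a] vert_D_Inr[of b] by metis
    then show "a = b" by simp
  qed
  have "(\<lambda>d. vert D (Inr d)) ` (S - C) \<inter> I = {}" using vert_D_Inr by (auto simp: I_def)
  then have "card ((\<lambda>d. vert D (Inr d)) ` (S - C) \<union> I) = card (S - C) + card I"
    using fin card_image[OF inj] by (subst card_Un_disjoint) (auto simp: I_def)
  moreover have "(\<lambda>d. vert D (Inr d)) ` (S - C) \<union> I \<subseteq> verts D" by (auto simp: I_def verts_def darts_D)
  ultimately have 1: "card (S - C) + card I \<le> card (verts D)" using card_mono[OF fin(1)] by metis
  have "(`) Inl ` W \<subseteq> I"
  proof
    fix w' :: "('d + 'd) set" assume "w' \<in> (`) Inl ` W"
    then obtain d where d: "d \<in> darts m" "vert m d \<subseteq> C" "w' = Inl ` vert m d" by (auto simp: W_def verts_def)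
    have dC: "d \<in> vert m d" by (rule orbit_self[OF finite_darts[OF cm] step_permutes[OF cm]])
    have "vert D (Inl d) = Inl ` vert m d"
    proof (rule orbit_image[of "vert m d"])
      fix z assume z: "z \<in> vert m d"
      show "(nxt m \<circ> opp m) z \<in> vert m d" using z by (rule orbit.step)
      have zC: "z \<in> C" using z d by blast
      then show "Inl ((nxt m \<circ> opp m) z) = (nxt D \<circ> opp D) (Inl z)"
        using C_opp[OF zC] CS by (simp add: opp_D_C nxt_D_Inl subset_iff)
    qed (rule dC)
    then have "w' = vert D (Inl d)" using d by simp
    moreover have "Inl d \<in> darts D" using dC d CS by (auto simp: darts_D)
    ultimately show "w' \<in> I" using d(3) by (auto simp: I_def verts_def)
  qed
  then have "card ((`) (Inl :: 'd \<Rightarrow> 'd + 'd) ` W) \<le> card I" using fin by (intro card_mono) (auto simp: I_def)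
  moreover have "card ((`) (Inl :: 'd \<Rightarrow> 'd + 'd) ` W) = card W"
    by (rule card_image) (auto simp: inj_on_def)
  ultimately have 2: "card W \<le> card I" by simp
  have "card ((\<lambda>x. vert m (strip x)) ` UD) \<le> card (orbit (nxt (Umap UD r) \<circ> opp (Umap UD r)) ` UD)"
  proof (rule card_image_le_orbits[OF finite_UD])
    show "nxt (Umap UD r) \<circ> opp (Umap UD r) permutes UD"
      using step_permutes[OF cmap_U[OF closed_UD]] by simp
  qed (use strip_step Uopp_step in auto)
  then have 3: "card ((\<lambda>x. vert m (strip x)) ` UD) \<le> card (verts (Umap UD r))" by (simp add: verts_def)
  have "verts m \<subseteq> (\<lambda>x. vert m (strip x)) ` UD \<union> W"
  proof
    fix w assume w: "w \<in> verts m"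
    show "w \<in> (\<lambda>x. vert m (strip x)) ` UD \<union> W"
    proof (cases "w \<subseteq> C")
      case False
      then obtain e where e: "e \<in> w" "e \<notin> C" by blast
      obtain d where d: "d \<in> darts m" "w = vert m d" using w by (auto simp: verts_def)
      have "e \<in> darts m" using permutes_orbit_subset[OF step_permutes[OF cm] d(1)] e d by blast
      moreover have "w = vert m e" using orbit_eq[OF finite_darts[OF cm] step_permutes[OF cm], of e d] e d by simp
      ultimately show ?thesis using lift_UD[of e] e by (intro UnI1 image_eqI[of _ _ "lift e"]) auto
    qed (use w in \<open>simp add: W_def\<close>)
  qed
  then have "card (verts m) \<le> card ((\<lambda>x. vert m (strip x)) ` UD \<union> W)"
    using fin finite_UD by (intro card_mono) (auto simp: W_def)
  also have "\<dots> \<le> card ((\<lambda>x. vert m (strip x)) ` UD) + card W" by (rule card_Un_le)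
  finally show ?thesis using 1 2 3 by linarith
qed

text \<open>Each hole appears twice, as a face of \<open>D\<close> and as a face of the complement,
  while a face of \<open>m\<close> goes to one of the two.\<close>

lemma card_faces: "card (faces m) + 2 * card H \<le> card (faces (Umap UD r)) + card (faces D)"
proof -
  have fin: "finite S" "finite (darts m)" using finite_darts[OF cm] finite_subset[OF S_darts] by auto
  have cU: "cmap (Umap UD r)" by (rule cmap_U[OF closed_UD])
  have holes: "card H \<le> card (face D ` Inr ` (S - C))"
  proof -
    have "card H = card (face D ` H)" using quad_with_holesD(4)[OF qD] by (simp add: marks_D card_image)
    also have "\<dots> \<le> card (face D ` Inr ` (S - C))" using H_hole fin by (intro card_mono) auto
    finally show ?thesis .
  qed
  \<comment> \<open>Applied with \<open>A = S\<close> to \<open>D\<close> and with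
    \<open>A = darts m - S\<close> to the complement; in both cases the tagged darts move within
    their holes.\<close>
  have gen: "card (face m ` A) + card H \<le> card (orbit f ` (Inl ` A \<union> Inr ` (S - C)))"
    if f: "f permutes (Inl ` A \<union> Inr ` (S - C))" and A: "A \<subseteq> darts m"
      and fl: "\<And>d. d \<in> A \<Longrightarrow> f (Inl d) = Inl (nxt m d)"
      and fr: "\<And>d. d \<in> S - C \<Longrightarrow> \<exists>e\<in>S - C. f (Inr d) = Inr e \<and> face D (Inr e) = face D (Inr d)"
    for A and f :: "'d + 'd \<Rightarrow> 'd + 'd"
  proof -
    define g where "g x = (case x of Inl d \<Rightarrow> Inl (face m d) | Inr d \<Rightarrow> Inr (face D (Inr d)))" for x :: "'d + 'd"
    have finA: "finite A" using A fin finite_subset by blast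
    have "g ` (Inl ` A \<union> Inr ` (S - C)) = Inl ` (face m ` A) \<union> Inr ` (face D ` Inr ` (S - C))"
      by (auto simp: g_def image_Un image_image)
    moreover have "card (Inl ` (face m ` A) \<union> Inr ` (face D ` Inr ` (S - C)) :: ('d set + ('d + 'd) set) set)
       = card (Inl ` (face m ` A) :: ('d set + ('d + 'd) set) set) + card (Inr ` (face D ` Inr ` (S - C)) :: ('d set + ('d + 'd) set) set)"
      using finA fin by (intro card_Un_disjoint) auto
    ultimately have "card (g ` (Inl ` A \<union> Inr ` (S - C))) = card (face m ` A) + card (face D ` Inr ` (S - C))"
      by (simp add: card_image)
    moreover have "card (g ` (Inl ` A \<union> Inr ` (S - C))) \<le> card (orbit f ` (Inl ` A \<union> Inr ` (S - C)))"
    proof (rule card_image_le_orbits[OF _ f])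
      show "finite (Inl ` A \<union> Inr ` (S - C))" using finA fin by auto
      fix x :: "'d + 'd" assume "x \<in> Inl ` A \<union> Inr ` (S - C)"
      then show "g (f x) = g x"
      proof
        assume "x \<in> Inl ` A" then show ?thesis using fl face_nxt[OF cm] by (auto simp: g_def)
      next
        assume "x \<in> Inr ` (S - C)" then show ?thesis using fr by (force simp: g_def)
      qed
    qed
    ultimately show ?thesis using holes by linarith
  qed
  have "card (face m ` S) + card H \<le> card (orbit (nxt D) ` (Inl ` S \<union> Inr ` (S - C)))"
  proof (rule gen)
    show "nxt D permutes Inl ` S \<union> Inr ` (S - C)" using nxt_permutes[OF cD] by (simp add: darts_D)
    fix d assume d: "d \<in> S - C"
    then show "\<exists>e\<in>S - C. nxt D (Inr d) = Inr e \<and> face D (Inr e) = face D (Inr d)"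
      using border_in[OF d] nxt_D_Inr face_nxt[OF cD, of "Inr d"] by (intro bexI[of _ "border d"]) auto
  qed (use S_darts nxt_D_Inl in auto)
  then have 1: "card (face m ` S) + card H \<le> card (faces D)" by (simp add: faces_def face_def[of D, abs_def] darts_D)
  have "card (face m ` (darts m - S)) + card H \<le> card (orbit (nxt (Umap UD r)) ` (Inl ` (darts m - S) \<union> Inr ` (S - C)))"
  proof (rule gen)
    show "nxt (Umap UD r) permutes Inl ` (darts m - S) \<union> Inr ` (S - C)"
      using nxt_permutes[OF cU] by (simp add: UD_def[symmetric])
    fix d assume d: "d \<in> S - C"
    then have "Inr d \<in> UD" by (simp add: UD_def)
    then show "\<exists>e\<in>S - C. nxt (Umap UD r) (Inr d) = Inr e \<and> face D (Inr e) = face D (Inr d)"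
      using back_D_Inr[OF d] face_back[OF cD, of "Inr d"] by (auto simp: Unxt_def)
  qed (auto simp: UD_def Unxt_def)
  then have 2: "card (face m ` (darts m - S)) + card H \<le> card (faces (Umap UD r))"
    by (simp add: faces_def face_def[of "Umap UD r", abs_def] UD_def[symmetric])
  have "faces m = face m ` S \<union> face m ` (darts m - S)" using S_darts by (auto simp: faces_def)
  then have "card (faces m) \<le> card (face m ` S) + card (face m ` (darts m - S))" by (simp add: card_Un_le)
  then show ?thesis using 1 2 by linarith
qed

lemma card_edges_cut: "card (edges m) + card (S - C) = card (edges (Umap UD r)) + card (edges D)"
proof -
  have fin: "finite S" "finite (darts m)" using finite_darts[OF cm] finite_subset[OF S_darts] by auto
  have "card UD = card (darts m - S) + card (S - C)"
    unfolding UD_def using fin by (subst card_Un_disjoint) (auto simp: card_image)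
  moreover have "card (darts D) = card S + card (S - C)"
    unfolding darts_D using fin by (subst card_Un_disjoint) (auto simp: card_image)
  moreover have "card (darts m - S) + card S = card (darts m)"
    using S_darts fin by (metis card_Diff_subset card_mono le_add_diff_inverse2)
  ultimately show ?thesis
    using card_edges[OF cm] card_edges[OF cD] card_edges[OF cmap_U[OF closed_UD], of r] by simp
qed

text \<open>On subtracting Euler's formula for \<open>D\<close> from that for \<open>m\<close>, the
  \<open>card (S - C)\<close> extra vertices and edges cancel, and the two extra faces for each hole
  remain.\<close>

lemma euler_UD: "card (edges (Umap UD r)) + 2 * card H \<le> card (verts (Umap UD r)) + card (faces (Umap UD r))"
  using card_verts[of r] card_faces[of r] card_edges_cut[of r]
    planar_mapD(5)[OF quad_with_holesD(1)[OF qm]] planar_mapD(5)[OF quad_with_holesD(1)[OF qD]] by linarith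

text \<open>A closed set contains the whole orbits of its darts, so the counts for the components
  add up to those for the complement.\<close>

lemma Umap_orbits:
  assumes K: "closed K" and x: "x \<in> K"
  shows "vert (Umap K r) x = vert (Umap UD r') x" "face (Umap K r) x = face (Umap UD r') x"
proof -
  have KU: "y \<in> UD" if "y \<in> K" for y using K that by (auto simp: closed_def)
  have "orbit (nxt (Umap UD r') \<circ> opp (Umap UD r')) (id x) = id ` orbit (nxt (Umap K r) \<circ> opp (Umap K r)) x"
    by (rule orbit_image[of K]) (use K x KU Uopp_step in \<open>auto simp: closed_def\<close>)
  then show "vert (Umap K r) x = vert (Umap UD r') x" by simp
  have "orbit (nxt (Umap UD r')) (id x) = id ` orbit (nxt (Umap K r)) x"
    by (rule orbit_image[of K]) (use K x KU in \<open>auto simp: closed_def\<close>)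
  then show "face (Umap K r) x = face (Umap UD r') x" by (simp add: face_def)
qed

text \<open>
  Euler's inequality for the components leaves no room: no component meets two holes, and
  every component has genus zero.
\<close>

lemma components:
  shows "inj_on comp H"
    and "h \<in> H \<Longrightarrow> card (verts (Umap (comp h) h)) + card (faces (Umap (comp h) h)) = card (edges (Umap (comp h) h)) + 2"
proof -
  define \<K> where "\<K> = comp ` H"
  \<comment> \<open>The counts depend on the darts alone; \<open>undefined\<close> stands for the
    root until it is replaced by \<open>h\<close> at the end.\<close>
  define V where "V K = card (verts (Umap K undefined))" for K
  define F where "F K = card (faces (Umap K undefined))" for K
  define E where "E K = card (edges (Umap K undefined))" for K
  have fin: "finite \<K>" using finite_H by (simp add: \<K>_def)
  have cl: "closed K" if "K \<in> \<K>" for K using that closed_comp H_UD by (auto simp: \<K>_def)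
  have le: "V K + F K \<le> E K + 2" if K: "K \<in> \<K>" for K
  proof -
    obtain h where h: "h \<in> H" "K = comp h" using K by (auto simp: \<K>_def)
    then show ?thesis
      using euler_le[OF cmap_U[OF cl[OF K]], of undefined] linked_comp[of h undefined] H_UD comp_self[of h]
      by (auto simp: V_def F_def E_def)
  qed
  have UN: "UD = \<Union>\<K>"
    using comp_cover cl by (auto simp: \<K>_def closed_def)
  have disj: "K \<inter> K' = {}" if KK: "K \<in> \<K>" "K' \<in> \<K>" "K \<noteq> K'" for K K'
  proof -
    obtain h h' where h: "h \<in> UD" "h' \<in> UD" "K = comp h" "K' = comp h'"
      using KK(1,2) H_UD unfolding \<K>_def by blast
    have "K = K'" if "x \<in> K" "x \<in> K'" for x
      using comp_eq[OF h(1), of x] comp_eq[OF h(2), of x] that h(3,4) by simp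
    then show ?thesis using \<open>K \<noteq> K'\<close> by blast
  qed
  have "verts (Umap UD undefined) = (\<Union>K\<in>\<K>. verts (Umap K undefined))"
  proof -
    have "verts (Umap K undefined) = vert (Umap UD undefined) ` K" if K: "K \<in> \<K>" for K
      unfolding verts_def Umap_simps by (rule image_cong[OF refl Umap_orbits(1)[OF cl[OF K]]])
    moreover have "vert (Umap UD undefined) ` UD = vert (Umap UD undefined) ` \<Union>\<K>"
      by (rule arg_cong[OF UN])
    ultimately show ?thesis by (simp add: verts_def[of "Umap UD undefined"] image_Union)
  qed
  then have v: "card (verts (Umap UD undefined)) \<le> sum V \<K>"
    unfolding V_def using card_UN_le[OF fin] by metis
  have "faces (Umap UD undefined) = (\<Union>K\<in>\<K>. faces (Umap K undefined))"
  proof -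
    have "faces (Umap K undefined) = face (Umap UD undefined) ` K" if K: "K \<in> \<K>" for K
      unfolding faces_def Umap_simps by (rule image_cong[OF refl Umap_orbits(2)[OF cl[OF K]]])
    moreover have "face (Umap UD undefined) ` UD = face (Umap UD undefined) ` \<Union>\<K>"
      by (rule arg_cong[OF UN])
    ultimately show ?thesis by (simp add: faces_def[of "Umap UD undefined"] image_Union)
  qed
  then have f: "card (faces (Umap UD undefined)) \<le> sum F \<K>"
    unfolding F_def using card_UN_le[OF fin] by metis
  have "card UD = sum card \<K>"
    unfolding UN by (rule card_Union_disjoint) (use disj cl finite_subset[OF _ finite_UD] in \<open>auto simp: disjoint_def closed_def\<close>)
  moreover have "2 * E K = card K" if "K \<in> \<K>" for K
    unfolding E_def using card_edges[OF cmap_U[OF cl[OF that]]] by simp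
  then have "sum card \<K> = 2 * sum E \<K>" by (simp add: sum_distrib_left)
  ultimately have e: "card (edges (Umap UD undefined)) = sum E \<K>"
    using card_edges[OF cmap_U[OF closed_UD], of undefined] by simp
  have s2: "(\<Sum>K\<in>\<K>. E K + 2) = sum E \<K> + 2 * card \<K>" by (simp only: sum.distrib) simp
  have s1: "sum E \<K> + 2 * card H \<le> (\<Sum>K\<in>\<K>. V K + F K)"
    using euler_UD[of undefined] v f e by (simp add: sum.distrib)
  also have "\<dots> \<le> (\<Sum>K\<in>\<K>. E K + 2)" by (rule sum_mono) (rule le)
  \<comment> \<open>Each component contributes at most 2 to a total of at least
    \<open>2 * card H\<close>, so there are as many components as holes.\<close>
  finally have "card H \<le> card \<K>" using s2 by linarith
  then have cH: "card \<K> = card H" using card_image_le[OF finite_H, of comp] by (simp add: \<K>_def)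
  then show "inj_on comp H" using eq_card_imp_inj_on[OF finite_H] by (simp add: \<K>_def)
  \<comment> \<open>Equal sums of termwise ordered numbers agree term by term, so every component
    attains Euler's bound.\<close>
  have "(\<Sum>K\<in>\<K>. V K + F K) = (\<Sum>K\<in>\<K>. E K + 2)"
    using s1 s2 cH sum_mono[of \<K> "\<lambda>K. V K + F K" "\<lambda>K. E K + 2"] le by (metis le_antisym)
  then have eq: "V K + F K = E K + 2" if "K \<in> \<K>" for K
    using sum_mono_inv[of "\<lambda>K. V K + F K" \<K> "\<lambda>K. E K + 2" K] le fin that by blast
  assume h: "h \<in> H"
  then have "V (comp h) + F (comp h) = E (comp h) + 2" using eq by (simp add: \<K>_def)
  moreover have "verts (Umap K r) = verts (Umap K r')" "faces (Umap K r) = faces (Umap K r')"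
    "edges (Umap K r) = edges (Umap K r')" for K r r'
    by (simp_all add: verts_def faces_def edges_def face_def Umap_def)
  ultimately show "card (verts (Umap (comp h) h)) + card (faces (Umap (comp h) h)) = card (edges (Umap (comp h) h)) + 2"
    unfolding V_def F_def E_def by metis
qed

text \<open>Distinct holes have distinct components, so the tagged darts of a component all lie on
  its one hole. The rest of the filling then consists of whole faces of \<open>m\<close> outside
  \<open>S\<close>.\<close>

lemma comp_Inr:
  assumes "h \<in> H" "Inr d \<in> comp h" shows "Inr d \<in> face D h"
proof -
  have "Inr d \<in> UD" using assms comp_subset H_UD by blast
  then have "d \<in> S - C" by (auto simp: UD_def)
  then obtain h' where h': "h' \<in> H" "Inr d \<in> face D h'" using hole_cover by blast
  then have "comp h' = comp h" using face_D_comp comp_eq assms H_UD by (metis subsetD)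
  then show ?thesis using components(1) assms(1) h' by (auto simp: inj_on_def)
qed

lemma root_face_U: "h \<in> H \<Longrightarrow> root_face (Umap (comp h) h) = face D h"
  using face_U_hole[of "comp h" h h h] closed_comp[of h] H_UD comp_self[of h] face_self[OF cD]
  by (auto simp: root_face_def)

lemma quad_U:
  assumes h: "h \<in> H" shows "quad_with_holes (Umap (comp h) h)"
proof -
  have hU: "h \<in> UD" using h H_UD by blast
  have pl: "planar_map (Umap (comp h) h)"
    by (rule planar_mapI[OF cmap_U[OF closed_comp[OF hU]]])
      (use linked_comp[OF hU] comp_self[of h] components(2)[OF h] in auto)
  have hd: "hole_darts (Umap (comp h) h) = {}" by (simp add: hole_darts_def)
  \<comment> \<open>Away from the hole a dart belongs to a face outside \<open>S\<close>; this face
    is not the root face of \<open>m\<close>, which lies in \<open>S\<close>, and is therefore a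
    square.\<close>
  have "card (face (Umap (comp h) h) x) = 4" if x: "x \<in> comp h" "x \<notin> face D h" for x
  proof -
    obtain d where d: "x = Inl d" using x comp_Inr[OF h] by (cases x) auto
    then have "Inl d \<in> UD" using x comp_subset[OF hU] by blast
    then have dm: "d \<in> darts m - S" by (auto simp: UD_def)
    have "d \<notin> root_face m"
      using dm orbit_subset_closed[of "rootd m" S "nxt m"] root_S S_nxt by (auto simp: root_face_def face_def)
    then have "card (face m d) = 4" using quad_with_holesD(6)[OF qm, of d] dm no_marks by (simp add: hole_darts_def)
    then show ?thesis using face_U_Inl[OF closed_comp[OF hU], of d h] d x by (simp add: card_image)
  qed
  then show ?thesis
    using pl hd planar_mapD(2)[OF pl] root_face_U[OF h] by (simp add: quad_with_holes_def)
qed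

text \<open>Regluing undoes the cut, with \<open>strip\<close> removing the tags on both sides. A
  boundary dart of the filling is a copy \<open>Inr e\<close>, and beyond the matching hole edge of
  \<open>D\<close> lies \<open>Inl e\<close>, so the labels agree as \<open>glue_isoI\<close>
  requires.\<close>

theorem glue_cut:
  assumes g: "rooted_iso g p D" "g ` marks p = H" "cmap p"
    and k: "\<And>h. h \<in> marks p \<Longrightarrow> quad_with_holes (u h)" "\<And>h. h \<in> marks p \<Longrightarrow> rooted_iso (k h) (u h) (Umap (comp (g h)) (g h))"
      "\<And>h. h \<in> marks p \<Longrightarrow> marks (u h) = {}" and qp: "quad_with_holes p"
  shows "gluing p u" "map_iso (glue_pmap p u) m"
proof -
  note gD = rooted_isoD[OF g(1)] and kD = rooted_isoD[OF k(2)]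
  have mp: "marks p \<subseteq> darts p" using quad_with_holesD(3)[OF qp] .
  have gH: "g h \<in> H" "g h \<in> UD" if "h \<in> marks p" for h using that g(2) H_UD by auto
  have cUK: "cmap (Umap (comp (g h)) (g h))" if "h \<in> marks p" for h
    using cmap_U closed_comp gH that by blast
  have cu: "cmap (u h)" if "h \<in> marks p" for h using k(1)[OF that] quad_with_holesD(2) by blast
  have ru: "rootd (u h) \<in> darts (u h)" if "h \<in> marks p" for h
    using k(1)[OF that] quad_with_holesD(1) planar_mapD(3) by blast
  have krf: "face D (g h) = k h ` root_face (u h)" if h: "h \<in> marks p" for h
    using iso_root_face[OF cu[OF h] cUK[OF h] k(2)[OF h] ru[OF h]] root_face_U[OF gH(1)[OF h]] by simp
  have card_rf: "card (root_face (u h)) = card (face D (g h))" if h: "h \<in> marks p" for h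
    unfolding krf[OF h] using face_subset[OF cu[OF h] ru[OF h]]
    by (intro card_image[symmetric] inj_on_subset[OF kD(5)[OF h]]) (simp add: root_face_def)
  have card_hf: "card (face D (g h)) = card (face p h)" if h: "h \<in> marks p" for h
    using iso_face[OF g(3) cD g(1)] h mp face_subset[OF g(3)]
    by (metis card_image inj_on_subset[OF gD(5)] subsetD)
  show gl: "gluing p u"
    by unfold_locales (use qp k(1) card_rf card_hf in auto)
  interpret gluing p u by (rule gl)
  have hole: "Inr ` (S - C) = g ` hole_darts p"
    using iso_hole_darts[OF g(3) cD g(1) mp] g(2) by (simp add: marks_D hole_D)
  have gpd: "g ` pd = Inl ` S"
  proof -
    have "g ` pd = g ` darts p - g ` hole_darts p"
      unfolding pd_def using hole_darts_subset gD(5) by (simp add: inj_on_image_set_diff[of g "darts p"])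
    also have "\<dots> = Inl ` S" unfolding gD(6) hole[symmetric] darts_D by auto
    finally show ?thesis .
  qed
  have gpdE: "\<exists>e\<in>S. g d = Inl e" if "d \<in> pd" for d using gpd that by blast
  have kud: "k h ` ud h = comp (g h) - face D (g h)" if h: "h \<in> marks p" for h
  proof -
    have "k h ` ud h = k h ` darts (u h) - k h ` root_face (u h)"
      unfolding ud_def using root_face_subset[OF h] kD(5)[OF h] by (simp add: inj_on_image_set_diff[of "k h" "darts (u h)"])
    then show ?thesis using kD(6)[OF h] krf[OF h] by simp
  qed
  have kudE: "\<exists>e\<in>darts m - S. k h y = Inl e \<and> Inl e \<in> comp (g h)" if h: "h \<in> marks p" and y: "y \<in> ud h" for h y
  proof -
    have y': "k h y \<in> comp (g h)" "k h y \<notin> face D (g h)" using kud[OF h] y by blast+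
    then obtain e where e: "k h y = Inl e" using comp_Inr[OF gH(1)[OF h]] by (cases "k h y") auto
    then have "Inl e \<in> UD" using y' comp_subset[OF gH(2)[OF h]] by auto
    then show ?thesis using e y' by (auto simp: UD_def)
  qed
  let ?\<phi> = "\<lambda>d. strip (g d)" and ?\<psi> = "\<lambda>h y. strip (k h y)"
  show "map_iso (glue_pmap p u) m"
  proof (rule glue_isoI[where \<phi> = ?\<phi> and \<psi> = ?\<psi>])
    show "?\<phi> (rootd p) = rootd m" by (simp add: gD(2) rootd_D)
    fix d assume d: "d \<in> pd"
    obtain e where e: "e \<in> S" "g d = Inl e" using gpdE[OF d] by blast
    show "?\<phi> (nxt p d) = nxt m (?\<phi> d)" using gD(4)[OF pd_darts[OF d]] e by (simp add: nxt_D_Inl)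
    assume d': "opp p d \<in> pd"
    obtain e' where e': "g (opp p d) = Inl e'" using gpdE[OF d'] by blast
    have "Inl e' = opp D (Inl e)" using gD(3)[OF pd_darts[OF d]] e e' by simp
    then have "e \<in> C" using opp_D_Inl[OF e(1)] by (metis sum.distinct(1))
    then show "?\<phi> (opp p d) = opp m (?\<phi> d)" using gD(3)[OF pd_darts[OF d]] e by (simp add: opp_D_C)
  next
    fix h y assume h: "h \<in> marks p" and y: "y \<in> ud h"
    obtain e where e: "k h y = Inl e" "Inl e \<in> comp (g h)" using kudE[OF h y] by blast
    show "?\<psi> h (nxt (u h) y) = nxt m (?\<psi> h y)"
      using kD(4)[OF h ud_darts[OF y]] e by (simp add: Unxt_def)
  next
    fix h y assume h: "h \<in> marks p" and y: "y \<in> darts (u h)"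
    have "k h y \<in> comp (g h)" using kD(6)[OF h] y by auto
    then show "?\<psi> h (opp (u h) y) = opp m (?\<psi> h y)" using kD(3)[OF h y] by (simp add: Uopp_def)
  next
    fix h i assume h: "h \<in> marks p"
    have 1: "k h (rd h i) = (nxt (Umap (comp (g h)) (g h)) ^^ i) (g h)"
      unfolding rd_def using iso_nxt_funpow[OF cu[OF h] cUK[OF h] k(2)[OF h] ru[OF h], of i] kD(2)[OF h] by simp
    have hd: "h \<in> darts p" using h mp by blast
    have 2: "g (opp p (hd h i)) = opp D ((inv (nxt D) ^^ i) (g h))"
      unfolding hd_def using iso_back_funpow[OF g(3) cD g(1) hd, of i] gD(3) by simp
    \<comment> \<open>The boundary walk of the filling is the backward walk along the hole, so the
      pairing by positions matches each copy with the hole dart of the same name.\<close>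
    have 3: "(nxt (Umap (comp (g h)) (g h)) ^^ i) (g h) = (inv (nxt D) ^^ i) (g h) \<and>
      (inv (nxt D) ^^ i) (g h) \<in> comp (g h) \<and> (\<exists>e\<in>S - C. (inv (nxt D) ^^ i) (g h) = Inr e)"
    proof (induct i)
      case 0 then show ?case using gH(1)[OF h] H_hole comp_self by auto
    next
      case (Suc i)
      then obtain e where e: "e \<in> S - C" "(inv (nxt D) ^^ i) (g h) = Inr e" "Inr e \<in> comp (g h)" by auto
      have "Unxt (Inr e) \<in> comp (g h)" using closed_comp[OF gH(2)[OF h]] e by (auto simp: closed_def)
      then show ?case using Suc e back_D_Inr[OF e(1)] by (auto simp: Unxt_def)
    qed
    then obtain e where e: "e \<in> S - C" "(inv (nxt D) ^^ i) (g h) = Inr e" by blast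
    show "?\<psi> h (rd h i) = ?\<phi> (opp p (hd h i))"
      using 1 2 3 e opp_D_Inr[of e] by simp
  next
    let ?F = "case_sum ?\<phi> (\<lambda>(h, y). ?\<psi> h y)"
    have "inj_on ?F (glue_darts p u)"
    proof (rule inj_onI)
      fix x y assume xy: "x \<in> glue_darts p u" "y \<in> glue_darts p u" "?F x = ?F y"
      have L: "?F z \<in> S" if "z = Inl d" "z \<in> glue_darts p u" for z d using that gpdE[of d] by auto
      have R: "?F z \<notin> S" if "z = Inr c" "z \<in> glue_darts p u" for z c
        using that kudE[of "fst c" "snd c"] by (cases c) auto
      show "x = y"
      proof (cases x; cases y)
        fix a b assume ab: "x = Inl a" "y = Inl b"
        then have abp: "a \<in> pd" "b \<in> pd" using xy by auto
        obtain ea eb where "g a = Inl ea" "g b = Inl eb" using gpdE abp by blast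
        then have "g a = g b" using xy(3) ab by simp
        then show ?thesis using ab abp pd_darts gD(5) by (auto simp: inj_on_def)
      next
        fix a b assume ab: "x = Inr a" "y = Inr b"
        obtain h c h' c' where c: "a = (h, c)" "b = (h', c')" by (cases a; cases b)
        have hc: "h \<in> marks p" "c \<in> ud h" "h' \<in> marks p" "c' \<in> ud h'" using xy ab c by auto
        obtain e e' where e: "k h c = Inl e" "Inl e \<in> comp (g h)" "k h' c' = Inl e'" "Inl e' \<in> comp (g h')"
          using kudE hc by metis
        have ee: "e = e'" using xy(3) ab c e by simp
        have "comp (g h) = comp (g h')" using comp_eq gH hc e ee by metis
        then have "g h = g h'" using components(1) gH(1) hc by (auto simp: inj_on_def)
        then have hh: "h = h'" using gD(5) hc mp by (meson inj_onD subsetD)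
        then have "c = c'" using e ee kD(5)[OF hc(1)] ud_darts hc by (metis inj_onD)
        then show ?thesis using ab c hh by simp
      qed (use L R xy in metis)+
    qed
    moreover have "?F ` glue_darts p u = darts m"
    proof -
      have "?F ` glue_darts p u = strip ` (g ` pd) \<union> (\<Union>h\<in>marks p. strip ` (k h ` ud h))"
        unfolding glue_darts_eq by (auto simp: image_Un image_image)
      also have "strip ` (g ` pd) = S" unfolding gpd by force
      also have "(\<Union>h\<in>marks p. strip ` (k h ` ud h)) = darts m - S"
      proof
        show "(\<Union>h\<in>marks p. strip ` (k h ` ud h)) \<subseteq> darts m - S" using kudE by force
        show "darts m - S \<subseteq> (\<Union>h\<in>marks p. strip ` (k h ` ud h))"
        proof
          fix d assume d: "d \<in> darts m - S"
          then have "Inl d \<in> UD" by (simp add: UD_def)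
          then obtain h' where h': "h' \<in> H" "Inl d \<in> comp h'" using comp_cover by blast
          then obtain h where h: "h \<in> marks p" "h' = g h" using g(2) by blast
          have "Inl d \<notin> face D h'" using face_D_hole[OF h'(1)] by auto
          then have "Inl d \<in> k h ` ud h" using kud[OF h(1)] h' h by auto
          then have "d \<in> strip ` (k h ` ud h)" by (intro image_eqI[of d strip "Inl d"]) simp_all
          then show "d \<in> (\<Union>h\<in>marks p. strip ` (k h ` ud h))" by (rule UN_I[OF h(1)])
        qed
      qed
      finally show ?thesis using S_darts by (simp add: Un_absorb1)
    qed
    ultimately show "bij_betw ?F (glue_darts p u) (darts m)" by (simp add: bij_betw_def)
  qed (use k(3) no_marks in auto)
qed

end

theorem cutting_submap:
  assumes "cutting (rep_hmap p') S C H"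
  shows "Some (class_of (discovered (rep_hmap p') S C H)) \<sqsubseteq> Some p'"
proof -
  interpret cutting "rep_hmap p'" S C H by (rule assms)
  define p where "p = class_of D"
  obtain g where g: "rooted_iso g (rep_hmap p) D" "g ` marks (rep_hmap p) = H"
    using rep_class_of[OF qD] unfolding map_iso_def p_def marks_D by blast
  define u where "u h = class_of (Umap (comp (g h)) (g h))" for h
  have q: "quad_with_holes (Umap (comp (g h)) (g h))" if "h \<in> marks (rep_hmap p)" for h
    using quad_U g(2) that by blast
  have "\<exists>k. rooted_iso k (rep_hmap (u h)) (Umap (comp (g h)) (g h)) \<and> marks (rep_hmap (u h)) = {}"
    if "h \<in> marks (rep_hmap p)" for h
    using rep_class_of[OF q[OF that]] unfolding map_iso_def u_def by auto
  then obtain k where k: "\<And>h. h \<in> marks (rep_hmap p) \<Longrightarrow>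
      rooted_iso (k h) (rep_hmap (u h)) (Umap (comp (g h)) (g h)) \<and> marks (rep_hmap (u h)) = {}"
    by metis
  have "gluing (rep_hmap p) (\<lambda>h. rep_hmap (u h))" "map_iso (glue_pmap (rep_hmap p) (\<lambda>h. rep_hmap (u h))) (rep_hmap p')"
    using glue_cut[OF g quad_with_holesD(2)[OF quad_with_holes_rep], of "\<lambda>h. rep_hmap (u h)" k]
      quad_with_holes_rep k by blast+
  then have "fills p u p'" by (rule fillsI)
  then show ?thesis unfolding p_def by auto
qed

section \<open>The right process\<close>

locale exploration =
  fixes m :: "'d pmap" and s :: 'd
  assumes qm: "quad_with_holes m" and no_marks: "marks m = {}"
    and card_root: "card (root_face m) = 2" and s_root: "s \<in> root_face m"
begin

lemmas cm = quad_with_holesD(2)[OF qm]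

lemma root_in: "rootd m \<in> darts m"
  using planar_mapD(3)[OF quad_with_holesD(1)[OF qm]] .

lemma root_face_eq: "d \<in> root_face m \<longleftrightarrow> face m d = root_face m"
  unfolding root_face_def using face_eq_iff[OF cm] by blast

lemma s_in: "s \<in> darts m"
  using s_root face_subset[OF cm root_in] by (auto simp: root_face_def)

lemma card_face: "d \<in> darts m \<Longrightarrow> d \<notin> root_face m \<Longrightarrow> card (face m d) = 4"
  using quad_with_holesD(6)[OF qm] no_marks by (simp add: hole_darts_def)

lemma ex_col: "\<exists>P :: 'd \<Rightarrow> bool. \<forall>d\<in>darts m. P (opp m d) \<noteq> P d \<and> P (nxt m d) \<noteq> P d"
proof (rule bipartite[OF cm])
  note P = planar_mapD[OF quad_with_holesD(1)[OF qm]]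
  show "linked m (darts m)" "darts m \<noteq> {}" "card (verts m) + card (faces m) = card (edges m) + 2"
    using P by blast+
  show "even (card (face m d))" if "d \<in> darts m" for d
    using card_face[OF that] card_root root_face_eq[of d] by (cases "d \<in> root_face m") auto
qed

text \<open>Since both \<open>opp\<close> and \<open>nxt\<close> change it, \<open>col\<close> is
  constant on vertices: it is the colour of the vertex from which a dart leaves.\<close>

definition col :: "'d \<Rightarrow> bool" where
  "col = (SOME P. \<forall>d\<in>darts m. P (opp m d) \<noteq> P d \<and> P (nxt m d) \<noteq> P d)"

lemma col: "d \<in> darts m \<Longrightarrow> col (opp m d) \<longleftrightarrow> \<not> col d" "d \<in> darts m \<Longrightarrow> col (nxt m d) \<longleftrightarrow> \<not> col d"
  using someI_ex[OF ex_col] unfolding col_def[symmetric] by blast+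

lemma col_back: "d \<in> darts m \<Longrightarrow> col (inv (nxt m) d) \<longleftrightarrow> \<not> col d"
  using col(2)[of "inv (nxt m) d"] by (simp add: nxt_back[OF cm] back_in[OF cm])

text \<open>\<open>turn\<close> permutes the darts that end at a given vertex. Hence
  \<open>rot\<close> runs through the darts ending where \<open>s\<close> ends, and \<open>N\<close>
  is the degree of this vertex.\<close>

definition turn :: "'d \<Rightarrow> 'd" where "turn = inv (nxt m) \<circ> opp m"
definition rot :: "nat \<Rightarrow> 'd" where "rot n = (turn ^^ n) s"
definition N :: nat where "N = card (orbit turn s)"

lemma turn_permutes: "turn permutes darts m"
  unfolding turn_def by (rule permutes_compose[OF opp_permutes[OF cm] permutes_inv[OF nxt_permutes[OF cm]]])

lemma rot_0 [simp]: "rot 0 = s" and rot_Suc: "rot (Suc n) = inv (nxt m) (opp m (rot n))"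
  by (simp_all add: rot_def turn_def)

lemma rot_in: "rot n \<in> darts m" and col_rot: "col (rot n) = col s"
proof -
  have "rot n \<in> darts m \<and> col (rot n) = col s"
    by (induct n) (use s_in in \<open>auto simp: rot_Suc back_in[OF cm] opp_in[OF cm] col col_back\<close>)
  then show "rot n \<in> darts m" "col (rot n) = col s" by auto
qed

lemma rot_eq: "rot i = rot j \<longleftrightarrow> i mod N = j mod N"
  unfolding rot_def N_def by (rule funpow_orbit_period[OF finite_darts[OF cm] turn_permutes])

lemma N_pos: "0 < N"
proof -
  have "s \<in> orbit turn s" by (rule orbit_self[OF finite_darts[OF cm] turn_permutes])
  then show ?thesis unfolding N_def using finite_orbit by (auto simp: card_gt_0_iff)
qed

lemma rot_N: "rot N = s"
  using rot_eq[of N 0] by simp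

lemma rot_inj: "i < N \<Longrightarrow> j < N \<Longrightarrow> rot i = rot j \<longleftrightarrow> i = j"
  by (simp add: rot_eq)

lemma N_eqI: "0 < n \<Longrightarrow> rot n = s \<Longrightarrow> (\<And>k. 0 < k \<Longrightarrow> k < n \<Longrightarrow> rot k \<noteq> s) \<Longrightarrow> N = n"
proof -
  assume n: "0 < n" "rot n = s" "\<And>k. 0 < k \<Longrightarrow> k < n \<Longrightarrow> rot k \<noteq> s"
  have "n mod N = 0" using n(2) rot_eq[of n 0] by simp
  then have "N \<le> n" using n(1) by (auto simp: mod_eq_0_iff_dvd dest: dvd_imp_le)
  then show "N = n" using n(3)[OF N_pos] rot_N by fastforce
qed

lemma root_face_s: "root_face m = {s, nxt m s}" "nxt m s \<noteq> s" "inv (nxt m) s = nxt m s"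
proof -
  have nr: "nxt m s \<in> root_face m" "nxt m (nxt m s) \<in> root_face m"
    using s_root root_face_eq face_nxt[OF cm] by auto
  show ns: "nxt m s \<noteq> s" using col(2)[OF s_in] by auto
  have fin: "finite (root_face m)" using card_root card.infinite by fastforce
  have "{s, nxt m s} \<subseteq> root_face m" "card {s, nxt m s} = card (root_face m)"
    using s_root nr ns card_root by auto
  then show eq: "root_face m = {s, nxt m s}" using card_subset_eq[OF fin] by metis
  have "nxt m (nxt m s) \<noteq> nxt m s" using col(2)[of "nxt m s"] s_in nxt_in[OF cm] by auto
  then have "nxt m (nxt m s) = s" using nr(2) eq by blast
  then show "inv (nxt m) s = nxt m s" using back_nxt[OF cm] by metis
qed

text \<open>The two darts of the root face have different colours and the rotation keeps that of
  \<open>s\<close>, so it meets the root face only in \<open>s\<close> itself.\<close>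

lemma face_rot_root: "face m (rot i) = root_face m \<longleftrightarrow> N dvd i"
proof -
  have "face m (rot i) = root_face m \<longleftrightarrow> rot i \<in> {s, nxt m s}"
    using root_face_eq[of "rot i"] root_face_s(1) by blast
  also have "\<dots> \<longleftrightarrow> rot i = s" using col_rot[of i] col(2)[OF s_in] by auto
  also have "\<dots> \<longleftrightarrow> N dvd i" using rot_eq[of i 0] by (auto simp: mod_eq_0_iff_dvd)
  finally show ?thesis .
qed

lemma face_rot_Suc: "face m (opp m (rot i)) = face m (rot (Suc i))"
  by (simp add: rot_Suc face_back[OF cm])

text \<open>The entry dart has just been used, and the dart before it has the colour of
  \<open>s\<close>. Opposites of earlier darts have the other colour, and earlier darts do not recur
  before time \<open>N\<close>; so this first candidate is still free.\<close>

lemma right_path: "n < N \<Longrightarrow> right_path m s n = map rot [0..<Suc n]"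
proof (induct n)
  case 0 then show ?case by simp
next
  case (Suc n)
  define V where "V = rot ` {..n} \<union> opp m ` rot ` {..n}"
  have IH: "right_path m s n = map rot [0..<Suc n]" using Suc by simp
  have V: "set (map rot [0..<Suc n]) \<union> opp m ` set (map rot [0..<Suc n]) = V"
    unfolding V_def set_map set_upt atLeast0LessThan lessThan_Suc_atMost ..
  have "opp m (rot n) \<in> V" by (auto simp: V_def)
  moreover have "rot (Suc n) \<notin> V"
  proof
    assume "rot (Suc n) \<in> V"
    then obtain j where j: "j \<le> n" "rot (Suc n) = rot j \<or> rot (Suc n) = opp m (rot j)" by (auto simp: V_def)
    have "rot (Suc n) \<noteq> rot j" using rot_inj[OF Suc(2), of j] j(1) Suc(2) by simp
    moreover have "rot (Suc n) \<noteq> opp m (rot j)"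
      using col_rot[of "Suc n"] col_rot[of j] col(1)[OF rot_in, of j] by metis
    ultimately show False using j by blast
  qed
  ultimately have "(LEAST k. (inv (nxt m) ^^ k) (opp m (rot n)) \<notin> V) = 1"
    by (intro Least_equality) (auto simp: rot_Suc Suc_le_eq intro!: gr0I)
  then have "rightmost m V (opp m (rot n)) = rot (Suc n)" by (simp add: rightmost_def rot_Suc)
  then show ?case unfolding right_path.simps Let_def IH V by simp
qed

lemma exit_dart: "n < N \<Longrightarrow> exit_dart m s n = rot n"
  by (simp add: exit_dart_def right_path)

lemma visited: "i \<le> N \<Longrightarrow> visited m s i = face m (rot i)"
proof (cases i)
  case 0 then show ?thesis using s_root root_face_eq by (simp add: visited_def)
next
  case (Suc n) assume "i \<le> N"
  then show ?thesis using Suc by (simp add: visited_def exit_dart face_rot_Suc)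
qed

lemma tau_E: "tau_E m s = N"
  unfolding tau_E_def
proof (rule Least_equality)
  show "1 \<le> N \<and> visited m s N = visited m s 0" using N_pos by (simp add: visited rot_N)
  fix i assume i: "1 \<le> i \<and> visited m s i = visited m s 0"
  show "N \<le> i"
  proof (rule ccontr)
    assume "\<not> N \<le> i"
    then have "face m (rot i) = root_face m" using i s_root root_face_eq by (simp add: visited)
    then show False using face_rot_root i \<open>\<not> N \<le> i\<close> by (auto dest: dvd_imp_le)
  qed
qed

section \<open>Self-intersections of the rotation\<close>

lemma opposite_corner:
  assumes d: "d \<in> darts m" "d \<notin> root_face m" and e: "e \<in> face m d" "col e = col d" "e \<noteq> d"
  shows "e = nxt m (nxt m d)"
proof -
  have c4: "card (orbit (nxt m) d) = 4" using card_face[OF d] by (simp add: face_def)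
  have "permutation (nxt m)" using finite_darts[OF cm] nxt_permutes[OF cm] permutation_permutes by blast
  from orbit_altdef_permutation[OF this, of d] e(1) obtain k where k: "e = (nxt m ^^ k) d"
    unfolding face_def by blast
  have "(nxt m ^^ k) d = (nxt m ^^ (k mod 4)) d"
    unfolding funpow_orbit_period[OF finite_darts[OF cm] nxt_permutes[OF cm]] c4 by simp
  then have k': "e = (nxt m ^^ (k mod 4)) d" using k by simp
  have in1: "nxt m d \<in> darts m" "nxt m (nxt m d) \<in> darts m" using d(1) nxt_in[OF cm] by auto
  have "k mod 4 < 4" by simp
  then consider "k mod 4 = 0" | "k mod 4 = 1" | "k mod 4 = 2" | "k mod 4 = 3" by linarith
  then show ?thesis
  proof cases
    case 1 then show ?thesis using k' e(3) by simp
  next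
    case 2 then show ?thesis using k' e(2) col(2)[OF d(1)] by simp
  next
    case 3 then show ?thesis using k' by (simp add: numeral_2_eq_2)
  next
    case 4 then show ?thesis using k' e(2) col(2)[OF d(1)] col(2)[OF in1(1)] col(2)[OF in1(2)]
      by (simp add: numeral_3_eq_3)
  qed
qed

lemma rot_root: "0 < i \<Longrightarrow> i < N \<Longrightarrow> rot i \<notin> root_face m"
  using face_rot_root[of i] root_face_eq by (auto dest: dvd_imp_le)

text \<open>A square has only one other dart of this colour, so it is visited at most twice: the
  first and the last visit of an intersection point are its only ones.\<close>

lemma same_face_rot:
  assumes i: "0 < i" "i < N" and j: "j \<le> N" "j \<noteq> i" and f: "face m (rot i) = face m (rot j)"
  shows "0 < j" "j < N" "rot j = nxt m (nxt m (rot i))"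
proof -
  have "face m (rot i) \<noteq> root_face m" using rot_root[OF i] root_face_eq by blast
  then have nd: "\<not> N dvd j" using f face_rot_root[of j] by simp
  show j': "0 < j" "j < N"
  proof -
    show "0 < j" using nd by (cases j) auto
    have "j \<noteq> N" using nd by auto
    then show "j < N" using j(1) by simp
  qed
  show "rot j = nxt m (nxt m (rot i))"
  proof (rule opposite_corner[OF rot_in rot_root[OF i]])
    show "rot j \<in> face m (rot i)" using f face_self[OF cm, of "rot j"] by simp
    show "col (rot j) = col (rot i)" by (simp add: col_rot)
    show "rot j \<noteq> rot i" using rot_inj[OF i(2) j'(2)] j(2) by simp
  qed
qed

lemma intersection_times: "intersection_times m s =
    {i. 0 < i \<and> i < N \<and> (\<exists>j. 0 < j \<and> j < N \<and> j \<noteq> i \<and> face m (rot i) = face m (rot j))}"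
proof (intro equalityI subsetI)
  fix i assume "i \<in> intersection_times m s"
  then obtain j where "i \<in> {1..N}" "j \<in> {1..N}" and ne: "j \<noteq> i" and v: "visited m s i = visited m s j"
    unfolding intersection_times_def tau_E by blast
  then have ij: "0 < i" "i \<le> N" "0 < j" "j \<le> N" "j \<noteq> i" "face m (rot i) = face m (rot j)"
    using visited[of i] visited[of j] by auto
  have "i < N"
  proof (rule ccontr)
    assume "\<not> i < N"
    then have "i = N" using ij by simp
    then have "face m (rot j) = root_face m" using ij face_rot_root[of N] by simp
    then show False using face_rot_root[of j] ij \<open>i = N\<close> by (auto dest: dvd_imp_le)
  qed
  then show "i \<in> {i. 0 < i \<and> i < N \<and> (\<exists>j. 0 < j \<and> j < N \<and> j \<noteq> i \<and> face m (rot i) = face m (rot j))}"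
    using same_face_rot[of i j] ij by auto
qed (auto simp: intersection_times_def tau_E visited Suc_le_eq)

definition SS :: "'d set" where "SS = (\<Union>i\<in>kept_faces m s. visited m s i)"
definition CC :: "'d set" where "CC = (\<Union>i\<in>kept_steps m s. {exit_dart m s i, opp m (exit_dart m s i)})"

text \<open>The two visits \<open>a\<close> and \<open>b\<close> of the first self-intersection point.\<close>

definition first_loop :: "nat \<Rightarrow> nat \<Rightarrow> bool" where
  "first_loop a b \<longleftrightarrow> 0 < a \<and> a < b \<and> b < N \<and> rot b = nxt m (nxt m (rot a)) \<and>
     (\<forall>i j. 0 < i \<longrightarrow> i < a \<longrightarrow> 0 < j \<longrightarrow> j \<le> N \<longrightarrow> j \<noteq> i \<longrightarrow> face m (rot i) \<noteq> face m (rot j))"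

definition loop_visits :: "nat \<Rightarrow> nat \<Rightarrow> bool" where
  "loop_visits a b \<longleftrightarrow> first_loop a b \<and> kept_faces m s = {0..a} \<union> {b..N} \<and>
     kept_steps m s = {0..<a} \<union> {b..<N}"

text \<open>Two visits constructed in another map can thereby be recognised as the times
  \<open>tau_I\<close> and \<open>tau_R\<close> of its process, since \<open>loop_cases\<close>
  produces those times as a \<open>first_loop\<close>.\<close>

lemma first_loop_unique:
  assumes "first_loop a b" "first_loop a' b'" shows "a = a'" "b = b'"
proof -
  have fb: "face m (rot a) = face m (rot b)" if "first_loop a b" for a b
    using that face_nxt[OF cm] by (simp add: first_loop_def)
  have "\<not> a < a'" if "first_loop a b" "first_loop a' b'" for a b a' b'
  proof
    assume "a < a'"
    moreover have "0 < a" "0 < b" "b \<le> N" "b \<noteq> a" "face m (rot a) = face m (rot b)"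
      using that(1) fb[OF that(1)] by (auto simp: first_loop_def)
    ultimately show False using that(2) unfolding first_loop_def by blast
  qed
  then show "a = a'" using assms by (metis linorder_neqE_nat)
  then have "rot b = rot b'" "b < N" "b' < N" using assms by (simp_all add: first_loop_def)
  then show "b = b'" using rot_inj by blast
qed

lemma loop_cases:
  obtains (none) "intersection_times m s = {}"
      "kept_faces m s = {0..N}" "kept_steps m s = {0..<N}"
      "\<And>i j. i \<le> N \<Longrightarrow> j \<le> N \<Longrightarrow> 0 < i \<Longrightarrow> 0 < j \<Longrightarrow> face m (rot i) = face m (rot j) \<Longrightarrow> i = j"
    | (loop) a b where "loop_visits a b" "first_loop a b"
      "kept_faces m s = {0..a} \<union> {b..N}" "kept_steps m s = {0..<a} \<union> {b..<N}"
proof (cases "intersection_times m s = {}")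
  case True
  have "i = j" if "i \<le> N" "j \<le> N" "0 < i" "0 < j" "face m (rot i) = face m (rot j)" for i j
    using True that unfolding intersection_times_def by (fastforce simp: tau_E visited)
  then show ?thesis using True by (intro none) (simp_all add: kept_faces_def kept_steps_def tau_E)
next
  case False
  define a where "a = tau_I m s"
  have aI: "a \<in> intersection_times m s" unfolding a_def tau_I_def by (rule Inf_nat_def1[OF False])
  have min: "a \<le> i" if "i \<in> intersection_times m s" for i
    unfolding a_def tau_I_def using that by (rule wellorder_Inf_le1)
  obtain b where a: "0 < a" "a < N" and b: "0 < b" "b < N" "b \<noteq> a" "face m (rot a) = face m (rot b)"
    using aI unfolding intersection_times by blast
  have "b \<in> intersection_times m s" unfolding intersection_times using a b by (auto intro!: exI[of _ a])
  then have ab: "a < b" using min b(3) by fastforce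
  have rb: "rot b = nxt m (nxt m (rot a))" using same_face_rot(3)[of a b] a b by simp
  have fl: "first_loop a b"
    unfolding first_loop_def
  proof (intro conjI allI impI notI)
    fix i j assume "0 < i" "i < a" "0 < j" "j \<le> N" "j \<noteq> i" "face m (rot i) = face m (rot j)"
    then have "i \<in> intersection_times m s" using a(2) by (auto simp: intersection_times_def tau_E visited)
    then show False using min \<open>i < a\<close> by fastforce
  qed (use a ab b rb in auto)
  \<comment> \<open>The maximum defining \<open>tau_R\<close> is thus taken over two visits
    only.\<close>
  have "{i \<in> {0..tau_E m s}. visited m s i = visited m s (tau_I m s)} = {a, b}"
  proof (intro equalityI subsetI)
    fix i assume "i \<in> {i \<in> {0..tau_E m s}. visited m s i = visited m s (tau_I m s)}"
    then have "i \<le> N" "visited m s i = visited m s a" by (simp_all add: tau_E a_def[symmetric])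
    then have i: "i \<le> N" "face m (rot a) = face m (rot i)" using a visited[of i] visited[of a] by simp_all
    show "i \<in> {a, b}"
    proof (cases "i = a")
      case False
      then have "rot i = rot b" "i < N" using same_face_rot[OF a i(1) False i(2)] rb by auto
      then show ?thesis using rot_inj b by simp
    qed simp
  next
    fix i assume i: "i \<in> {a, b}"
    have "visited m s b = visited m s a" using a b visited[of a] visited[of b] by simp
    then show "i \<in> {i \<in> {0..tau_E m s}. visited m s i = visited m s (tau_I m s)}"
      unfolding a_def[symmetric] tau_E using i a b by auto
  qed
  then have "tau_R m s = b" unfolding tau_R_def using ab by simp
  then show ?thesis using False fl
    by (intro loop[of a b]) (simp_all add: loop_visits_def kept_faces_def kept_steps_def tau_E a_def[symmetric])
qed

lemma kept_le: "i \<in> kept_faces m s \<Longrightarrow> i \<le> N" "i \<in> kept_steps m s \<Longrightarrow> i < N"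
  and kept_0: "0 \<in> kept_faces m s"
  and kept_steps_faces: "i \<in> kept_steps m s \<Longrightarrow> i \<in> kept_faces m s \<and> Suc i \<in> kept_faces m s"
proof -
  consider "kept_faces m s = {0..N}" "kept_steps m s = {0..<N}"
    | a b where "kept_faces m s = {0..a} \<union> {b..N}" "kept_steps m s = {0..<a} \<union> {b..<N}" "a < b" "b < N"
    using loop_cases unfolding first_loop_def by metis
  then show "i \<in> kept_faces m s \<Longrightarrow> i \<le> N" "i \<in> kept_steps m s \<Longrightarrow> i < N" "0 \<in> kept_faces m s"
    "i \<in> kept_steps m s \<Longrightarrow> i \<in> kept_faces m s \<and> Suc i \<in> kept_faces m s"
    by (cases; auto)+
qed

lemma SS_eq: "SS = (\<Union>i\<in>kept_faces m s. face m (rot i))"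
  unfolding SS_def using kept_le(1) visited by (intro SUP_cong refl) auto

lemma CC_eq: "CC = (\<Union>i\<in>kept_steps m s. {rot i, opp m (rot i)})"
  unfolding CC_def using kept_le(2) exit_dart by (intro SUP_cong refl) auto

lemma rot_CC: "i \<in> kept_steps m s \<Longrightarrow> rot i \<in> CC"
  by (auto simp: CC_eq)

lemma face_SS: "i \<in> kept_faces m s \<Longrightarrow> face m (rot i) \<subseteq> SS"
  by (auto simp: SS_eq)

lemma rot_SS: "i \<in> kept_faces m s \<Longrightarrow> rot i \<in> SS"
  using face_SS face_self[OF cm] by blast

lemma SS_sub: "SS \<subseteq> darts m"
  unfolding SS_eq using face_subset[OF cm rot_in] by blast

lemma SS_nxt: "nxt m d \<in> SS \<longleftrightarrow> d \<in> SS"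
proof -
  have "nxt m d \<in> face m e \<longleftrightarrow> d \<in> face m e" for e
    using face_eq_iff[OF cm] face_nxt[OF cm] by metis
  then show ?thesis unfolding SS_eq by blast
qed

lemma SS_back: "inv (nxt m) d \<in> SS \<longleftrightarrow> d \<in> SS"
  using SS_nxt[of "inv (nxt m) d"] nxt_back[OF cm] by simp

lemma root_SS: "root_face m \<subseteq> SS"
  using face_SS[OF kept_0] s_root root_face_eq by simp

lemma CC_opp: "d \<in> CC \<Longrightarrow> opp m d \<in> CC"
  unfolding CC_eq using opp_opp[OF cm rot_in] by auto

lemma CC_SS: "CC \<subseteq> SS"
proof
  fix d assume "d \<in> CC"
  then obtain i where i: "i \<in> kept_steps m s" "d = rot i \<or> d = opp m (rot i)" by (auto simp: CC_eq)
  have "opp m (rot i) \<in> face m (rot (Suc i))"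
    using face_rot_Suc[of i] face_eq_iff[OF cm] by blast
  then show "d \<in> SS" using i kept_steps_faces[OF i(1)] rot_SS face_SS by blast
qed

lemma cuttingI:
  assumes "quad_with_holes (discovered m SS CC H)" "hole_darts (discovered m SS CC H) = Inr ` (SS - CC)"
  shows "cutting m SS CC H"
  using qm no_marks SS_sub SS_nxt root_SS CC_SS CC_opp assms face_self[OF cm, of "rootd m"]
  by unfold_locales (auto simp: root_face_def)

text \<open>In the order of \<open>nxt\<close> the sides of the square are: exit at time
  \<open>a\<close>, entry at \<open>a\<close>, exit at \<open>b\<close>, entry at \<open>b\<close>.
  The first and the last belong to the suppressed loop; they are adjacent and become the sides along
  the hole.\<close>

lemma loop_edges:
  assumes lv: "loop_visits a b"
  defines "e1 \<equiv> rot a" and "e2 \<equiv> inv (nxt m) (rot a)"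
  shows "e1 \<in> SS - CC" "e2 \<in> SS - CC" "inv (nxt m) e2 = rot b"
proof -
  have fl: "first_loop a b" and ks: "kept_steps m s = {0..<a} \<union> {b..<N}" and kf: "kept_faces m s = {0..a} \<union> {b..N}"
    using lv by (simp_all add: loop_visits_def)
  have ab: "0 < a" "a < b" "b < N" "rot b = nxt m (nxt m (rot a))" using fl by (auto simp: first_loop_def)
  have fb: "face m (rot b) = face m (rot a)" using ab(4) face_nxt[OF cm] by simp
  have e1d: "e1 \<in> darts m" unfolding e1_def by (rule rot_in)
  have nr: "rot a \<notin> root_face m" using rot_root ab by simp
  have c4: "card (orbit (nxt m) (rot a)) = 4" using card_face[OF rot_in nr] by (simp add: face_def)
  have "(nxt m ^^ 4) (rot a) = (nxt m ^^ 0) (rot a)"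
    unfolding funpow_orbit_period[OF finite_darts[OF cm] nxt_permutes[OF cm]] c4 by simp
  then have n4: "nxt m (nxt m (nxt m (nxt m (rot a)))) = rot a" by (simp add: eval_nat_numeral)
  then have "nxt m (rot b) = inv (nxt m) (rot a)" using ab(4) back_nxt[OF cm] by metis
  then show e2b: "inv (nxt m) e2 = rot b" unfolding e2_def using back_nxt[OF cm] by metis
  have "rot a \<in> SS" using rot_SS kf by simp
  then have S: "e1 \<in> SS" "e2 \<in> SS" unfolding e1_def e2_def by (simp_all add: SS_back)
  have ne: "rot i \<noteq> opp m (rot j)" for i j
    using col_rot[of i] col_rot[of j] col(1)[OF rot_in, of j] by metis
  have "e1 \<notin> CC"
  proof
    assume "e1 \<in> CC"
    then obtain i where i: "i \<in> kept_steps m s" "rot a = rot i" unfolding CC_eq e1_def using ne by blast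
    then have "a = i" using rot_inj[of a i] ab kept_le(2)[OF i(1)] by simp
    then show False using i ks ab by auto
  qed
  moreover have "e2 \<notin> CC"
  proof
    assume "e2 \<in> CC"
    moreover have "e2 \<noteq> rot i" for i unfolding e2_def using col_back[OF rot_in, of a] col_rot[of i] col_rot[of a] by metis
    ultimately obtain i where i: "i \<in> kept_steps m s" "e2 = opp m (rot i)" unfolding CC_eq by blast
    then have "rot (Suc i) = rot b" using e2b by (simp add: rot_Suc)
    then have "Suc i mod N = b mod N" by (simp add: rot_eq)
    moreover have "Suc i \<le> N" using kept_le(2)[OF i(1)] by simp
    \<comment> \<open>The residue modulo \<open>N\<close> determines the time except for
      \<open>Suc i = N\<close>, where it is 0 and differs from \<open>b\<close>.\<close>
    ultimately have "Suc i = b" using ab by (cases "Suc i = N") auto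
    then show False using i ks ab by auto
  qed
  ultimately show "e1 \<in> SS - CC" "e2 \<in> SS - CC" using S by auto
qed

end

text \<open>From \<open>e1\<close> the border goes directly to the adjacent \<open>e2\<close>. From
  \<open>e2\<close> it rotates across all kept steps, those from \<open>b\<close> up to
  \<open>N\<close> and then, past \<open>s\<close>, those from 0 up to \<open>a\<close>, and stops
  at \<open>e1\<close>; these are \<open>N - b + a\<close> turns.\<close>

lemma (in exploration) loop_hole:
  assumes lv: "loop_visits a b" and cut: "cutting m SS CC H"
  shows "face (discovered m SS CC H) (Inr (rot a)) = {Inr (rot a), Inr (inv (nxt m) (rot a))}"
proof -
  interpret c: cutting m SS CC H by (rule cut)
  define e1 where "e1 = rot a"
  define e2 where "e2 = inv (nxt m) (rot a)"
  note E = loop_edges[OF lv, folded e1_def e2_def]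
  have ab: "0 < a" "a < b" "b < N" and ks: "kept_steps m s = {0..<a} \<union> {b..<N}"
    using lv by (auto simp: loop_visits_def first_loop_def)
  have B1: "c.border e1 = e2"
  proof -
    have "inv (nxt m) e1 = e2" by (simp add: e1_def e2_def)
    then show ?thesis using E(2) unfolding c.border_def by (subst Least_eq_0) auto
  qed
  have B2: "c.border e2 = e1"
  proof -
    have t: "(c.turn ^^ k) (inv (nxt m) e2) = rot (b + k)" for k
      by (induct k) (simp_all add: E(3) c.turn_def rot_Suc)
    have "rot (b + k) \<in> CC" if "k < N - b + a" for k
    proof (cases "b + k < N")
      case True then show ?thesis using rot_CC ks by simp
    next
      case False
      define i where "i = b + k - N"
      have i: "b + k = i + N" "i < a" using False that ab by (auto simp: i_def)
      have "rot (b + k) = rot i" by (simp add: rot_eq i(1))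
      then show ?thesis using rot_CC[of i] i ks by simp
    qed
    moreover have "rot (b + (N - b + a)) = e1" using ab by (simp add: e1_def rot_eq)
    ultimately have "(LEAST k. rot (b + k) \<notin> CC) = N - b + a"
      using E(1) by (intro Least_equality) (auto simp: not_less[symmetric])
    then show ?thesis unfolding c.border_def t using \<open>rot (b + (N - b + a)) = e1\<close> by simp
  qed
  have n: "nxt (discovered m SS CC H) (Inr e1) = Inr e2" "nxt (discovered m SS CC H) (Inr e2) = Inr e1"
    using c.nxt_D_Inr[of e1] c.nxt_D_Inr[of e2] E(1,2) B1 B2 by auto
  have "face c.D (Inr e1) \<subseteq> {Inr e1, Inr e2}"
    unfolding face_def by (rule orbit_subset_closed) (use n in auto)
  moreover have "Inr e1 \<in> face c.D (Inr e1)" "Inr e2 \<in> face c.D (Inr e1)"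
    using face_self[OF c.cD] face_nxt[OF c.cD, of "Inr e1"] n(1) by metis+
  ultimately show ?thesis unfolding e1_def e2_def by blast
qed

text \<open>
  The faces on the kept cycle of \<open>m\<close> also occur in \<open>m'\<close>, and \<open>R\<close> is the region of \<open>m'\<close> in the hole
  which is enclosed by the first loop: the process of \<open>m'\<close> can leave it only through the two edges of the hole.
\<close>

locale embedding = exploration m s + target: exploration m' s'
  for m :: "'d pmap" and s and m' :: "'e pmap" and s' +
  fixes f :: "'d \<Rightarrow> 'e" and R :: "'e set"
  assumes f_inj: "inj_on f SS" and f_in: "d \<in> SS \<Longrightarrow> f d \<in> darts m'"
    and f_nxt: "d \<in> SS \<Longrightarrow> f (nxt m d) = nxt m' (f d)"
    and f_opp: "d \<in> CC \<Longrightarrow> f (opp m d) = opp m' (f d)"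
    and f_s: "f s = s'"
    and R_disj: "d \<in> SS \<Longrightarrow> f d \<notin> R" and R_back: "x \<in> R \<Longrightarrow> inv (nxt m') x \<in> R"
    and R_opp: "loop_visits a b \<Longrightarrow>
      x \<in> R \<union> {f (rot a), f (inv (nxt m) (rot a))} \<Longrightarrow> opp m' x \<in> R \<union> {f (rot a), f (inv (nxt m) (rot a))}"
begin

lemma f_back: "d \<in> SS \<Longrightarrow> f (inv (nxt m) d) = inv (nxt m') (f d)"
proof -
  assume d: "d \<in> SS"
  have "nxt m' (f (inv (nxt m) d)) = f d"
    using f_nxt[of "inv (nxt m) d"] d SS_back nxt_back[OF cm] by simp
  then show ?thesis using back_nxt[OF target.cm] by metis
qed

lemma f_step:
  assumes "i \<in> kept_steps m s" "target.rot j = f (rot i)" shows "target.rot (Suc j) = f (rot (Suc i))"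
proof -
  have c: "rot i \<in> CC" "opp m (rot i) \<in> SS" using rot_CC[OF assms(1)] CC_opp CC_SS by auto
  show ?thesis unfolding target.rot_Suc rot_Suc assms(2) using f_opp[OF c(1)] f_back[OF c(2)] by simp
qed

lemma f_face: "d \<in> SS \<Longrightarrow> face m' (f d) = f ` face m d"
  unfolding face_def by (rule orbit_image[of SS]) (use SS_nxt f_nxt in auto)

lemma f_face_eq:
  assumes "i \<in> kept_faces m s" "j \<in> kept_faces m s"
  shows "face m' (f (rot i)) = face m' (f (rot j)) \<longleftrightarrow> face m (rot i) = face m (rot j)"
  using f_face rot_SS assms inj_on_image_eq_iff[OF f_inj face_SS[OF assms(1)] face_SS[OF assms(2)]] by simp

lemma f_rot_s: "i \<in> kept_faces m s \<Longrightarrow> 0 < i \<Longrightarrow> i < N \<Longrightarrow> f (rot i) \<noteq> s'"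
proof
  assume i: "i \<in> kept_faces m s" "0 < i" "i < N" and "f (rot i) = s'"
  then have "f (rot i) = f (rot 0)" by (simp add: f_s)
  then have "rot i = rot 0" using f_inj rot_SS[OF i(1)] rot_SS[OF kept_0] by (auto simp: inj_on_def)
  then show False using rot_inj[of i 0] i by simp
qed


text \<open>The process of \<open>m'\<close> copies that of \<open>m\<close> up to time
  \<open>a\<close>, then stays in \<open>R\<close> until a time \<open>b'\<close>, and from there
  copies the process of \<open>m\<close> from \<open>b\<close> on. What happens in \<open>R\<close>
  is exactly the part that is suppressed.\<close>

theorem target_SS_CC: "target.SS = f ` SS \<and> target.CC = f ` CC"
proof (cases rule: loop_cases)
  case none
  have r: "target.rot k = f (rot k)" if "k \<le> N" for k
    using that
  proof (induct k)
    case (Suc k) then show ?case using f_step[of k k] none by simp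
  qed (simp add: f_s)
  have N': "target.N = N"
  proof (rule target.N_eqI[OF N_pos])
    show "target.rot N = s'" using r[of N] by (simp add: rot_N f_s)
    show "target.rot k \<noteq> s'" if "0 < k" "k < N" for k using r[of k] that f_rot_s[of k] none by simp
  qed
  have i': "intersection_times m' s' = {}"
  proof (rule ccontr)
    assume "intersection_times m' s' \<noteq> {}"
    then obtain i j where ij: "0 < i" "i < N" "0 < j" "j < N" "j \<noteq> i" "face m' (f (rot i)) = face m' (f (rot j))"
      unfolding target.intersection_times N' using r by auto
    then show False using f_face_eq[of i j] none(2,4) by fastforce
  qed
  have kf: "kept_faces m' s' = {0..N}" and ks: "kept_steps m' s' = {0..<N}"
    using i' N' by (simp_all add: kept_faces_def kept_steps_def target.tau_E)
  have "target.SS = (\<Union>i\<in>{0..N}. face m' (f (rot i)))"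
    unfolding target.SS_eq kf using r by (intro SUP_cong refl) auto
  also have "\<dots> = (\<Union>i\<in>{0..N}. f ` face m (rot i))"
    using f_face rot_SS none(2) by (intro SUP_cong refl) auto
  finally have "target.SS = f ` SS" unfolding SS_eq none(2) by (simp add: image_UN)
  moreover have "target.CC = (\<Union>i\<in>{0..<N}. {f (rot i), f (opp m (rot i))})"
    unfolding target.CC_eq ks using r f_opp[OF rot_CC] none(3) by (intro SUP_cong refl) auto
  then have "target.CC = f ` CC" unfolding CC_eq none(3) by (simp add: image_UN)
  ultimately show ?thesis ..
next
  case (loop a b)
  have ab: "0 < a" "a < b" "b < N" "rot b = nxt m (nxt m (rot a))" using loop(2) by (auto simp: first_loop_def)
  define e1 where "e1 = rot a"
  define e2 where "e2 = inv (nxt m) (rot a)"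
  note E = loop_edges[OF loop(1), folded e1_def e2_def]
  have r1: "target.rot k = f (rot k)" if "k \<le> a" for k
    using that
  proof (induct k)
    case (Suc k) then show ?case using f_step[of k k] loop(4) by simp
  qed (simp add: f_s)
  have s'S: "s' \<notin> R" using R_disj[OF rot_SS[OF kept_0]] by (simp add: f_s)
  \<comment> \<open>The rotation is periodic and \<open>s'\<close> lies outside \<open>R\<close>;
    the witness is a multiple of the period exceeding \<open>a\<close>.\<close>
  have ex: "\<exists>t. 0 < t \<and> target.rot (a + t) \<notin> R"
  proof (intro exI conjI)
    have le: "a < target.N * (a + 1)" using target.N_pos by (cases target.N) auto
    then show "0 < target.N * (a + 1) - a" by simp
    have "target.rot (a + (target.N * (a + 1) - a)) = s'"
      using target.rot_eq[of "target.N * (a + 1)" 0] le by simp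
    then show "target.rot (a + (target.N * (a + 1) - a)) \<notin> R" using s'S by simp
  qed
  define t where "t = (LEAST t. 0 < t \<and> target.rot (a + t) \<notin> R)"
  have t: "0 < t" "target.rot (a + t) \<notin> R" using LeastI_ex[OF ex] by (auto simp: t_def)
  have tR: "target.rot (a + i) \<in> R" if "0 < i" "i < t" for i
    using not_less_Least[of i "\<lambda>t. 0 < t \<and> target.rot (a + t) \<notin> R"] that by (auto simp: t_def)
  define b' where "b' = a + t"
  have rb: "target.rot b' = f (rot b)"
  proof -
    obtain k where k: "t = Suc k" using t(1) by (cases t) auto
    define x where "x = target.rot (a + k)"
    have "x \<in> R \<union> {f e1, f e2}"
    proof (cases "k = 0")
      case True then show ?thesis using r1[of a] by (simp add: x_def e1_def)
    next
      case False then show ?thesis using tR[of k] k by (simp add: x_def)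
    qed
    then have o: "opp m' x \<in> R \<union> {f e1, f e2}" using R_opp[OF loop(1)] unfolding e1_def e2_def by blast
    have rx: "target.rot b' = inv (nxt m') (opp m' x)" by (simp add: b'_def k x_def target.rot_Suc)
    have "opp m' x \<notin> R" using R_back[of "opp m' x"] t(2) rx by (auto simp: b'_def)
    \<comment> \<open>Crossed darts have the colour of \<open>s'\<close> and their opposites the
      other one, so the rotation cannot come out through the edge by which it went in.\<close>
    moreover have "opp m' x \<noteq> f e1"
      using r1[of a] target.col_rot[of a] target.col_rot[of "a + k"] target.col(1)[OF target.rot_in, of "a + k"]
      unfolding e1_def x_def by auto
    ultimately have "opp m' x = f e2" using o by blast
    then show ?thesis using rx f_back[of e2] E by simp
  qed
  have r2: "target.rot (b' + k) = f (rot (b + k))" if "b + k \<le> N" for k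
    using that
  proof (induct k)
    case (Suc k) then show ?case using f_step[of "b + k" "b' + k"] loop(4) by simp
  qed (simp add: rb)
  have ab': "a < b'" using t by (simp add: b'_def)
  \<comment> \<open>Inside \<open>R\<close> the rotation cannot meet \<open>s'\<close>; before and
    after, it repeats darts of \<open>m\<close> at times strictly between 0 and
    \<open>N\<close>.\<close>
  have N': "target.N = b' + (N - b)"
  proof (rule target.N_eqI)
    show "0 < b' + (N - b)" using ab by simp
    show "target.rot (b' + (N - b)) = s'" using r2[of "N - b"] ab by (simp add: rot_N f_s)
    fix k assume k: "0 < k" "k < b' + (N - b)"
    consider "k \<le> a" | "a < k" "k < b'" | "b' \<le> k" by linarith
    then show "target.rot k \<noteq> s'"
    proof cases
      case 1 then show ?thesis using r1[of k] f_rot_s[of k] k ab loop(3) by simp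
    next
      case 2
      then have "target.rot (a + (k - a)) \<in> R" by (intro tR) (auto simp: b'_def)
      then show ?thesis using 2 s'S by auto
    next
      case 3
      define l where "l = b + (k - b')"
      have l: "b \<le> l" "l < N" using 3 k ab by (auto simp: l_def)
      have "target.rot k = f (rot l)" using r2[of "k - b'"] 3 l by (simp add: l_def)
      then show ?thesis using f_rot_s[of l] l ab loop(3) by simp
    qed
  qed
  have fl': "target.first_loop a b'"
    unfolding target.first_loop_def
  proof (intro conjI allI impI notI)
    show "0 < a" "a < b'" by (rule ab, rule ab')
    show "b' < target.N" using N' ab by simp
    have "rot a \<in> SS" using rot_SS loop(3) by simp
    then show "target.rot b' = nxt m' (nxt m' (target.rot a))"
      using rb r1[of a] ab(4) f_nxt SS_nxt by simp
    fix i j assume ij: "0 < i" "i < a" "0 < j" "j \<le> target.N" "j \<noteq> i" "face m' (target.rot i) = face m' (target.rot j)"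
    have ri: "target.rot i = f (rot i)" using r1 ij by simp
    have iK: "i \<in> kept_faces m s" using ij loop(3) by simp
    have min: "face m (rot i) \<noteq> face m (rot l)" if "0 < l" "l \<le> N" "l \<noteq> i" for l
      using loop(2) ij that by (auto simp: first_loop_def)
    consider "j \<le> a" | "a < j" "j < b'" | "b' \<le> j" by linarith
    then show False
    proof cases
      case 1
      then have "face m (rot i) = face m (rot j)" using ij(6) ri r1[of j] f_face_eq[OF iK, of j] loop(3) by simp
      then show False using min[of j] 1 ij ab by simp
    next
      \<comment> \<open>The face at time \<open>i\<close> is the image of a face in
        \<open>SS\<close> and hence disjoint from \<open>R\<close>, so no dart of the loop lies on
        it.\<close>
      case 2
      then have "target.rot (a + (j - a)) \<in> R" by (intro tR) (auto simp: b'_def)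
      then have "target.rot j \<in> R" using 2 by simp
      have "target.rot j \<in> face m' (target.rot j)" by (rule face_self[OF target.cm])
      then have "target.rot j \<in> f ` face m (rot i)"
        unfolding ij(6)[symmetric] ri f_face[OF rot_SS[OF iK]] .
      then obtain d where "d \<in> face m (rot i)" "target.rot j = f d" by blast
      then show False using face_SS[OF iK] R_disj[of d] \<open>target.rot j \<in> R\<close> by auto
    next
      case 3
      define l where "l = b + (j - b')"
      have l: "l \<le> N" "b \<le> l" using 3 ij(4) N' ab by (auto simp: l_def)
      have "target.rot j = f (rot l)" using r2[of "j - b'"] 3 l by (simp add: l_def)
      then have "face m (rot i) = face m (rot l)" using ij(6) ri f_face_eq[OF iK, of l] l loop(3) by simp
      then show False using min[of l] l ij ab by simp
    qed
  qed
  \<comment> \<open>An intersection exists because the same face is visited at \<open>a\<close> and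
    \<open>b'\<close>; uniqueness of the first loop then gives the times of the process.\<close>
  obtain kf: "kept_faces m' s' = {0..a} \<union> {b'..target.N}" and ks: "kept_steps m' s' = {0..<a} \<union> {b'..<target.N}"
  proof (cases rule: target.loop_cases)
    case none
    have "face m' (target.rot a) = face m' (target.rot b')"
      using fl' face_nxt[OF target.cm] by (simp add: target.first_loop_def)
    then show ?thesis using none(4)[of a b'] fl' by (simp add: target.first_loop_def)
  next
    case (loop a'' b'')
    then show ?thesis using that target.first_loop_unique[OF fl' loop(2)] by simp
  qed
  \<comment> \<open>Both unions are over the copied end of the process; \<open>F\<close> is later
    the face of a dart or the two sides of its edge.\<close>
  have shift: "(\<Union>i\<in>{b'..target.N}. F (target.rot i)) = (\<Union>i\<in>{b..N}. F (f (rot i)))"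
    "(\<Union>i\<in>{b'..<target.N}. F (target.rot i)) = (\<Union>i\<in>{b..<N}. F (f (rot i)))" for F :: "'e \<Rightarrow> 'e set"
  proof -
    define c where "c = N - b"
    have c: "N = b + c" "target.N = b' + c" using N' ab by (simp_all add: c_def)
    have e: "{l..l + c} = (\<lambda>k. l + k) ` {0..c}" "{l..<l + c} = (\<lambda>k. l + k) ` {0..<c}" for l
      by (simp_all add: image_add_atLeastAtMost image_add_atLeastLessThan add.commute)
    have v: "F (target.rot (b' + k)) = F (f (rot (b + k)))" if "k \<le> c" for k using r2[of k] that c by simp
    then show "(\<Union>i\<in>{b'..target.N}. F (target.rot i)) = (\<Union>i\<in>{b..N}. F (f (rot i)))"
      "(\<Union>i\<in>{b'..<target.N}. F (target.rot i)) = (\<Union>i\<in>{b..<N}. F (f (rot i)))"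
      unfolding c e image_image by (intro SUP_cong refl v; simp)+
  qed
  have "target.SS = (\<Union>i\<in>{0..a}. face m' (f (rot i))) \<union> (\<Union>i\<in>{b..N}. face m' (f (rot i)))"
    unfolding target.SS_eq kf UN_Un shift[of "face m'"] using r1 by (intro arg_cong2[of _ _ _ _ "(\<union>)"] SUP_cong refl) auto
  also have "\<dots> = (\<Union>i\<in>kept_faces m s. face m' (f (rot i)))" unfolding loop(3) by (simp add: UN_Un)
  also have "\<dots> = (\<Union>i\<in>kept_faces m s. f ` face m (rot i))"
    using f_face rot_SS by (intro SUP_cong refl) auto
  finally have ss: "target.SS = f ` SS" unfolding SS_eq by (simp add: image_UN)
  have "target.CC = (\<Union>i\<in>{0..<a}. {f (rot i), opp m' (f (rot i))}) \<union> (\<Union>i\<in>{b..<N}. {f (rot i), opp m' (f (rot i))})"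
    unfolding target.CC_eq ks UN_Un shift[of "\<lambda>x. {x, opp m' x}"] using r1
    by (intro arg_cong2[of _ _ _ _ "(\<union>)"] SUP_cong refl) auto
  then have "target.CC = (\<Union>i\<in>kept_steps m s. {f (rot i), opp m' (f (rot i))})" unfolding loop(4) by (simp add: UN_Un)
  also have "\<dots> = (\<Union>i\<in>kept_steps m s. {f (rot i), f (opp m (rot i))})"
    using f_opp rot_CC by (intro SUP_cong refl) auto
  finally have "target.CC = f ` CC" unfolding CC_eq by (simp add: image_UN)
  with ss show ?thesis ..
qed

end

section \<open>The submap order\<close>

text \<open>The map in a hole that leaves it unfilled: a polygon, with the root face outside and a hole inside.\<close>

definition polygon :: "'d pmap \<Rightarrow> 'd \<Rightarrow> (bool \<times> 'd) pmap" where
  "polygon p h = \<lparr>darts = UNIV \<times> face p h,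
     opp = (\<lambda>(i, d). if d \<in> face p h then (\<not> i, d) else (i, d)),
     nxt = (\<lambda>(i, d). if d \<in> face p h then (i, if i then inv (nxt p) d else nxt p d) else (i, d)),
     rootd = (True, h), marks = {(False, h)}\<rparr>"

context
  fixes p :: "'d pmap" and h :: 'd
  assumes cp: "cmap p"
begin

lemma polygon_simps:
  "darts (polygon p h) = UNIV \<times> face p h" "rootd (polygon p h) = (True, h)" "marks (polygon p h) = {(False, h)}"
  "d \<in> face p h \<Longrightarrow> opp (polygon p h) (i, d) = (\<not> i, d)"
  "d \<in> face p h \<Longrightarrow> nxt (polygon p h) (True, d) = (True, inv (nxt p) d)"
  "d \<in> face p h \<Longrightarrow> nxt (polygon p h) (False, d) = (False, nxt p d)"
  by (simp_all add: polygon_def)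

lemma face_closed: "nxt p d \<in> face p h \<longleftrightarrow> d \<in> face p h" "inv (nxt p) d \<in> face p h \<longleftrightarrow> d \<in> face p h"
  by (metis face_eq_iff[OF cp] face_nxt[OF cp]) (metis face_eq_iff[OF cp] face_back[OF cp])

lemma cmap_polygon: "cmap (polygon p h)"
proof -
  have "opp (polygon p h) permutes darts (polygon p h)"
    by (rule involution_permutes) (auto simp: polygon_def split: if_splits)
  moreover have "nxt (polygon p h) permutes darts (polygon p h)"
  proof (rule bij_imp_permutes)
    show "bij_betw (nxt (polygon p h)) (darts (polygon p h)) (darts (polygon p h))"
      by (rule bij_betw_byWitness[where f' = "\<lambda>(i, d). (i, if i then nxt p d else inv (nxt p) d)"])
        (auto simp: polygon_def face_closed nxt_back[OF cp] back_nxt[OF cp])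
  qed (auto simp: polygon_def split: if_splits)
  ultimately show ?thesis
    using finite_face[OF cp] by (auto simp: cmap_def polygon_simps)
qed

lemma face_polygon:
  assumes "d \<in> face p h" shows "face (polygon p h) (i, d) = {i} \<times> face p h"
proof -
  have e: "face p d = face p h" using assms face_eq_iff[OF cp] by blast
  have "orbit (nxt (polygon p h)) (Pair i d) = Pair i ` orbit (if i then inv (nxt p) else nxt p) d"
    by (rule orbit_image[of "face p h"]) (use assms in \<open>auto simp: polygon_def face_closed\<close>)
  moreover have "orbit (if i then inv (nxt p) else nxt p) d = face p d"
    using orbit_inv[OF finite_darts[OF cp] nxt_permutes[OF cp]] by (simp add: face_def)
  ultimately show ?thesis unfolding face_def[of "polygon p h"] using e by auto
qed

text \<open>With n the degree of the hole there are n edges, two faces and, by the label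
  \<open>g\<close>, at least n vertices.\<close>

lemma quad_polygon: "quad_with_holes (polygon p h)"
proof -
  let ?m = "polygon p h"
  note hh = face_self[OF cp, of h]
  have rf: "root_face ?m = {True} \<times> face p h" and hd: "hole_darts ?m = {False} \<times> face p h"
    using face_polygon[OF hh] by (auto simp: root_face_def hole_darts_def polygon_simps)
  have st: "P (i, d) = P (i, e)"
    if n: "\<And>c. c \<in> {i} \<times> face p h \<Longrightarrow> P (nxt ?m c) = P c" and de: "d \<in> face p h" "e \<in> face p h"
    for P :: "bool \<times> 'd \<Rightarrow> bool" and i d e
  proof -
    have w: "w \<in> {i} \<times> face p h \<and> P w = P (i, e)" if "w \<in> orbit (nxt ?m) (i, e)" for w
      using that
    proof induct
      case base
      then show ?case using n[of "(i, e)"] de by (auto simp: polygon_def face_closed)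
    next
      case (step y)
      then show ?case using n[of y] by (auto simp: polygon_def face_closed)
    qed
    have "(i, d) \<in> orbit (nxt ?m) (i, e)" using face_polygon[OF de(2), of i] de by (auto simp: face_def)
    then show ?thesis using w by blast
  qed
  have lk: "linked ?m (darts ?m)"
  proof (rule linkedI[OF cmap_polygon])
    fix P :: "bool \<times> 'd \<Rightarrow> bool" and x y
    assume n: "\<And>c. c \<in> darts ?m \<Longrightarrow> P (nxt ?m c) = P c"
      and o: "\<And>c. c \<in> darts ?m \<Longrightarrow> opp ?m c \<in> darts ?m \<Longrightarrow> P (opp ?m c) = P c"
      and x: "x \<in> darts ?m" and y: "y \<in> darts ?m"
    have "P (i, d) = P (True, h)" if d: "d \<in> face p h" for i d
    proof -
      have "P (i, d) = P (i, h)" by (rule st) (use n d hh in \<open>auto simp: polygon_simps\<close>)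
      also have "\<dots> = P (True, h)" using o[of "(True, h)"] hh by (cases i) (auto simp: polygon_simps)
      finally show ?thesis .
    qed
    then show "P x = P y" using x y by (cases x; cases y) (auto simp: polygon_simps)
  qed (auto simp: nxt_in[OF cmap_polygon])
  have lk': "linked ?m (darts ?m - hole_darts ?m)"
  proof (rule linkedI[OF cmap_polygon])
    fix P :: "bool \<times> 'd \<Rightarrow> bool" and x y
    assume n: "\<And>c. c \<in> darts ?m - hole_darts ?m \<Longrightarrow> P (nxt ?m c) = P c"
      and x: "x \<in> darts ?m - hole_darts ?m" and y: "y \<in> darts ?m - hole_darts ?m"
    obtain d e where "x = (True, d)" "y = (True, e)" "d \<in> face p h" "e \<in> face p h"
      using x y hd by (cases x; cases y) (auto simp: polygon_simps)
    then show "P x = P y" using st[of True P d e] n hd by (auto simp: polygon_simps)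
  qed (auto simp: nxt_in[OF cmap_polygon] hole_darts_closed[OF cmap_polygon])
  have "card (darts ?m) = 2 * card (face p h)" by (simp add: polygon_simps card_cartesian_product)
  then have E: "card (edges ?m) = card (face p h)" using card_edges[OF cmap_polygon] by simp
  have "faces ?m = {{True} \<times> face p h, {False} \<times> face p h}"
  proof
    show "faces ?m \<subseteq> {{True} \<times> face p h, {False} \<times> face p h}"
    proof
      fix w assume "w \<in> faces ?m"
      then obtain i d where "d \<in> face p h" "w = face ?m (i, d)" by (auto simp: faces_def polygon_simps)
      then show "w \<in> {{True} \<times> face p h, {False} \<times> face p h}" using face_polygon by (cases i) auto
    qed
    have "face ?m (i, h) \<in> faces ?m" for i using hh by (simp add: faces_def polygon_simps)
    then show "{{True} \<times> face p h, {False} \<times> face p h} \<subseteq> faces ?m" using face_polygon[OF hh] by auto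
  qed
  moreover have "{True} \<times> face p h \<noteq> {False} \<times> face p h" using hh by auto
  ultimately have F: "card (faces ?m) = 2" by simp
  \<comment> \<open>The name of the outer dart that leaves the same vertex.\<close>
  define g where "g z = (case z of (i, d) \<Rightarrow> if i then d else inv (nxt p) d)" for z :: "bool \<times> 'd"
  have "card (g ` darts ?m) \<le> card (orbit (nxt ?m \<circ> opp ?m) ` darts ?m)"
  proof (rule card_image_le_orbits[OF finite_darts[OF cmap_polygon] step_permutes[OF cmap_polygon]])
    fix z assume "z \<in> darts ?m"
    then obtain i d where "z = (i, d)" "d \<in> face p h" by (auto simp: polygon_simps)
    then show "g ((nxt ?m \<circ> opp ?m) z) = g z"
      by (cases i) (auto simp: polygon_simps g_def back_nxt[OF cp])
  qed
  moreover have "g ` darts ?m = face p h"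
  proof
    show "g ` darts ?m \<subseteq> face p h" by (auto simp: g_def polygon_simps face_closed)
    show "face p h \<subseteq> g ` darts ?m"
    proof
      fix d assume "d \<in> face p h"
      then show "d \<in> g ` darts ?m" by (intro image_eqI[of _ _ "(True, d)"]) (auto simp: g_def polygon_simps)
    qed
  qed
  ultimately have "card (face p h) \<le> card (verts ?m)" by (simp add: verts_def)
  then have pl: "planar_map ?m"
    by (intro planar_mapI[OF cmap_polygon lk]) (use E F hh in \<open>simp_all add: polygon_simps\<close>)
  show ?thesis
    unfolding quad_with_holes_def
    using pl lk' hh rf hd by (auto simp: polygon_simps)
qed

end

text \<open>Serves the trace argument at the end: on the event \<open>Q = p\<close> the discovered
  map has to be a submap of \<open>p\<close>. Each hole is filled with a polygon whose inner face is
  the hole again.\<close>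

lemma submap_refl: "Some p \<sqsubseteq> Some p"
proof -
  define P where "P = rep_hmap p"
  note q = quad_with_holes_rep[of p, folded P_def]
  note cP = quad_with_holesD(2)[OF q]
  define u where "u h = class_of (polygon P h)" for h
  have "\<exists>k. rooted_iso k (rep_hmap (u h)) (polygon P h) \<and> k ` marks (rep_hmap (u h)) = {(False, h)}" for h
    using rep_class_of[OF quad_polygon[OF cP]] unfolding map_iso_def u_def by (metis polygon_simps(3)[OF cP])
  then obtain k where k: "\<And>h. rooted_iso (k h) (rep_hmap (u h)) (polygon P h)"
    and km: "\<And>h. k h ` marks (rep_hmap (u h)) = {(False, h)}" by metis
  note kD = rooted_isoD[OF k]
  note cu = quad_with_holesD(2)[OF quad_with_holes_rep] and cpo = cmap_polygon[OF cP]
  have ru: "rootd (rep_hmap (u h)) \<in> darts (rep_hmap (u h))" for h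
    using quad_with_holes_rep quad_with_holesD(1) planar_mapD(3) by blast
  have krf: "{True} \<times> face P h = k h ` root_face (rep_hmap (u h))" for h
    using iso_root_face[OF cu cpo k ru, of h] face_polygon[OF cP face_self[OF cP], of h True]
    by (simp add: root_face_def polygon_simps(2)[OF cP])
  have rfs: "root_face (rep_hmap (u h)) \<subseteq> darts (rep_hmap (u h))" for h
    using face_subset[OF cu ru] by (simp add: root_face_def)
  have gl: "gluing P (\<lambda>h. rep_hmap (u h))"
  proof unfold_locales
    fix h
    have "card (root_face (rep_hmap (u h))) = card ({True} \<times> face P h)"
      unfolding krf by (rule card_image[symmetric], rule inj_on_subset[OF kD(5) rfs])
    then show "card (root_face (rep_hmap (u h))) = card (face P h)" by (simp add: card_cartesian_product)
  qed (use q quad_with_holes_rep in auto)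
  interpret gluing P "\<lambda>h. rep_hmap (u h)" by (rule gl)
  \<comment> \<open>An inner dart of the polygon stands for the hole dart \<open>d\<close>, an outer
    one for the other side of its edge; this is the compatibility along the boundary that
    \<open>glue_isoI\<close> asks for.\<close>
  define lab where "lab z = (case z of (i, d) \<Rightarrow> if i then opp P d else d)" for z :: "bool \<times> nat"
  have kud: "k h ` ud h = {False} \<times> face P h" for h
  proof -
    have "k h ` ud h = k h ` darts (rep_hmap (u h)) - k h ` root_face (rep_hmap (u h))"
      unfolding ud_def using rfs kD(5) by (simp add: inj_on_image_set_diff[of "k h" "darts (rep_hmap (u h))"])
    then show ?thesis unfolding kD(6) krf[symmetric] polygon_simps(1)[OF cP] by auto
  qed
  have kudE: "\<exists>d\<in>face P h. k h y = (False, d)" if "y \<in> ud h" for h y using kud[of h] that by blast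
  have mP: "marks P \<subseteq> darts P" using quad_with_holesD(3)[OF q] .
  have "map_iso (glue_pmap P (\<lambda>h. rep_hmap (u h))) P"
  proof (rule glue_isoI[where \<phi> = id and \<psi> = "\<lambda>h y. lab (k h y)"])
    fix h y assume h: "h \<in> marks P" and y: "y \<in> ud h"
    obtain d where d: "d \<in> face P h" "k h y = (False, d)" using kudE[OF y] by blast
    show "lab (k h (nxt (rep_hmap (u h)) y)) = nxt P (lab (k h y))"
      using kD(4)[OF ud_darts[OF y]] d by (simp add: polygon_simps[OF cP] lab_def)
  next
    fix h y assume h: "h \<in> marks P" and y: "y \<in> darts (rep_hmap (u h))"
    have "k h y \<in> UNIV \<times> face P h" using kD(6)[of h] y polygon_simps(1)[OF cP] by auto
    then obtain i d where d: "d \<in> face P h" "k h y = (i, d)" by auto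
    have "opp P (opp P d) = d" using opp_opp[OF cP] face_subset[OF cP] d h mP by blast
    then show "lab (k h (opp (rep_hmap (u h)) y)) = opp P (lab (k h y))"
      using kD(3)[OF y] d by (simp add: polygon_simps[OF cP] lab_def)
  next
    fix h i assume h: "h \<in> marks P"
    have "k h (rd h i) = (nxt (polygon P h) ^^ i) (True, h)"
      unfolding rd_def using h iso_nxt_funpow[OF cu cpo k ru, of h i] kD(2)[of h] polygon_simps(2)[OF cP] by simp
    moreover have "(nxt (polygon P h) ^^ i) (True, h) = (True, hd h i) \<and> hd h i \<in> face P h"
      by (induct i) (auto simp: hd_def polygon_simps[OF cP] face_closed[OF cP] face_self[OF cP])
    ultimately show "lab (k h (rd h i)) = id (opp P (hd h i))" by (simp add: lab_def)
  next
    let ?F = "case_sum id (\<lambda>(h, y). lab (k h y))"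
    have "inj_on ?F (glue_darts P (\<lambda>h. rep_hmap (u h)))"
    proof (rule inj_onI)
      fix x y assume xy: "x \<in> glue_darts P (\<lambda>h. rep_hmap (u h))" "y \<in> glue_darts P (\<lambda>h. rep_hmap (u h))" "?F x = ?F y"
      have R: "\<exists>h y. z = Inr (h, y) \<and> h \<in> marks P \<and> y \<in> ud h \<and> ?F z \<in> face P h \<and> k h y = (False, ?F z)"
        if "z = Inr c" "z \<in> glue_darts P (\<lambda>h. rep_hmap (u h))" for z c
        using that kudE[of "snd c" "fst c"] by (cases c) (auto simp: lab_def)
      have L: "?F z = d \<and> d \<notin> hole_darts P" if "z = Inl d" "z \<in> glue_darts P (\<lambda>h. rep_hmap (u h))" for z d
        using that by (auto simp: pd_def)
      show "x = y"
      proof (cases x; cases y)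
        fix a b assume "x = Inl a" "y = Inl b" then show ?thesis using xy(3) by simp
      next
        fix a b assume ab: "x = Inr a" "y = Inr b"
        obtain h c where c: "x = Inr (h, c)" "h \<in> marks P" "c \<in> ud h" "?F x \<in> face P h" "k h c = (False, ?F x)"
          using R[OF ab(1) xy(1)] by blast
        obtain h' c' where c': "y = Inr (h', c')" "h' \<in> marks P" "c' \<in> ud h'" "?F y \<in> face P h'" "k h' c' = (False, ?F y)"
          using R[OF ab(2) xy(2)] by blast
        have hh: "h = h'" by (rule hole_unique[OF c(2) c'(2) c(4)]) (unfold xy(3), rule c'(4))
        have "k h c = k h c'" using c(5) c'(5) xy(3) hh by simp
        then have "c = c'" using inj_onD[OF kD(5)[of h], of c c'] ud_darts[OF c(3)] ud_darts[OF c'(3)] hh by simp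
        then show ?thesis using c(1) c'(1) hh by simp
      next
        fix a b assume ab: "x = Inl a" "y = Inr b"
        obtain h where "h \<in> marks P" "?F y \<in> face P h" using R[OF ab(2) xy(2)] by blast
        then show ?thesis using L[OF ab(1) xy(1)] in_hole xy(3) by metis
      next
        fix a b assume ab: "x = Inr a" "y = Inl b"
        obtain h where "h \<in> marks P" "?F x \<in> face P h" using R[OF ab(1) xy(1)] by blast
        then show ?thesis using L[OF ab(2) xy(2)] in_hole xy(3) by metis
      qed
    qed
    moreover have "?F ` glue_darts P (\<lambda>h. rep_hmap (u h)) = darts P"
    proof -
      have "?F ` glue_darts P (\<lambda>h. rep_hmap (u h)) = pd \<union> (\<Union>h\<in>marks P. lab ` (k h ` ud h))"
        unfolding glue_darts_eq by (auto simp: image_Un image_image)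
      also have "\<dots> = pd \<union> hole_darts P"
        unfolding kud hole_darts_def lab_def by force
      finally show ?thesis using hole_darts_subset by (auto simp: pd_def)
    qed
    ultimately show "bij_betw ?F (glue_darts P (\<lambda>h. rep_hmap (u h))) (darts P)" by (simp add: bij_betw_def)
  next
    have "(\<lambda>y. lab (k h y)) ` marks (rep_hmap (u h)) = {h}" for h
      using arg_cong[OF km[of h], of "(`) lab"] by (simp add: image_image lab_def)
    then show "(\<Union>h\<in>marks P. (\<lambda>y. lab (k h y)) ` marks (rep_hmap (u h))) = marks P" by simp
  qed simp_all
  then have "fills p u p" using fillsI gl unfolding P_def by blast
  then show ?thesis by auto
qed

section \<open>The submaps discovered by the right process\<close>

lemma rooted_iso_comp:
  assumes "rooted_iso f a b" "rooted_iso g b c" shows "rooted_iso (g \<circ> f) a c"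
  using assms unfolding rooted_iso_def by (auto intro: bij_betw_trans dest: bij_betwE)

text \<open>The rotations defining \<open>border\<close> cross only edges of \<open>C\<close>, which
  \<open>f\<close> respects, so \<open>f\<close> carries the new boundaries along with the
  faces.\<close>

lemma discovered_iso:
  assumes c: "cutting m S C H" "cutting m' (f ` S) (f ` C) H'"
    and inj: "inj_on f S" and nx: "\<And>d. d \<in> S \<Longrightarrow> f (nxt m d) = nxt m' (f d)"
    and op: "\<And>d. d \<in> C \<Longrightarrow> f (opp m d) = opp m' (f d)" and root: "f (rootd m) = rootd m'"
  shows "rooted_iso (map_sum f f) (discovered m S C H) (discovered m' (f ` S) (f ` C) H')"
proof -
  interpret a: cutting m S C H by (rule c(1))
  interpret b: cutting m' "f ` S" "f ` C" H' by (rule c(2))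
  have mem: "f d \<in> f ` C \<longleftrightarrow> d \<in> C" if "d \<in> S" for d
    using that inj a.CS by (auto simp: inj_on_def)
  have bk: "f (inv (nxt m) d) = inv (nxt m') (f d)" if d: "d \<in> S" for d
  proof -
    have "nxt m' (f (inv (nxt m) d)) = f d"
      using nx[of "inv (nxt m) d"] a.back_S[OF d] nxt_back[OF a.cm] by simp
    then show ?thesis using back_nxt[OF b.cm] by metis
  qed
  have border: "b.border (f d) = f (a.border d)" if d: "d \<in> S - C" for d
  proof -
    define t where "t k = (a.turn ^^ k) (inv (nxt m) d)" for k
    define t' where "t' k = (b.turn ^^ k) (inv (nxt m') (f d))" for k
    define L where "L = (LEAST k. t k \<notin> C)"
    have tL: "t L = a.border d" by (simp add: a.border_def t_def L_def)
    then have tLC: "t L \<in> S - C" using a.border_in[OF d] by simp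
    have less: "t k \<in> C" if "k < L" for k using not_less_Least[of k "\<lambda>k. t k \<notin> C"] that by (auto simp: L_def)
    have t': "t' k = f (t k)" if "k \<le> L" for k
      using that
    proof (induct k)
      case 0 then show ?case using bk d by (simp add: t_def t'_def)
    next
      case (Suc k)
      have tk: "t k \<in> C" using less Suc by simp
      have "opp m (t k) \<in> S" using a.C_opp[OF tk] a.CS by blast
      then have "f (a.turn (t k)) = b.turn (f (t k))" using bk op[OF tk] by (simp add: a.turn_def b.turn_def)
      then show ?case using Suc by (simp add: t_def t'_def)
    qed
    have "(LEAST k. t' k \<notin> f ` C) = L"
    proof (rule Least_equality)
      show "t' L \<notin> f ` C" using t'[of L] tLC mem by auto
      show "L \<le> k" if "t' k \<notin> f ` C" for k
      proof (rule ccontr)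
        assume "\<not> L \<le> k"
        then have "t' k \<in> f ` C" using t'[of k] less[of k] by simp
        then show False using that by simp
      qed
    qed
    then show ?thesis using t'[of L] tL by (simp add: b.border_def t'_def)
  qed
  have "bij_betw (map_sum f f) (darts a.D) (darts b.D)"
    unfolding bij_betw_def
  proof
    show "inj_on (map_sum f f) (darts a.D)"
    proof (rule inj_onI)
      fix x y assume "x \<in> darts a.D" "y \<in> darts a.D" "map_sum f f x = map_sum f f y"
      then show "x = y" unfolding a.darts_D by (cases x; cases y) (auto dest: inj_onD[OF inj])
    qed
    have "f ` (S - C) = f ` S - f ` C" using inj a.CS by (simp add: inj_on_image_set_diff[of f S])
    moreover have "map_sum f f ` darts a.D = Inl ` (f ` S) \<union> Inr ` (f ` (S - C))"
      unfolding a.darts_D by (simp add: image_Un image_image)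
    ultimately show "map_sum f f ` darts a.D = darts b.D" unfolding b.darts_D by simp
  qed
  moreover have "map_sum f f (opp a.D x) = opp b.D (map_sum f f x) \<and> map_sum f f (nxt a.D x) = nxt b.D (map_sum f f x)"
    if x: "x \<in> darts a.D" for x
  proof (cases x)
    case (Inl d)
    then have d: "d \<in> S" using x a.darts_D by auto
    have "map_sum f f (opp a.D x) = opp b.D (map_sum f f x)"
    proof (cases "d \<in> C")
      case True
      then show ?thesis using Inl op a.opp_D_C b.opp_D_C[of "f d"] by simp
    next
      case False
      then show ?thesis using Inl d mem a.opp_D_Inl b.opp_D_Inl[of "f d"] by simp
    qed
    then show ?thesis using Inl d nx a.nxt_D_Inl b.nxt_D_Inl[of "f d"] by simp
  next
    case (Inr d)
    then have d: "d \<in> S" "d \<notin> C" using x a.darts_D by auto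
    then have "f d \<in> f ` S" "f d \<notin> f ` C" using mem by auto
    then show ?thesis using Inr d border a.opp_D_Inr b.opp_D_Inr a.nxt_D_Inr b.nxt_D_Inr by simp
  qed
  ultimately show ?thesis unfolding rooted_iso_def using root by (simp add: a.rootd_D b.rootd_D)
qed

definition start :: "bool \<Rightarrow> 'd pmap \<Rightarrow> 'd" where
  "start b m = (if b then rootd m else nxt m (rootd m))"

lemma exploration_rep:
  assumes "p \<in> quads 2" shows "exploration (rep_hmap p) (start b (rep_hmap p))"
proof
  note cm = quad_with_holesD(2)[OF quad_with_holes_rep[of p]]
  show "start b (rep_hmap p) \<in> root_face (rep_hmap p)"
    using face_self[OF cm] face_nxt[OF cm] face_eq_iff[OF cm] by (auto simp: start_def root_face_def)
qed (use assms quad_with_holes_rep in \<open>auto simp: quads_def holes_def perimeter_def\<close>)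

lemma right_cycle_map_cutting:
  assumes "exploration m s" "right_cycle_map m s p"
  shows "\<exists>H. cutting m (exploration.SS m s) (exploration.CC m s) H \<and>
    p = class_of (discovered m (exploration.SS m s) (exploration.CC m s) H)"
proof -
  interpret exploration m s by (rule assms(1))
  show ?thesis
    using assms(2) cuttingI unfolding right_cycle_map_def Let_def SS_def[symmetric] CC_def[symmetric] by blast
qed

lemma right_cycle_submap:
  assumes "p \<in> quads 2" "right_cycle_map (rep_hmap p) (start b (rep_hmap p)) p'"
  shows "Some p' \<sqsubseteq> Some p"
  using right_cycle_map_cutting[OF exploration_rep[OF assms(1)] assms(2)] cutting_submap by blast

text \<open>The faces discovered in \<open>p\<close> are placed in \<open>p'\<close> by
  \<open>f\<close>, which follows \<open>r\<close> into the glued map. The content of the hole left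
  by the loop serves as \<open>R\<close>: it is attached to the rest only along the two edges of
  that hole, as an \<open>embedding\<close> demands.\<close>

theorem right_cycle_local:
  assumes p: "p \<in> quads 2" "right_cycle_map (rep_hmap p) (start b (rep_hmap p)) r"
    and p': "p' \<in> quads 2" "right_cycle_map (rep_hmap p') (start b (rep_hmap p')) r'"
    and sub: "Some r \<sqsubseteq> Some p'"
  shows "same_up_to_marks r r'"
proof -
  define m m' P where "m = rep_hmap p" and "m' = rep_hmap p'" and "P = rep_hmap r"
  interpret e: exploration m "start b m" unfolding m_def by (rule exploration_rep[OF p(1)])
  interpret e': exploration m' "start b m'" unfolding m'_def by (rule exploration_rep[OF p'(1)])
  obtain H where cut: "cutting m e.SS e.CC H" and r: "r = class_of (discovered m e.SS e.CC H)"
    using right_cycle_map_cutting[OF e.exploration_axioms p(2)[folded m_def]] by blast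
  obtain H' where cut': "cutting m' e'.SS e'.CC H'" and r': "r' = class_of (discovered m' e'.SS e'.CC H')"
    using right_cycle_map_cutting[OF e'.exploration_axioms p'(2)[folded m'_def]] by blast
  interpret c: cutting m e.SS e.CC H by (rule cut)
  obtain u where u: "fills r u p'" using sub by auto
  interpret gluing P "\<lambda>h. rep_hmap (u h)" unfolding P_def by (rule fills_rep(1)[OF u])
  have qP: "quad_with_holes P" unfolding P_def by (rule quad_with_holes_rep)
  note cP = quad_with_holesD(2)[OF qP]
  have "map_iso c.D P"
    using map_iso_sym[OF quad_with_holes_rep rep_class_of[OF c.qD]] unfolding P_def r .
  then obtain j where j: "rooted_iso j c.D P" "j ` H = marks P" unfolding map_iso_def c.marks_D by blast
  have "map_iso G m'"
    using map_iso_sym[OF quad_with_holes_rep fills_rep(2)[OF u]] unfolding P_def m'_def .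
  then obtain \<theta> where \<theta>: "rooted_iso \<theta> G m'" unfolding map_iso_def by blast
  note jD = rooted_isoD[OF j(1)] and \<theta>D = rooted_isoD[OF \<theta>]
  have HD: "H \<subseteq> darts c.D" using quad_with_holesD(3)[OF c.qD] by (simp add: c.marks_D)
  have holeP: "hole_darts P = j ` Inr ` (e.SS - e.CC)"
    using iso_hole_darts[OF c.cD cP j(1)] HD j(2) by (simp add: c.marks_D c.hole_D)
  have jpd: "j (Inl d) \<in> pd" if d: "d \<in> e.SS" for d
  proof -
    have dD: "Inl d \<in> darts c.D" using d by (simp add: c.darts_D)
    have "j (Inl d) \<notin> j ` Inr ` (e.SS - e.CC)"
    proof
      assume "j (Inl d) \<in> j ` Inr ` (e.SS - e.CC)"
      then obtain d' where "d' \<in> e.SS - e.CC" "j (Inl d) = j (Inr d')" by blast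
      then have "Inl d = Inr d'" using inj_onD[OF jD(5), of "Inl d" "Inr d'"] dD by (auto simp: c.darts_D)
      then show False by simp
    qed
    then show ?thesis using dD jD(6) holeP by (auto simp: pd_def)
  qed
  define f where "f d = \<theta> (Inl (j (Inl d)))" for d
  have f_inj: "inj_on f e.SS"
  proof (rule inj_onI)
    fix a b assume ab: "a \<in> e.SS" "b \<in> e.SS" "f a = f b"
    then have "j (Inl a) = j (Inl b)"
      using inj_onD[OF \<theta>D(5), of "Inl (j (Inl a))" "Inl (j (Inl b))"] jpd by (simp add: f_def)
    then show "a = b" using inj_onD[OF jD(5), of "Inl a" "Inl b"] ab by (simp add: c.darts_D)
  qed
  have f_nxt: "f (nxt m d) = nxt m' (f d)" if d: "d \<in> e.SS" for d
    using jD(4)[of "Inl d"] \<theta>D(4)[of "Inl (j (Inl d))"] jpd[OF d] d by (simp add: f_def c.darts_D c.nxt_D_Inl)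
  have f_opp: "f (opp m d) = opp m' (f d)" if d: "d \<in> e.CC" for d
  proof -
    have dS: "d \<in> e.SS" "opp m d \<in> e.SS" using d c.C_opp[OF d] c.CS by auto
    have jo: "opp P (j (Inl d)) = j (Inl (opp m d))"
      using jD(3)[of "Inl d"] dS d by (simp add: c.darts_D c.opp_D_C)
    then have "opp G (Inl (j (Inl d))) = Inl (j (Inl (opp m d)))"
      using glue_opp_pd[of "j (Inl d)"] jpd dS by simp
    then show ?thesis using \<theta>D(3)[of "Inl (j (Inl d))"] jpd dS by (simp add: f_def)
  qed
  have root_SS: "rootd m \<in> e.SS" by (rule c.root_S)
  have f_root: "f (rootd m) = rootd m'"
    using jD(2) \<theta>D(2) by (simp add: f_def c.rootd_D)
  have f_s: "f (start b m) = start b m'"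
    using f_root f_nxt[OF root_SS] by (simp add: start_def)
  have f_in: "f d \<in> darts m'" if "d \<in> e.SS" for d
    using jpd[OF that] \<theta>D(6) by (auto simp: f_def)
  have jhole: "opp P (j (Inr e)) = j (Inl e)" "opp P (j (Inl e)) = j (Inr e)" if "e \<in> e.SS - e.CC" for e
    using jD(3)[of "Inr e"] jD(3)[of "Inl e"] that by (simp_all add: c.darts_D c.opp_D_Inr c.opp_D_Inl)
  \<comment> \<open>Without a loop the empty region serves.\<close>
  have "\<exists>R. (\<forall>d\<in>e.SS. f d \<notin> R) \<and> (\<forall>x\<in>R. inv (nxt m') x \<in> R) \<and>
    (\<forall>a k x. e.loop_visits a k \<longrightarrow>
      x \<in> R \<union> {f (e.rot a), f (inv (nxt m) (e.rot a))} \<longrightarrow> opp m' x \<in> R \<union> {f (e.rot a), f (inv (nxt m) (e.rot a))})"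
  proof (cases "\<exists>a k. e.loop_visits a k")
    case False then show ?thesis by (intro exI[of _ "{}"]) blast
  next
    case True
    then obtain a k where lv: "e.loop_visits a k" by blast
    define e1 where "e1 = e.rot a"
    define e2 where "e2 = inv (nxt m) (e.rot a)"
    note E = e.loop_edges[OF lv, folded e1_def e2_def]
    have fD: "face c.D (Inr e1) = {Inr e1, Inr e2}"
      using e.loop_hole[OF lv cut] unfolding e1_def e2_def .
    have "j (Inr e1) \<in> hole_darts P" unfolding holeP using E(1) by blast
    then obtain h where h: "h \<in> marks P" "j (Inr e1) \<in> face P h" by (auto simp: hole_darts_def)
    have "face P h = face P (j (Inr e1))" using h(2) face_eq_iff[OF cP] by metis
    also have "\<dots> = j ` face c.D (Inr e1)" by (rule iso_face[OF c.cD cP j(1)]) (use E(1) in \<open>simp add: c.darts_D\<close>)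
    finally have fh: "face P h = {j (Inr e1), j (Inr e2)}" using fD by simp
    define R where "R = (\<lambda>y. \<theta> (Inr (h, y))) ` ud h"
    have Rin: "\<theta> (Inr (h, y)) \<in> R" if "y \<in> ud h" for y using that by (simp add: R_def)
    have cu: "cmap (rep_hmap (u h))" using quad_with_holesD(2)[OF quad_with_holes_rep] .
    have 1: "f d \<notin> R" if d: "d \<in> e.SS" for d
    proof
      assume "f d \<in> R"
      then obtain y where "y \<in> ud h" "\<theta> (Inl (j (Inl d))) = \<theta> (Inr (h, y))" by (auto simp: f_def R_def)
      then have "Inl (j (Inl d)) = (Inr (h, y) :: nat + nat \<times> nat)"
        using inj_onD[OF \<theta>D(5), of "Inl (j (Inl d))" "Inr (h, y)"] jpd[OF d] h(1) by simp
      then show False by simp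
    qed
    have 2: "inv (nxt m') x \<in> R" if x: "x \<in> R" for x
    proof -
      obtain y where y: "y \<in> ud h" "x = \<theta> (Inr (h, y))" using x by (auto simp: R_def)
      have "nxt G (Inr (h, inv (nxt (rep_hmap (u h))) y)) = Inr (h, y)"
        using h(1) y(1) by (simp add: nxt_back[OF cu])
      then have "nxt m' (\<theta> (Inr (h, inv (nxt (rep_hmap (u h))) y))) = x"
        using \<theta>D(4)[of "Inr (h, inv (nxt (rep_hmap (u h))) y)"] h(1) y by simp
      then have "inv (nxt m') x = \<theta> (Inr (h, inv (nxt (rep_hmap (u h))) y))" using back_nxt[OF e'.cm] by metis
      then show ?thesis using Rin h(1) y(1) by simp
    qed
    \<comment> \<open>Leaving the filling through its root face means crossing one of the two hole
      edges, and behind these lie \<open>f e1\<close> and \<open>f e2\<close>.\<close>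
    have hole_f: "\<theta> (Inl (opp P z)) \<in> {f e1, f e2}" if "z \<in> face P h" for z
      using that fh jhole(1) E(1,2) by (auto simp: f_def)
    have 3: "opp m' x \<in> R \<union> {f e1, f e2}" if x: "x \<in> R \<union> {f e1, f e2}" for x
    proof -
      consider y where "y \<in> ud h" "x = \<theta> (Inr (h, y))" | e where "e \<in> {e1, e2}" "x = f e" using x by (auto simp: R_def)
      then show ?thesis
      proof cases
        case (1 y)
        have o: "opp m' x = \<theta> (glue_opp P (\<lambda>h. rep_hmap (u h)) (Inr (h, y)))"
          using \<theta>D(3)[of "Inr (h, y)"] 1 h(1) by simp
        from h(1) ud_darts[OF 1(1)] show ?thesis
        proof (cases rule: ud_opp_cases)
          case 1 then show ?thesis using o glue_opp_ud[OF h(1)] Rin by simp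
        next
          case 2 then show ?thesis using o glue_opp_root[OF h(1) 2] hole_f[OF to_hole_in[OF h(1) 2]] by auto
        qed
      next
        case (2 e)
        have eS: "e \<in> e.SS - e.CC" using 2(1) E(1,2) by blast
        have o: "opp m' x = \<theta> (glue_opp P (\<lambda>h. rep_hmap (u h)) (Inl (j (Inl e))))"
          using \<theta>D(3)[of "Inl (j (Inl e))"] 2 jpd eS by (simp add: f_def)
        have oh: "opp P (j (Inl e)) \<in> face P h" using jhole(2)[OF eS] fh 2(1) by auto
        from h(1) to_root_darts[OF h(1) oh] show ?thesis
        proof (cases rule: ud_opp_cases)
          case 1 then show ?thesis using o glue_opp_hole[OF h(1) oh 1] Rin by simp
        next
          case 2 then show ?thesis using o glue_opp_hole_root[OF h(1) oh 2] hole_f[OF to_hole_in[OF h(1) 2]] by auto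
        qed
      qed
    qed
    show ?thesis
    proof (intro exI[of _ R] conjI allI impI)
      fix a' k' x assume lv': "e.loop_visits a' k'" and x: "x \<in> R \<union> {f (e.rot a'), f (inv (nxt m) (e.rot a'))}"
      have "a' = a" using e.first_loop_unique(1) lv lv' unfolding e.loop_visits_def by blast
      then show "opp m' x \<in> R \<union> {f (e.rot a'), f (inv (nxt m) (e.rot a'))}" using 3 x unfolding e1_def e2_def by simp
    qed (use 1 2 in blast)+
  qed
  then obtain R where R: "\<forall>d\<in>e.SS. f d \<notin> R" "\<forall>x\<in>R. inv (nxt m') x \<in> R"
    "\<forall>a k x. e.loop_visits a k \<longrightarrow>
      x \<in> R \<union> {f (e.rot a), f (inv (nxt m) (e.rot a))} \<longrightarrow> opp m' x \<in> R \<union> {f (e.rot a), f (inv (nxt m) (e.rot a))}"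
    by (elim exE conjE)
  interpret em: embedding m "start b m" m' "start b m'" f R
    by unfold_locales (fact f_inj f_in f_nxt f_opp f_s R[rule_format])+
  have S': "e'.SS = f ` e.SS" "e'.CC = f ` e.CC" using em.target_SS_CC by auto
  have iso: "rooted_iso (map_sum f f) c.D (discovered m' e'.SS e'.CC H')"
    using discovered_iso[OF cut cut'[unfolded S'] f_inj f_nxt f_opp f_root] unfolding S' .
  interpret c': cutting m' e'.SS e'.CC H' by (rule cut')
  obtain g where g: "rooted_iso g P c.D" "g ` marks P = H"
    using rep_class_of[OF c.qD] unfolding map_iso_def P_def r c.marks_D by blast
  have "map_iso c'.D (rep_hmap r')"
    using map_iso_sym[OF quad_with_holes_rep rep_class_of[OF c'.qD]] unfolding r' .
  then obtain j' where j': "rooted_iso j' c'.D (rep_hmap r')" "j' ` H' = marks (rep_hmap r')"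
    unfolding map_iso_def c'.marks_D by blast
  have hg: "Inr ` (e.SS - e.CC) = g ` hole_darts P"
    using iso_hole_darts[OF cP c.cD g(1)] g(2) quad_with_holesD(3)[OF qP] by (simp add: c.marks_D c.hole_D)
  have "H' \<subseteq> darts c'.D" using quad_with_holesD(3)[OF c'.qD] by (simp add: c'.marks_D)
  then have hj: "hole_darts (rep_hmap r') = j' ` Inr ` (e'.SS - e'.CC)"
    using iso_hole_darts[OF c'.cD quad_with_holesD(2)[OF quad_with_holes_rep] j'(1)] j'(2)
    by (simp add: c'.marks_D c'.hole_D)
  have "map_sum f f ` Inr ` (e.SS - e.CC) = Inr ` (e'.SS - e'.CC)"
  proof -
    have "f ` (e.SS - e.CC) = f ` e.SS - f ` e.CC" using f_inj c.CS by (simp add: inj_on_image_set_diff[of f e.SS])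
    moreover have "map_sum f f ` Inr ` (e.SS - e.CC) = Inr ` (f ` (e.SS - e.CC))"
      by (simp add: image_image)
    ultimately show ?thesis unfolding S' by simp
  qed
  then have "(j' \<circ> (map_sum f f \<circ> g)) ` hole_darts P = hole_darts (rep_hmap r')"
    unfolding hj image_comp[symmetric] hg[symmetric] by simp
  moreover have "rooted_iso (j' \<circ> (map_sum f f \<circ> g)) P (rep_hmap r')"
    by (rule rooted_iso_comp[OF rooted_iso_comp[OF g(1) iso] j'(1)])
  ultimately show ?thesis unfolding same_up_to_marks_def P_def by blast
qed

section \<open>The Markov property\<close>

text \<open>\<open>same_up_to_marks\<close> becomes equality because the marks are chosen by a rule
  depending only on the discovered map. Hence each quadrangulation of perimeter 2 contains exactly
  one of the possible values of \<open>Q\<close>.\<close>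

lemma right_cycle_rule_submap_iff:
  assumes "is_right_cycle_rule b Q" "p \<in> quads 2" "r \<in> Q ` quads 2"
  shows "Some r \<sqsubseteq> Some p \<longleftrightarrow> Q p = r"
proof -
  have rc: "right_cycle_map (rep_hmap p) (start b (rep_hmap p)) (Q p)" if "p \<in> quads 2" for p
    using assms(1) that unfolding is_right_cycle_rule_def start_def Let_def by blast
  obtain p0 where p0: "p0 \<in> quads 2" "r = Q p0" using assms(3) by blast
  show ?thesis
  proof
    assume "Some r \<sqsubseteq> Some p"
    then have "same_up_to_marks (Q p0) (Q p)"
      using right_cycle_local[OF p0(1) rc[OF p0(1)] assms(2) rc[OF assms(2)]] p0(2) by simp
    then show "Q p = r" using assms(1,2) p0 unfolding is_right_cycle_rule_def by metis
  next
    assume "Q p = r"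
    then show "Some r \<sqsubseteq> Some p" using right_cycle_submap[OF assms(2) rc[OF assms(2)]] by simp
  qed
qed

theorem proposition7p1:
  fixes M :: "'w measure" and q :: real and X :: "'w \<Rightarrow> hmap"
    and F :: "hmap option \<Rightarrow> 'w measure"
    and b :: bool and Q :: "hmap \<Rightarrow> hmap"
  assumes "prob_space M" and "complete_measure M"
    and "0 < q" and "\<And>n. (\<lambda>m. q ^ nfaces m) summable_on quads n"
    and "F = natural_filtration M X"
    and "F_boltzmann_map M q F 1 X"
    and "is_right_cycle_rule b Q"
  shows "stopping_map M F X (\<lambda>\<omega>. Some (Q (X \<omega>))) \<and>
    (AE \<omega> in M. X \<omega> = Q (X \<omega>) \<odot> filling (Q (X \<omega>)) (X \<omega>)) \<and>
    (\<forall>p. cond_indep_boltzmann M q (stopped_algebra M F (\<lambda>\<omega>. Some (Q (X \<omega>))))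
           {\<omega>\<in>space M. Q (X \<omega>) = p} p X)"
proof -
  interpret prob_space M by (rule assms(1))
  have X: "X \<in> M \<rightarrow>\<^sub>M count_space (quads 2)"
    and filt: "filtration M F"
    and ev_F: "\<And>x. {\<omega>\<in>space M. x \<sqsubseteq> Some (X \<omega>)} \<in> sets (F x)"
    and ind: "\<And>p. cond_indep_boltzmann M q (F (Some p)) {\<omega>\<in>space M. Some p \<sqsubseteq> Some (X \<omega>)} p X"
    using assms(6) unfolding F_boltzmann_map_def by auto
  have sub: "subalgebra M (F x)" for x using filt by (simp add: filtration_def)
  have Xq: "X \<omega> \<in> quads 2" if "\<omega> \<in> space M" for \<omega> using measurable_space[OF X that] by simp
  have X_sets: "{\<omega>\<in>space M. P (X \<omega>)} \<in> sets M" for P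
  proof -
    have "X -` {m \<in> quads 2. P m} \<inter> space M \<in> sets M" by (rule measurable_sets[OF X]) auto
    moreover have "X -` {m \<in> quads 2. P m} \<inter> space M = {\<omega>\<in>space M. P (X \<omega>)}" using Xq by auto
    ultimately show ?thesis by simp
  qed
  define R where "R = Q ` quads 2"
  define ev where "ev p = {\<omega>\<in>space M. Some p \<sqsubseteq> Some (X \<omega>)}" for p
  have ev_eq: "ev p = {\<omega>\<in>space M. Q (X \<omega>) = p}" if "p \<in> R" for p
    using right_cycle_rule_submap_iff[OF assms(7) Xq] that unfolding ev_def R_def by blast
  have gen: "ev p \<in> sets (F x)" if "Some p \<sqsubseteq> x" for p x
    unfolding assms(5) natural_filtration_def ev_def
  proof (rule in_measure_of)
    show "{{\<omega> \<in> space M. y \<sqsubseteq> Some (X \<omega>)} |y. y \<sqsubseteq> x} \<union> null_sets M \<subseteq> Pow (space M)"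
      using null_setsD2 sets.sets_into_space by blast
  qed (use that in blast)
  define QX where "QX \<omega> = Some (Q (X \<omega>))" for \<omega>
  have QX_sets: "{\<omega>\<in>space M. QX \<omega> \<sqsubseteq> x} \<in> sets (F x)" for x
  proof -
    \<comment> \<open>For a value \<open>p\<close> contained in \<open>x\<close>, the event
      \<open>Q = p\<close> is a generator of the natural filtration at \<open>x\<close>, and there
      are only countably many values.\<close>
    have "{\<omega>\<in>space M. QX \<omega> \<sqsubseteq> x} = (\<Union>p\<in>{p \<in> R. Some p \<sqsubseteq> x}. ev p)"
      using Xq ev_eq unfolding QX_def R_def by auto
    also have "\<dots> \<in> sets (F x)"
      using gen countable_subset[OF subset_UNIV countable_hmap] by (intro sets.countable_UN') auto
    finally show ?thesis .
  qed
  have Q_sub: "QX \<omega> \<sqsubseteq> Some (X \<omega>)" if "\<omega> \<in> space M" for \<omega>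
    unfolding QX_def using right_cycle_rule_submap_iff[OF assms(7) Xq[OF that]] Xq[OF that] by blast
  have "QX \<in> M \<rightarrow>\<^sub>M count_space UNIV"
    unfolding QX_def[abs_def] by (rule measurable_compose[OF X]) simp
  then have stop: "stopping_map M F X QX"
    unfolding stopping_map_def using Q_sub QX_sets by (auto intro: AE_I2)
  have dec: "AE \<omega> in M. X \<omega> = Q (X \<omega>) \<odot> filling (Q (X \<omega>)) (X \<omega>)"
  proof (rule AE_I2)
    fix \<omega> assume "\<omega> \<in> space M"
    then have "\<exists>u. fills (Q (X \<omega>)) u (X \<omega>)" using Q_sub[of \<omega>] unfolding QX_def by simp
    then have "fills (Q (X \<omega>)) (filling (Q (X \<omega>)) (X \<omega>)) (X \<omega>)" unfolding filling_def by (rule someI_ex)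
    then show "X \<omega> = Q (X \<omega>) \<odot> filling (Q (X \<omega>)) (X \<omega>)" by (simp add: fills_def)
  qed
  define G where "G = stopped_algebra M F QX"
  define \<T> where "\<T> = {T \<in> sigma_sets (space M) (\<Union>x. sets (F x)). \<forall>x. T \<inter> {\<omega>\<in>space M. QX \<omega> \<sqsubseteq> x} \<in> sets (F x)}"
  have FM: "sets (F x) \<subseteq> sets M" "space (F x) = space M" for x
    using sub[of x] by (auto simp: subalgebra_def)
  have \<T>M: "\<T> \<subseteq> sets M"
    using sets.sigma_sets_subset[of "\<Union>x. sets (F x)" M] FM(1) unfolding \<T>_def by blast
  have \<T>_Pow: "\<T> \<subseteq> Pow (space M)" using \<T>M sets.sets_into_space by blast
  have sets_G: "sets G = sigma_sets (space M) \<T>" and space_G: "space G = space M"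
    unfolding G_def stopped_algebra_def \<T>_def[symmetric] using \<T>_Pow by simp_all
  have subG: "subalgebra M G"
    unfolding subalgebra_def sets_G space_G using sets.sigma_sets_subset[OF \<T>M] by simp
  interpret SG: finite_measure_subalgebra M G by unfold_locales (rule subG)
  have "cond_indep_boltzmann M q G {\<omega>\<in>space M. Q (X \<omega>) = p} p X" for p
  proof (cases "p \<in> R")
    case False
    then have "{\<omega>\<in>space M. Q (X \<omega>) = p} = {}" using Xq by (auto simp: R_def)
    then show ?thesis by (simp add: cond_indep_boltzmann_def)
  next
    case True
    interpret SF: finite_measure_subalgebra M "F (Some p)" by unfold_locales (rule sub)
    note E = ev_eq[OF True]
    have EF: "ev p \<in> sets (F (Some p))" using ev_F[of "Some p"] by (simp add: ev_def)
    have EM: "ev p \<in> sets M" using EF FM by blast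
    have trace: "T \<inter> ev p \<in> sets (F (Some p))" if "T \<in> sets G" for T
      using that unfolding sets_G
    proof induct
      case (Basic T)
      then have "T \<inter> {\<omega>\<in>space M. QX \<omega> \<sqsubseteq> Some p} \<in> sets (F (Some p))" by (simp add: \<T>_def)
      then have "T \<inter> {\<omega>\<in>space M. QX \<omega> \<sqsubseteq> Some p} \<inter> ev p \<in> sets (F (Some p))" using EF by blast
      \<comment> \<open>On \<open>ev p\<close> the discovered map is \<open>p\<close>, which is a
        submap of itself.\<close>
      moreover have "T \<inter> {\<omega>\<in>space M. QX \<omega> \<sqsubseteq> Some p} \<inter> ev p = T \<inter> ev p"
        using submap_refl[of p] unfolding E QX_def by auto
      ultimately show ?case by simp
    next
      case Empty then show ?case by simp
    next
      case (Compl T)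
      have "(space M - T) \<inter> ev p = ev p - T \<inter> ev p" by (auto simp: ev_def)
      then show ?case using Compl EF by simp
    next
      case (Union T)
      have "(\<Union>i. T i) \<inter> ev p = (\<Union>i. T i \<inter> ev p)" by blast
      also have "\<dots> \<in> sets (F (Some p))" by (rule sets.countable_UN) (use Union in blast)
      finally show ?case .
    qed
    \<comment> \<open>On \<open>ev p\<close> the condition that \<open>Q\<close> is a submap of
      \<open>x\<close> is constant, so the intersection is \<open>ev p\<close> or empty.\<close>
    have EG: "ev p \<in> sets G"
    proof -
      have "ev p \<inter> {\<omega>\<in>space M. QX \<omega> \<sqsubseteq> x} \<in> sets (F x)" for x
      proof (cases "Some p \<sqsubseteq> x")
        case True
        then have "ev p \<inter> {\<omega>\<in>space M. QX \<omega> \<sqsubseteq> x} = ev p" unfolding E QX_def by auto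
        then show ?thesis using gen[OF True] by simp
      next
        case False
        then have "ev p \<inter> {\<omega>\<in>space M. QX \<omega> \<sqsubseteq> x} = {}" unfolding E QX_def by auto
        then show ?thesis by (metis sets.empty_sets)
      qed
      moreover have "ev p \<in> sigma_sets (space M) (\<Union>x. sets (F x))" using EF by (intro sigma_sets.Basic) blast
      ultimately have "ev p \<in> \<T>" by (simp add: \<T>_def)
      then show ?thesis unfolding sets_G by (rule sigma_sets.Basic)
    qed
    show ?thesis
      unfolding cond_indep_boltzmann_def E[symmetric]
    proof (intro allI impI)
      fix A assume A: "\<forall>h\<in>holes p. A h \<subseteq> quads (hole_deg p h)"
      define B where "B = ev p \<inter> {\<omega>\<in>space M. \<forall>h\<in>holes p. filling p (X \<omega>) h \<in> A h}"
      define c where "c = (\<Prod>h\<in>holes p. measure (boltzmann q (hole_deg p h)) (A h))"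
      define f where "f = (indicator B :: 'w \<Rightarrow> real)"
      define g where "g \<omega> = c * indicator (ev p) \<omega>" for \<omega>
      have BM: "B \<in> sets M" unfolding B_def by (rule sets.Int[OF EM X_sets])
      have intf: "integrable M f" unfolding f_def using BM by (simp add: emeasure_eq_measure)
      have intg: "integrable M g" unfolding g_def using EM by (simp add: emeasure_eq_measure)
      have F_ce: "AE \<omega> in M. \<omega> \<in> ev p \<longrightarrow> real_cond_exp M (F (Some p)) f \<omega> = c"
        using ind[of p] A unfolding cond_indep_boltzmann_def ev_def[symmetric] B_def[symmetric] c_def f_def
        by (simp add: B_def)
      \<comment> \<open>\<open>f\<close> vanishes off \<open>ev p\<close>, so its integral over
        \<open>T\<close> is one over \<open>T \<inter> ev p\<close>, a set of
        \<open>F (Some p)\<close>. On this set the conditional expectation given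
        \<open>F (Some p)\<close> is the constant \<open>c\<close>.\<close>
      have "AE \<omega> in M. real_cond_exp M G f \<omega> = g \<omega>"
      proof (rule SG.real_cond_exp_charact)
        show "g \<in> borel_measurable G" unfolding g_def[abs_def] using EG by simp
        fix T assume T: "T \<in> sets G"
        have TE: "T \<inter> ev p \<in> sets M" using trace[OF T] FM by blast
        have "(\<integral>\<omega>\<in>T. f \<omega> \<partial>M) = (\<integral>\<omega>\<in>T \<inter> ev p. f \<omega> \<partial>M)"
          unfolding set_lebesgue_integral_def f_def B_def by (intro Bochner_Integration.integral_cong refl) (auto split: split_indicator)
        also have "\<dots> = (\<integral>\<omega>\<in>T \<inter> ev p. real_cond_exp M (F (Some p)) f \<omega> \<partial>M)"
          by (rule SF.real_cond_exp_intA[OF intf trace[OF T]])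
        also have "\<dots> = (\<integral>\<omega>\<in>T \<inter> ev p. c \<partial>M)"
          unfolding set_lebesgue_integral_def
        proof (rule integral_cong_AE)
          show "AE \<omega> in M. indicator (T \<inter> ev p) \<omega> *\<^sub>R real_cond_exp M (F (Some p)) f \<omega> = indicator (T \<inter> ev p) \<omega> *\<^sub>R c"
            using F_ce by eventually_elim (auto split: split_indicator)
        qed (use TE in measurable)
        also have "\<dots> = (\<integral>\<omega>\<in>T. g \<omega> \<partial>M)"
          unfolding set_lebesgue_integral_def g_def by (intro Bochner_Integration.integral_cong refl) (auto split: split_indicator)
        finally show "(\<integral>\<omega>\<in>T. f \<omega> \<partial>M) = (\<integral>\<omega>\<in>T. g \<omega> \<partial>M)" .
      qed (use intf intg in auto)
      then show "AE \<omega> in M. \<omega> \<in> ev p \<longrightarrow>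
          real_cond_exp M G (indicator (ev p \<inter> {\<omega>\<in>space M. \<forall>h\<in>holes p. filling p (X \<omega>) h \<in> A h})) \<omega>
            = (\<Prod>h\<in>holes p. measure (boltzmann q (hole_deg p h)) (A h))"
        unfolding B_def[symmetric] c_def[symmetric] f_def[symmetric] by eventually_elim (simp add: g_def)
    qed
  qed
  then show ?thesis using stop dec unfolding G_def QX_def by blast
qed

end
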